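(* Let $\boldsymbol{\omega}=(\omega_1,\omega_2,\ldots)$ be a nondecreasing sequence of positive numbers tending to $+\infty$ and let $(n_k)_{k\ge 1}$ be a sequence of different positive integers satisfying Condition $\boldsymbol{A_\omega}$. Let $f:\mathbb{R}\to\mathbb{R}$ be a measurable function satisfying $$f(x+1)=f(x)\ \text{ for all } x,\qquad \int_0^1 f(x)\,dx=0,\qquad \operatorname{Var}_{[0,1]}f<+\infty .$$ Then $$N^{-1/2}\sum_{k=1}^N f(n_kx)\ \stackrel{\mathcal D}{\longrightarrow}\ \mathcal{N}(0,\|f\|^2)\qquad (N\to\infty).$$ If, moreover, there exist $\alpha>0$ and $k_0$ such that $\omega_k\ge(\log k)^\alpha$ for all $k\ge k_0$, then also $$\limsup_{N\to\infty}\frac{\sum_{k=1}^N f(n_kx)}{(2N\log\log N)^{1/2}}=\|f\| \qquad\text{for almost every } x.$$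
   Context: $\operatorname{Var}_{[0,1]}f$ is the total variation of $f$ on $[0,1]$, and $\|f\|$ is the $L_2(0,1)$ norm of $f$. The functions $f(n_kx)$ are regarded as random variables on $[0,1]$ with Lebesgue measure; $\stackrel{\mathcal D}{\longrightarrow}$ is convergence in distribution with respect to this measure, and "almost every" refers to Lebesgue measure. $\mathcal{N}(0,s^2)$ is the centered normal law with variance $s^2$ (the point mass at $0$ if $s=0$). Condition $\boldsymbol{A_\omega}$: given a nondecreasing sequence $\boldsymbol{\omega}=(\omega_1,\omega_2,\ldots)$ of positive numbers tending to $+\infty$, a sequence $(n_k)_{k\ge 1}$ of different positive integers (not necessarily increasing) satisfies Condition $\boldsymbol{A_\omega}$ if there is an $N_0$ such that for every $N\ge N_0$ the following holds: whenever $r$ is an integer with $2\le r\le\omega_N$, the indices $k_1,\ldots,k_r$ are pairwise different, and $a_1,\ldots,a_r$ are nonzero integers with $0<|a_1|,\ldots,|a_r|\le N^{\omega_N}$ such that $$a_1n_{k_1}+\cdots+a_rn_{k_r}=0,$$ then all of $n_{k_1},\ldots,n_{k_r}$ belong to the set of the $N$ smallest elements of the sequence $(n_k)_{k\ge 1}$. *)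

theory Defs
  imports "HOL-Probability.Probability"
begin

text \<open>
  Sequences are indexed by the positive integers: for a function on \<^typ>\<open>nat\<close> only the
  values at arguments \<open>\<ge> 1\<close> matter.
\<close>

definition total_variation_on :: "real \<Rightarrow> real \<Rightarrow> (real \<Rightarrow> real) \<Rightarrow> ennreal" where
  "total_variation_on a b f =
     (SUP (m, t) \<in> {(m :: nat, t :: nat \<Rightarrow> real). t 0 = a \<and> t m = b \<and> mono_on {..m} t}.
        \<Sum>i<m. ennreal \<bar>f (t (Suc i)) - f (t i)\<bar>)"

definition L2_norm01 :: "(real \<Rightarrow> real) \<Rightarrow> real" where
  "L2_norm01 f = sqrt (LINT x|lebesgue_on {0..1}. (f x)\<^sup>2)"

text \<open>The second parameter of \<^const>\<open>normal_density\<close> is the standard deviation, hence the root.\<close>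

definition centered_normal :: "real \<Rightarrow> real measure" where
  "centered_normal v =
     (if v = 0 then return borel 0
      else density lborel (\<lambda>x. ennreal (normal_density 0 (sqrt v) x)))"

text \<open>
  The elements of the sequence are the members of \<open>n ` {1..}\<close>, which is an infinite set as
  \<open>n\<close> is injective there, so \<^const>\<open>enumerate\<close> lists it in increasing order.
\<close>

definition smallest_elements :: "(nat \<Rightarrow> nat) \<Rightarrow> nat \<Rightarrow> nat set" where
  "smallest_elements n N = enumerate (n ` {1..}) ` {..<N}"

definition condition_A :: "(nat \<Rightarrow> real) \<Rightarrow> (nat \<Rightarrow> nat) \<Rightarrow> bool" where
  "condition_A \<omega> n \<longleftrightarrow>
     (\<exists>N0\<ge>1. \<forall>N\<ge>N0. \<forall>(r :: nat) (k :: nat \<Rightarrow> nat) (a :: nat \<Rightarrow> int).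
        2 \<le> r \<longrightarrow> real r \<le> \<omega> N \<longrightarrow>
        k ` {1..r} \<subseteq> {1..} \<longrightarrow> inj_on k {1..r} \<longrightarrow>
        (\<forall>i\<in>{1..r}. a i \<noteq> 0 \<and> real_of_int \<bar>a i\<bar> \<le> real N powr \<omega> N) \<longrightarrow>
        (\<Sum>i=1..r. a i * int (n (k i))) = 0 \<longrightarrow>
        (\<forall>i\<in>{1..r}. n (k i) \<in> smallest_elements n N))"

end

theory Submission
  imports Defs "HOL-Real_Asymp.Real_Asymp"
begin

text \<open>
  Let \<open>p\<close> be the Fejer mean of \<open>f\<close> of degree \<open>M\<^sup>K\<close>, where \<open>M\<close> is a small power of \<open>N\<close> and \<open>K\<close> is a
  large constant. Since \<open>f\<close> has bounded variation, \<open>f - p\<close> is smaller than any given power of \<open>1 / N\<close>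
  in \<open>L\<^sup>1\<close>, and \<open>p\<close> has the same bound as \<open>f\<close>. Apart from at most \<open>M\<close> indices, whose contribution is
  negligible, Condition A excludes every relation of few terms with coefficients of the size of the
  degree. Expanding powers into characters, one sees that the sums of \<open>p (n k x)\<close> and those of
  \<open>p (U k)\<close>, with independent uniform \<open>U k\<close>, have exactly the same joint moments up to an order \<open>s\<close>
  tending to infinity. As the latter are sub-Gaussian, characteristic functions at arguments small
  compared with \<open>sqrt s\<close> differ by at most about \<open>exp (-s)\<close>, and the central limit theorem follows
  from the one for independent variables.

  For the law of the iterated logarithm, moments of order \<open>ln (ln N)\<close> suffice. Chernoff bounds with
  truncated exponentials control the sums on a grid in \<open>[2\<^sup>j, 2\<^bsup>j + 1\<^esup>]\<close>, and dyadic chaining does so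
  between the grid points; this is the upper half. For the lower half, trigonometric bump functions
  of the sums over blocks \<open>(2\<^bsup>h i\<^esup>, 2\<^bsup>h (i + 1)\<^esup>]\<close> with \<open>J \<le> i < 2 J\<close> are nearly uncorrelated, and
  their means, nearly those of the independent model, have a large sum; by the second moment method
  some block sum is then as large as required, except on a set whose measure tends to zero.
\<close>

section \<open>Functions of bounded variation\<close>

text \<open>Condition A leaves the M smallest elements unrestricted, so it is applied at an index M
  that is a small power of the number N of summands: the at most M exceptional terms then contribute
  o(sqrt N), while a degree \<open>M ^ (2 * L)\<close> with fixed L still lies below
  \<open>real M powr \<omega> M\<close>, because \<omega> tends to infinity. This is why the central
  limit theorem holds however slowly \<omega> grows. No cancellation is sought in the L1 error:
  every dilation preserves the measure, so the N errors are added up, and L is taken large enough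
  for the total to vanish.

  Agreement of moments stops at an order s that may grow slowly. Exponential moments and indicators
  therefore cannot be compared directly, only polynomials of degree at most s and, up to a small
  error, characters. Even moments carry the sub-Gaussian bound over from the independent model. In
  the lower half the bumps are powers of a cosine because these are combinations of few characters
  with coefficients of total modulus 1, so errors are not amplified. Such a bump is periodic; a tail
  bound confines the normalised sums to a single hump.\<close>

lemma total_variation_add_le:
  assumes "a \<le> x" "x \<le> y"
  shows "total_variation_on a x f + ennreal \<bar>f y - f x\<bar> \<le> total_variation_on a y f"
proof -
  let ?P = "\<lambda>x. {(m :: nat, t :: nat \<Rightarrow> real). t 0 = a \<and> t m = x \<and> mono_on {..m} t}"
  let ?S = "\<lambda>(m, t). \<Sum>i<m. ennreal \<bar>f (t (Suc i)) - f (t i)\<bar>"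
  \<comment> \<open>A constant can be moved into a supremum over a nonempty set only; the one-step
    partition is the witness.\<close>
  have "(1, \<lambda>i. if i = 0 then a else x) \<in> ?P x"
    using assms by (auto simp: mono_on_def)
  then have ne: "?P x \<noteq> {}" by blast
  have "total_variation_on a x f + ennreal \<bar>f y - f x\<bar>
      = (SUP p \<in> ?P x. ?S p + ennreal \<bar>f y - f x\<bar>)"
    unfolding total_variation_on_def using ne by (subst ennreal_SUP_add_left[symmetric]) (auto simp: case_prod_unfold)
  also have "\<dots> \<le> (SUP p \<in> ?P y. ?S p)"
  proof (rule SUP_mono)
    fix p assume p: "p \<in> ?P x"
    obtain m t where mt: "p = (m, t)" by (cases p)
    have t: "t 0 = a" "t m = x" "mono_on {..m} t" using p mt by auto
    \<comment> \<open>Append y as one more partition point. Partitions may repeat points, so x = y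
      is no exception.\<close>
    define t' where "t' = t(Suc m := y)"
    have "mono_on {..Suc m} t'"
    proof (rule mono_onI)
      fix r s assume rs: "r \<in> {..Suc m}" "s \<in> {..Suc m}" "r \<le> s"
      show "t' r \<le> t' s"
      proof (cases "s = Suc m")
        case True
        have "r \<le> m \<Longrightarrow> t r \<le> t m" using t(3) by (auto simp: mono_on_def)
        then show ?thesis using True rs assms(2) t(2) by (auto simp: t'_def le_Suc_eq)
      next
        case False
        then show ?thesis using rs t(3) by (auto simp: t'_def mono_on_def)
      qed
    qed
    moreover have "?S (Suc m, t') = ?S (m, t) + ennreal \<bar>f y - f x\<bar>"
      using t(2) by (auto simp: t'_def intro!: arg_cong2[where f = "(+)"] sum.cong)
    ultimately show "\<exists>q\<in>?P y. ?S p + ennreal \<bar>f y - f x\<bar> \<le> ?S q"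
      using mt t by (intro bexI[of _ "(Suc m, t')"]) (auto simp: t'_def)
  qed
  finally show ?thesis by (simp add: total_variation_on_def)
qed

lemma periodic_add_int:
  fixes g :: "real \<Rightarrow> 'a"
  assumes per: "\<And>x. g (x + 1) = g x"
  shows "g (x + of_int k) = g x"
proof -
  have shift: "g (x + of_nat k) = g x" for x and k :: nat
  proof (induction k)
    case (Suc k)
    then show ?case using per[of "x + of_nat k"] by (simp add: algebra_simps)
  qed simp
  show ?thesis
  proof (cases "k \<ge> 0")
    case True then show ?thesis using shift[of x "nat k"] by simp
  next
    case False then show ?thesis using shift[of "x + of_int k" "nat (-k)"] by simp
  qed
qed

text \<open>The codomain is left open because the fact also serves for predicates, in
  \<open>AE_lebesgue_periodic\<close>.\<close>

lemma periodic_frac: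
  fixes g :: "real \<Rightarrow> 'a"
  assumes per: "\<And>x. g (x + 1) = g x"
  shows "g (frac x) = g x"
  using periodic_add_int[of g "frac x" "\<lfloor>x\<rfloor>", OF per] by (simp add: frac_def)

text \<open>
  The variation function of a periodic function, continued to the real line so that
  \<open>w x - V x\<close> is periodic.
\<close>

lemma bounded_variation_majorant:
  assumes per: "\<And>x. f (x + 1) = f x" and bv: "total_variation_on 0 1 f < \<infinity>"
  obtains w :: "real \<Rightarrow> real" and V :: real
  where "\<And>x. w (x + 1) = w x + V" "\<And>x y. x \<le> y \<Longrightarrow> \<bar>f y - f x\<bar> \<le> w y - w x"
proof -
  define v where "v x = enn2real (total_variation_on 0 x f)" for x
  have fin: "total_variation_on 0 x f < \<infinity>" if "0 \<le> x" "x \<le> 1" for x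
    using total_variation_add_le[OF that, of f] bv
    by (metis add.commute ennreal_add_eq_top infinity_ennreal_def top.not_eq_extremum top.extremum_strict
        order_le_less_trans)
  have v: "\<bar>f y - f x\<bar> \<le> v y - v x" if "0 \<le> x" "x \<le> y" "y \<le> 1" for x y
  proof -
    have "ennreal (v x + \<bar>f y - f x\<bar>) \<le> ennreal (v y)"
      using total_variation_add_le[OF that(1,2), of f] fin[of x] fin[of y] that
      by (simp add: v_def ennreal_plus less_top)
    then show ?thesis by (subst (asm) ennreal_le_iff) (auto simp: v_def)
  qed
  define V where "V = v 1 - v 0"
  define w where "w x = v (frac x) + V * of_int \<lfloor>x\<rfloor>" for x
  have V0: "V \<ge> 0" using v[of 0 1] by (simp add: V_def)
  have frac_add: "frac (x + 1) = frac x" for x :: real by (simp add: frac_def)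
  note ffrac = periodic_frac[of f, OF per, symmetric]
  have fr: "0 \<le> frac x" "frac x \<le> 1" for x :: real using frac_lt_1[of x] by (auto simp: less_imp_le)
  show thesis
  proof
    fix x show "w (x + 1) = w x + V"
      unfolding w_def frac_add by (simp add: algebra_simps)
  next
    fix x y :: real assume xy: "x \<le> y"
    then have fl: "\<lfloor>x\<rfloor> \<le> \<lfloor>y\<rfloor>" by (rule floor_mono)
    show "\<bar>f y - f x\<bar> \<le> w y - w x"
    proof (cases "\<lfloor>x\<rfloor> = \<lfloor>y\<rfloor>")
      case True
      then have "frac x \<le> frac y" using xy by (simp add: frac_def)
      then show ?thesis using v[of "frac x" "frac y"] fr True by (simp add: w_def ffrac[of x] ffrac[of y])
    next
      case False
      then have "real_of_int \<lfloor>y\<rfloor> - real_of_int \<lfloor>x\<rfloor> \<ge> 1" using fl by linarith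
      then have 1: "V * real_of_int \<lfloor>y\<rfloor> - V * real_of_int \<lfloor>x\<rfloor> \<ge> V"
        using mult_left_mono[OF _ V0] by (fastforce simp: right_diff_distrib[symmetric])
      \<comment> \<open>Across an integer: climb from \<open>frac x\<close> to 1, pass to 0 by
        periodicity, and climb to \<open>frac y\<close>. At least one full V is available for the
        two pieces.\<close>
      have "\<bar>f y - f x\<bar> \<le> \<bar>f (frac y) - f 0\<bar> + \<bar>f 1 - f (frac x)\<bar>"
        using per[of 0] by (simp add: ffrac[of x] ffrac[of y])
      also have "\<dots> \<le> (v (frac y) - v 0) + (v 1 - v (frac x))"
        using v[of 0 "frac y"] v[of "frac x" 1] fr by (intro add_mono) auto
      also have "\<dots> \<le> w y - w x" using 1 by (simp add: w_def V_def algebra_simps)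
      finally show ?thesis .
    qed
  qed
qed

section \<open>The uniform distribution on the circle\<close>

text \<open>Haar measure of the circle R/Z, placed on [0, 1). Keeping the Borel sets of the whole
  line lets periodic functions be integrated without restricting them.\<close>

definition circ :: "real measure" where
  "circ = uniform_measure lborel {0..<1}"

lemma sets_circ [simp, measurable_cong]: "sets circ = sets borel"
  and space_circ [simp]: "space circ = UNIV"
  by (auto simp: circ_def)

lemma prob_space_circ: "prob_space circ"
  unfolding circ_def by (rule prob_space_uniform_measure) auto

interpretation circ: prob_space circ by (rule prob_space_circ)

lemma nn_integral_circ:
  "g \<in> borel_measurable borel \<Longrightarrow> (\<integral>\<^sup>+x. g x \<partial>circ) = (\<integral>\<^sup>+x. g x * indicator {0..<1} x \<partial>lborel)"
  unfolding circ_def by (subst nn_integral_uniform_measure) (auto simp: divide_ennreal_def)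

text \<open>Cut the interval [a, a + 1) at the integer in it and shift both pieces into [0,
  1).\<close>

lemma nn_integral_period:
  fixes g :: "real \<Rightarrow> ennreal"
  assumes [measurable]: "g \<in> borel_measurable borel" and per: "\<And>x. g (x + 1) = g x"
  shows "(\<integral>\<^sup>+x. g x * indicator {a..<a+1} x \<partial>lborel) = (\<integral>\<^sup>+x. g x \<partial>circ)"
proof -
  note shift_int = periodic_add_int[of g, OF per]
  have tr: "(\<integral>\<^sup>+x. g x * indicator {c..<d} x \<partial>lborel)
      = (\<integral>\<^sup>+x. g x * indicator {c - of_int k..<d - of_int k} x \<partial>lborel)" for c d and k :: int
  proof -
    have "(\<integral>\<^sup>+x. g x * indicator {c..<d} x \<partial>lborel)
        = (\<integral>\<^sup>+x. g (of_int k + 1 * x) * indicator {c..<d} (of_int k + 1 * x) \<partial>lborel)"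
      by (subst nn_integral_real_affine[where c = 1 and t = "of_int k"]) auto
    also have "\<dots> = (\<integral>\<^sup>+x. g x * indicator {c - of_int k..<d - of_int k} x \<partial>lborel)"
      using shift_int by (intro nn_integral_cong) (auto simp: add.commute indicator_def)
    finally show ?thesis .
  qed
  have split: "(\<integral>\<^sup>+x. g x * indicator {c..<e} x \<partial>lborel) =
      (\<integral>\<^sup>+x. g x * indicator {c..<d} x \<partial>lborel) + (\<integral>\<^sup>+x. g x * indicator {d..<e} x \<partial>lborel)"
    if "c \<le> d" "d \<le> e" for c d e
    using that by (subst nn_integral_add[symmetric]) (auto intro!: nn_integral_cong simp: indicator_def)
  define k where "k = \<lceil>a\<rceil>"
  define b where "b = a - of_int k + 1"
  have k: "a \<le> of_int k" "of_int k < a + 1" unfolding k_def by linarith+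
  have "(\<integral>\<^sup>+x. g x * indicator {a..<a+1} x \<partial>lborel)
      = (\<integral>\<^sup>+x. g x * indicator {b..<1} x \<partial>lborel) + (\<integral>\<^sup>+x. g x * indicator {0..<b} x \<partial>lborel)"
    using split[of a "of_int k" "a + 1"] tr[of a "of_int k" "k - 1"] tr[of "of_int k" "a + 1" k] k
    by (simp add: b_def algebra_simps)
  also have "\<dots> = (\<integral>\<^sup>+x. g x * indicator {0..<1} x \<partial>lborel)"
    using split[of 0 b 1] k by (simp add: b_def add.commute)
  finally show ?thesis by (simp add: nn_integral_circ)
qed

text \<open>A dilation by n winds the circle n times around itself and stretches lengths by n:
  substitution gives the integral over n consecutive periods divided by n.\<close>

lemma distr_circ_affine:
  assumes "n > 0"
  shows "distr circ borel (\<lambda>x. frac (real n * x + t)) = circ"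
proof (rule measure_eqI)
  fix A assume "A \<in> sets (distr circ borel (\<lambda>x. frac (real n * x + t)))"
  then have A[measurable]: "A \<in> sets borel" by simp
  define g :: "real \<Rightarrow> ennreal" where "g x = indicator A (frac x)" for x
  have [measurable]: "g \<in> borel_measurable borel" unfolding g_def frac_def by measurable
  have gper: "g (x + 1) = g x" for x by (simp add: g_def frac_def)
  have "emeasure (distr circ borel (\<lambda>x. frac (real n * x + t))) A = (\<integral>\<^sup>+x. g (t + real n * x) \<partial>circ)"
    by (subst nn_integral_indicator[symmetric], simp, subst nn_integral_distr)
       (auto simp: g_def add.commute frac_def)
  also have "\<dots> = (\<integral>\<^sup>+x. g (t + real n * x) * indicator {t..<t + real n} (t + real n * x) \<partial>lborel)"
    using assms by (subst nn_integral_circ)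
      (auto intro!: nn_integral_cong simp: indicator_def zero_le_mult_iff)
  also have "real n * \<dots> = (\<integral>\<^sup>+x. g x * indicator {t..<t + real n} x \<partial>lborel)"
    using assms by (subst (2) nn_integral_real_affine[where c = "real n" and t = t])
      (auto simp: ennreal_of_nat_eq_real_of_nat)
  also have "(\<integral>\<^sup>+x. g x * indicator {t..<t + real n} x \<partial>lborel)
      = of_nat n * (\<integral>\<^sup>+x. g x \<partial>circ)" for n
  proof (induction n)
    case 0 then show ?case by simp
  next
    case (Suc n)
    have "(\<integral>\<^sup>+x. g x * indicator {t..<t + real (Suc n)} x \<partial>lborel)
      = (\<integral>\<^sup>+x. g x * indicator {t..<t + real n} x \<partial>lborel)
        + (\<integral>\<^sup>+x. g x * indicator {t + real n..<t + real n + 1} x \<partial>lborel)"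
      by (subst nn_integral_add[symmetric]) (auto intro!: nn_integral_cong simp: indicator_def)
    then show ?case using nn_integral_period[of g "t + real n"] Suc gper by (simp add: distrib_right add.commute)
  qed
  finally have "of_nat n * emeasure (distr circ borel (\<lambda>x. frac (real n * x + t))) A
      = of_nat n * (\<integral>\<^sup>+x. g x \<partial>circ)" by (simp add: ennreal_of_nat_eq_real_of_nat)
  then have "emeasure (distr circ borel (\<lambda>x. frac (real n * x + t))) A = (\<integral>\<^sup>+x. g x \<partial>circ)"
    using assms by (subst (asm) ennreal_mult_cancel_left) auto
  also have "\<dots> = (\<integral>\<^sup>+x. indicator A x \<partial>circ)"
    by (subst (1 2) nn_integral_circ) (auto intro!: nn_integral_cong simp: g_def indicator_def frac_eq_id)
  finally show "emeasure (distr circ borel (\<lambda>x. frac (real n * x + t))) A = emeasure circ A" by simp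
qed simp

lemma integral_circ_affine:
  fixes g :: "real \<Rightarrow> 'a :: {banach, second_countable_topology}"
  assumes [measurable]: "g \<in> borel_measurable borel" and per: "\<And>x. g (x + 1) = g x" and n: "n > 0"
  shows "(\<integral>x. g (real n * x + t) \<partial>circ) = (\<integral>x. g x \<partial>circ)"
proof -
  have m[measurable]: "(\<lambda>x. frac (real n * x + t)) \<in> borel_measurable circ"
    unfolding frac_def by measurable
  have "(\<integral>x. g x \<partial>circ) = (\<integral>x. g x \<partial>distr circ borel (\<lambda>x. frac (real n * x + t)))"
    by (simp add: distr_circ_affine n)
  also have "\<dots> = (\<integral>x. g (real n * x + t) \<partial>circ)"
    by (subst integral_distr) (auto simp: periodic_frac[of g, OF per])
  finally show ?thesis ..
qed

lemma integrable_circ_bounded: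
  fixes g :: "real \<Rightarrow> 'a :: {banach, second_countable_topology}"
  assumes "g \<in> borel_measurable borel" "\<And>x. norm (g x) \<le> C"
  shows "integrable circ g"
  by (rule circ.integrable_const_bound[of _ C]) (use assms in auto)

lemma integral_circ_cis:
  "(\<integral>x. cis (2 * pi * of_int m * x) \<partial>circ) = (if m = 0 then 1 else 0)"
proof (cases "m = 0")
  case True then show ?thesis by (simp add: circ.prob_space[simplified])
next
  case False
  define e where "e x = cis (2 * pi * of_int m * x)" for x :: real
  have [measurable]: "e \<in> borel_measurable borel"
    unfolding e_def by (intro borel_measurable_continuous_onI continuous_intros)
  have per: "e (x + 1) = e x" for x
  proof -
    have "cis (2 * pi * of_int m) = 1"
      using cis_multiple_2pi[of "of_int m"] by simp
    then show ?thesis by (simp add: e_def distrib_left cis_mult[symmetric])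
  qed
  \<comment> \<open>Translation by half a period of the character changes its sign but not its
    integral.\<close>
  define t where "t = 1 / (2 * of_int m :: real)"
  have "e (x + t) = - e x" for x
    using False by (simp add: e_def t_def distrib_left cis_mult[symmetric])
  then have "(\<integral>x. e x \<partial>circ) = (\<integral>x. - e x \<partial>circ)"
    using integral_circ_affine[of e 1 t] per by simp
  then show ?thesis using False by (simp add: e_def)
qed

lemma integral_circ_shift:
  fixes g :: "real \<Rightarrow> 'a :: {banach, second_countable_topology}"
  assumes "g \<in> borel_measurable borel" "\<And>x. g (x + 1) = g x"
  shows "(\<integral>x. g (x + t) \<partial>circ) = (\<integral>x. g x \<partial>circ)"
  using integral_circ_affine[of g 1 t] assms by simp

text \<open>The L1 modulus of continuity of a function of bounded variation. The increment is at
  most \<open>w (x + t) - w x\<close>, whose mean is \<open>V * t\<close> because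
  \<open>w x - V * x\<close> is periodic and its translation drops out. The bound with
  \<open>1 - t\<close> comes from going round the circle the other way, from x + t to x + 1.\<close>

lemma integral_circ_translation_diff_le:
  assumes [measurable]: "f \<in> borel_measurable borel" and C: "\<And>x. \<bar>f x\<bar> \<le> C"
    and per: "\<And>x. f (x + 1) = f x"
    and w1: "\<And>x. w (x + 1) = w x + V" and w: "\<And>x y. x \<le> y \<Longrightarrow> \<bar>f y - f x\<bar> \<le> w y - w x"
    and t: "0 \<le> t" "t \<le> 1"
  shows "(\<integral>x. \<bar>f (x + t) - f x\<bar> \<partial>circ) \<le> V * min t (1 - t)"
proof -
  have "mono w" using w by (force simp: mono_def)
  then have [measurable]: "w \<in> borel_measurable borel" by (rule borel_measurable_mono)
  define g where "g x = w x - V * x" for x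
  have [measurable]: "g \<in> borel_measurable borel" unfolding g_def by measurable
  have gper: "g (x + 1) = g x" for x unfolding g_def w1 by (simp add: algebra_simps)
  have gb: "\<bar>g x\<bar> \<le> \<bar>w 0\<bar> + \<bar>w 1\<bar> + \<bar>V\<bar>" for x
  proof -
    have "0 \<le> frac x" "frac x \<le> 1" using frac_lt_1[of x] by auto
    moreover from this have "w 0 \<le> w (frac x)" "w (frac x) \<le> w 1" using \<open>mono w\<close> by (auto simp: mono_def)
    moreover have "\<bar>V * frac x\<bar> \<le> \<bar>V\<bar>" using calculation(1,2) by (simp add: abs_mult mult_left_le)
    ultimately have "\<bar>g (frac x)\<bar> \<le> \<bar>w 0\<bar> + \<bar>w 1\<bar> + \<bar>V\<bar>" unfolding g_def by linarith
    then show ?thesis using periodic_frac[of g, OF gper] by simp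
  qed
  have gi: "integrable circ (\<lambda>x. g (x + s))" for s
    using gb by (intro integrable_circ_bounded) auto
  have gi0: "integrable circ g" using gi[of 0] by simp
  have "\<bar>f (x + t) - f x\<bar> \<le> 2 * C" for x using C[of x] C[of "x + t"] by linarith
  then have fi: "integrable circ (\<lambda>x. \<bar>f (x + t) - f x\<bar>)"
    by (intro integrable_circ_bounded[of _ "2 * C"]) auto
  have "\<bar>f (x + t) - f x\<bar> \<le> g (x + t) - g x + V * t" for x
    using w[of x "x + t"] t by (simp add: g_def algebra_simps)
  then have "(\<integral>x. \<bar>f (x + t) - f x\<bar> \<partial>circ) \<le> (\<integral>x. g (x + t) - g x + V * t \<partial>circ)"
    by (intro integral_mono) (use fi gi gi0 in auto)
  also have "\<dots> = V * t"
    using gi gi0 integral_circ_shift[of g t] gper by (simp add: circ.prob_space[simplified])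
  finally have 1: "(\<integral>x. \<bar>f (x + t) - f x\<bar> \<partial>circ) \<le> V * t" .
  have "\<bar>f (x + t) - f x\<bar> \<le> g x - g (x + t) + V * (1 - t)" for x
    using w[of "x + t" "x + 1"] t per[of x] w1[of x] by (simp add: g_def algebra_simps abs_minus_commute)
  then have "(\<integral>x. \<bar>f (x + t) - f x\<bar> \<partial>circ) \<le> (\<integral>x. g x - g (x + t) + V * (1 - t) \<partial>circ)"
    by (intro integral_mono) (use fi gi gi0 in auto)
  also have "\<dots> = V * (1 - t)"
    using gi gi0 integral_circ_shift[of g t] gper by (simp add: circ.prob_space[simplified])
  finally show ?thesis using 1 by (auto simp: min_def)
qed

section \<open>Fejer means\<close>

text \<open>A weak form of Jordan's inequality, x / pi instead of 2 x / pi, for which the cubic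
  Taylor bound and 3 < pi < 3.2 suffice. It converts the distance to the nearest integer into the
  quantity that cancels the peak of the Fejer kernel.\<close>

lemma min_le_sin_pi:
  assumes "0 \<le> t" "t \<le> 1"
  shows "min t (1 - t) \<le> sin (pi * t)"
proof -
  have *: "x / pi \<le> sin x" if x: "0 \<le> x" "x \<le> pi / 2" for x
  proof -
    have p: "3 < pi" "pi < 3.2" using pi_approx by auto
    have "\<bar>sin x - x\<bar> \<le> inverse (fact 3) * \<bar>x\<bar> ^ 3"
      using Maclaurin_sin_bound[of x 3] by (simp add: numeral_3_eq_3 lessThan_Suc sin_coeff_def)
    moreover have "fact 3 = (6::real)" by (simp add: fact_numeral)
    ultimately have "sin x \<ge> x - x ^ 3 / 6" using x by (simp add: abs_if split: if_splits)
    moreover have "x ^ 3 \<le> x * (1.6 ^ 2)"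
    proof -
      have "x ^ 2 \<le> 1.6 ^ 2" using x p by (intro power_mono) auto
      then have "x * x ^ 2 \<le> x * 1.6 ^ 2" by (rule mult_left_mono) (rule x(1))
      then show ?thesis by (simp add: power3_eq_cube power2_eq_square mult.assoc)
    qed
    moreover have "x / pi \<le> x / 3" using x p by (intro divide_left_mono) auto
    ultimately show ?thesis using x by (simp add: power2_eq_square)
  qed
  show ?thesis
  proof (cases "t \<le> 1/2")
    case True
    then show ?thesis using *[of "pi * t"] assms by simp
  next
    case False
    have "sin (pi * t) = sin (pi * (1 - t))" by (simp add: right_diff_distrib sin_diff)
    then show ?thesis using *[of "pi * (1 - t)"] assms False by simp
  qed
qed

text \<open>Only the range of frequencies is recorded. Coefficients are never estimated; all bounds
  come from the supremum of p.\<close>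

definition trig_poly :: "nat \<Rightarrow> (real \<Rightarrow> real) \<Rightarrow> bool" where
  "trig_poly D p \<longleftrightarrow> (\<exists>c :: int \<Rightarrow> complex. \<forall>x. complex_of_real (p x) =
     (\<Sum>a\<in>{- int D..int D}. c a * cis (2 * pi * of_int a * x)))"

lemma cis_2pi_int [simp]: "cis (2 * pi * of_int m) = 1"
  using cis_multiple_2pi[of "of_int m"] by simp

lemma borel_measurable_cis [measurable]:
  "g \<in> borel_measurable M \<Longrightarrow> (\<lambda>x. cis (g x)) \<in> borel_measurable M"
  by (rule measurable_compose[of g M borel])
     (auto intro!: borel_measurable_continuous_onI continuous_intros)

lemma trig_poly_borel_measurable:
  assumes "trig_poly D p" shows "p \<in> borel_measurable borel"
proof -
  obtain c where c: "\<And>x. complex_of_real (p x) = (\<Sum>a\<in>{- int D..int D}. c a * cis (2 * pi * of_int a * x))"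
    using assms unfolding trig_poly_def by blast
  have "p = (\<lambda>x. Re (\<Sum>a\<in>{- int D..int D}. c a * cis (2 * pi * of_int a * x)))"
    by (subst c[symmetric]) simp
  also have "\<dots> \<in> borel_measurable borel" by measurable
  finally show ?thesis .
qed

lemma trig_poly_periodic:
  assumes "trig_poly D p" shows "p (x + 1) = p x"
proof -
  obtain c where c: "\<And>x. complex_of_real (p x) = (\<Sum>a\<in>{- int D..int D}. c a * cis (2 * pi * of_int a * x))"
    using assms unfolding trig_poly_def by blast
  have "complex_of_real (p (x + 1)) = complex_of_real (p x)"
    unfolding c by (simp add: distrib_left cis_mult[symmetric])
  then show ?thesis by simp
qed

text \<open>The Fejer kernel as a squared modulus, which makes nonnegativity evident; its
  frequencies are differences of numbers below D.\<close>

definition fejer :: "nat \<Rightarrow> real \<Rightarrow> real" where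
  "fejer D t = (cmod (\<Sum>k<D. cis (2 * pi * real k * t)))\<^sup>2 / real D"

lemma fejer_nonneg: "fejer D t \<ge> 0" by (simp add: fejer_def)

lemma fejer_borel_measurable [measurable]: "fejer D \<in> borel_measurable borel"
  unfolding fejer_def by measurable

lemma fejer_le:
  shows "\<bar>fejer D t\<bar> \<le> real D"
proof -
  have "cmod (\<Sum>k<D. cis (2 * pi * real k * t)) \<le> real D"
    using sum_norm_le[of "{..<D}" "\<lambda>k. cis (2 * pi * real k * t)" "\<lambda>_. 1"] by simp
  then have "(cmod (\<Sum>k<D. cis (2 * pi * real k * t)))\<^sup>2 \<le> real D * real D"
    unfolding power2_eq_square by (intro mult_mono) auto
  then show ?thesis by (cases "D = 0") (simp_all add: fejer_def divide_le_eq)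
qed

lemma fejer_periodic: "fejer D (t + 1) = fejer D t"
proof -
  have "cis (2 * pi * real k * (t + 1)) = cis (2 * pi * real k * t)" for k
    using cis_2pi_int[of "int k"] by (simp add: distrib_left cis_mult[symmetric])
  then show ?thesis by (simp add: fejer_def)
qed

lemma of_real_fejer:
  "complex_of_real (fejer D t) =
     (\<Sum>(k, l) \<in> {..<D} \<times> {..<D}. cis (2 * pi * of_int (int k - int l) * t)) / of_nat D"
proof -
  have "complex_of_real (fejer D t)
      = (\<Sum>k<D. cis (2 * pi * real k * t)) * cnj (\<Sum>k<D. cis (2 * pi * real k * t)) / of_nat D"
    unfolding fejer_def of_real_divide complex_norm_square by simp
  also have "(\<Sum>k<D. cis (2 * pi * real k * t)) * cnj (\<Sum>k<D. cis (2 * pi * real k * t))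
      = (\<Sum>(k, l) \<in> {..<D} \<times> {..<D}. cis (2 * pi * of_int (int k - int l) * t))"
    unfolding cnj_sum sum_product sum.cartesian_product
    by (intro sum.cong) (auto simp: cis_cnj cis_mult algebra_simps)
  finally show ?thesis .
qed

lemma integral_fejer:
  assumes "D > 0"
  shows "(\<integral>t. fejer D t \<partial>circ) = 1"
proof -
  have i: "integrable circ (\<lambda>t. cis (2 * pi * of_int m * t))" for m :: int
    by (rule integrable_circ_bounded[of _ 1]) auto
  have *: "(\<integral>t. (\<Sum>z\<in>A. cis (2 * pi * of_int (g z) * t)) / of_nat D \<partial>circ)
      = (\<Sum>z\<in>A. if g z = 0 then 1 else 0) / of_nat D" for g :: "nat \<times> nat \<Rightarrow> int" and A
    using i integral_circ_cis by simp
  have "complex_of_real (\<integral>t. fejer D t \<partial>circ) = (\<integral>t. complex_of_real (fejer D t) \<partial>circ)" by simp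
  also have "\<dots> = (\<Sum>(k, l) \<in> {..<D} \<times> {..<D}. if k = l then 1 else 0) / of_nat D"
    unfolding of_real_fejer case_prod_unfold * by (simp cong: sum.cong)
  also have "(\<Sum>(k, l) \<in> {..<D} \<times> {..<D}. if k = l then 1 else 0) = (\<Sum>k<D. \<Sum>l<D. if k = l then 1 else (0::complex))"
    by (rule sum.cartesian_product[symmetric])
  also have "\<dots> = of_nat D" by (simp add: sum.delta)
  finally show ?thesis using assms by simp
qed

text \<open>Geometric sum: multiplied by \<open>1 - cis (2 * pi * t)\<close>, of modulus 2 |sin (pi
  t)|, it becomes a difference of two unit vectors. The multiplied form also covers the zeros of the
  sine.\<close>

lemma fejer_sin_le:
  assumes "D > 0"
  shows "fejer D t * (sin (pi * t))\<^sup>2 \<le> 1 / real D"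
proof -
  let ?S = "\<Sum>k<D. cis (2 * pi * real k * t)"
  have "?S = (\<Sum>k<D. cis (2 * pi * t) ^ k)"
    by (intro sum.cong) (simp_all add: Complex.DeMoivre mult_ac)
  then have "?S * (1 - cis (2 * pi * t)) = 1 - cis (2 * pi * t) ^ D"
    by (simp add: sum_gp_basic[of _ "D - 1"] one_diff_power_eq mult.commute lessThan_Suc_atMost)
  then have "cmod ?S * cmod (1 - cis (2 * pi * t)) = cmod (1 - cis (2 * pi * t) ^ D)"
    by (metis norm_mult)
  also have "\<dots> \<le> 2" by (rule order_trans[OF norm_triangle_ineq4]) (simp add: norm_power)
  finally have 1: "(cmod ?S)\<^sup>2 * (cmod (1 - cis (2 * pi * t)))\<^sup>2 \<le> 4"
    using power_mono[of "cmod ?S * cmod (1 - cis (2 * pi * t))" 2 2] by (simp add: power_mult_distrib)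
  have "(cmod (1 - cis (2 * pi * t)))\<^sup>2 = 2 - 2 * cos (2 * (pi * t))"
  proof -
    have *: "(1 - c)\<^sup>2 + s\<^sup>2 = 2 - 2 * c" if "s\<^sup>2 + c\<^sup>2 = 1" for c s :: real
      using that by (simp add: power2_eq_square algebra_simps)
    show ?thesis unfolding cmod_power2 using *[OF sin_cos_squared_add[of "2 * (pi * t)"]] by (simp add: mult.assoc)
  qed
  also have "\<dots> = 4 * (sin (pi * t))\<^sup>2" by (simp add: cos_double_sin)
  finally show ?thesis using 1 assms by (simp add: fejer_def field_simps)
qed

text \<open>Convolution with a probability kernel preserves the bound C and the mean. By Fubini the
  L1 error is at most the kernel average of the translation errors, which are at most V sin (pi t).
  The resulting rate is a power of D, and any power is good enough since the degree will be a large
  power of M.\<close>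

lemma fejer_approximation:
  fixes f :: "real \<Rightarrow> real"
  assumes [measurable]: "f \<in> borel_measurable borel" and C: "\<And>x. \<bar>f x\<bar> \<le> C"
    and per: "\<And>x. f (x + 1) = f x" and mean: "(\<integral>x. f x \<partial>circ) = 0"
    and w1: "\<And>x. w (x + 1) = w x + V" and w: "\<And>x y. x \<le> y \<Longrightarrow> \<bar>f y - f x\<bar> \<le> w y - w x"
    and D: "D > 0"
  obtains p where "trig_poly D p" "\<And>x. \<bar>p x\<bar> \<le> C" "(\<integral>x. p x \<partial>circ) = 0"
    "(\<integral>x. \<bar>f x - p x\<bar> \<partial>circ) \<le> V / sqrt (real D)"
proof -
  let ?K = "fejer D"
  define p where "p x = (\<integral>t. f (x + t) * ?K t \<partial>circ)" for x
  have C0: "C \<ge> 0" using C[of 0] by simp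
  have V0: "V \<ge> 0" using w[of 0 1] w1[of 0] by auto
  have Ki: "integrable circ ?K" by (rule integrable_circ_bounded[of _ "real D"]) (auto simp: fejer_le)
  have fK: "integrable circ (\<lambda>t. f (x + t) * ?K t)" for x
    by (rule integrable_circ_bounded[of _ "C * real D"]) (auto simp: abs_mult intro!: mult_mono C fejer_le C0)
  define F where "F m = (\<integral>t. complex_of_real (f t) * cis (2 * pi * of_int m * t) \<partial>circ)" for m :: int
  have Fi: "integrable circ (\<lambda>t. complex_of_real (f t) * cis (2 * pi * of_int m * t))" for m :: int
    by (rule integrable_circ_bounded[of _ C]) (auto simp: norm_mult C)
  define c where "c a = (\<Sum>(k, l) \<in> {z \<in> {..<D} \<times> {..<D}. int (snd z) - int (fst z) = a}. F (int k - int l)) / of_nat D" for a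
  have trig: "complex_of_real (p x) = (\<Sum>a\<in>{- int D..int D}. c a * cis (2 * pi * of_int a * x))" for x
  proof -
    \<comment> \<open>After a translation x occurs in the kernel only, so expanding the kernel
      leaves Fourier coefficients of f.\<close>
    have "p x = (\<integral>t. f (t + x) * ?K ((t + x) - x) \<partial>circ)" by (simp add: p_def add.commute)
    also have "\<dots> = (\<integral>t. f t * ?K (t - x) \<partial>circ)"
      using fejer_periodic[of D "_ - x"]
      by (intro integral_circ_shift[of "\<lambda>t. f t * ?K (t - x)"]) (auto simp: per diff_add_eq)
    finally have "complex_of_real (p x) = (\<integral>t. complex_of_real (f t * ?K (t - x)) \<partial>circ)"
      by (simp del: of_real_mult)
    also have "\<dots> = (\<integral>t. (\<Sum>(k, l) \<in> {..<D} \<times> {..<D}. complex_of_real (f t) * cis (2 * pi * of_int (int k - int l) * t)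
        * (cis (2 * pi * of_int (int l - int k) * x) / of_nat D)) \<partial>circ)"
      unfolding of_real_mult of_real_fejer
      by (intro Bochner_Integration.integral_cong)
         (auto simp: sum_distrib_left sum_divide_distrib case_prod_unfold cis_mult algebra_simps
            intro!: sum.cong)
    also have "\<dots> = (\<Sum>(k, l) \<in> {..<D} \<times> {..<D}. F (int k - int l) * (cis (2 * pi * of_int (int l - int k) * x) / of_nat D))"
    proof -
      have *: "(\<integral>t. (\<Sum>z\<in>A. complex_of_real (f t) * cis (2 * pi * of_int (g z) * t) * (h z / of_nat D)) \<partial>circ)
        = (\<Sum>z\<in>A. F (g z) * (h z / of_nat D))" for g :: "nat \<times> nat \<Rightarrow> int" and h and A
        unfolding F_def using Fi by simp
      show ?thesis unfolding case_prod_unfold by (rule *)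
    qed
    also have "\<dots> = (\<Sum>a\<in>{- int D..int D}. \<Sum>(k, l)\<in>{z \<in> {..<D} \<times> {..<D}. int (snd z) - int (fst z) = a}.
        F (int k - int l) * (cis (2 * pi * of_int (int l - int k) * x) / of_nat D))"
      by (rule sum.group[symmetric]) auto
    also have "\<dots> = (\<Sum>a\<in>{- int D..int D}. c a * cis (2 * pi * of_int a * x))"
      unfolding c_def sum_divide_distrib sum_distrib_right case_prod_unfold
      by (intro sum.cong refl) clarsimp
    finally show ?thesis .
  qed
  then have tp: "trig_poly D p" unfolding trig_poly_def by blast
  note [measurable] = trig_poly_borel_measurable[OF tp]
  have pC: "\<bar>p x\<bar> \<le> C" for x
  proof -
    have "\<bar>p x\<bar> \<le> (\<integral>t. \<bar>f (x + t) * ?K t\<bar> \<partial>circ)" unfolding p_def by (rule integral_abs_bound)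
    also have "\<dots> \<le> (\<integral>t. C * ?K t \<partial>circ)"
    proof (intro integral_mono integrable_abs fK)
      show "\<bar>f (x + t) * ?K t\<bar> \<le> C * ?K t" for t
        by (simp add: abs_mult fejer_nonneg mult_right_mono C)
    qed (use Ki in auto)
    finally show ?thesis using integral_fejer[OF D] by simp
  qed
  have pmean: "(\<integral>x. p x \<partial>circ) = 0"
  proof -
    have i: "integrable circ (\<lambda>t. cis (2 * pi * of_int m * t))" for m :: int
      by (rule integrable_circ_bounded[of _ 1]) auto
    have "complex_of_real (\<integral>x. p x \<partial>circ) = (\<integral>x. complex_of_real (p x) \<partial>circ)" by simp
    also have "\<dots> = (\<Sum>a\<in>{- int D..int D}. c a * (if a = 0 then 1 else 0))"
      unfolding trig using i integral_circ_cis by simp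
    also have "\<dots> = c 0" by (subst sum.mono_neutral_right[of _ "{0}"]) auto
    also have "\<dots> = 0"
    proof -
      have "F 0 = 0" using mean by (simp add: F_def)
      then show ?thesis by (auto simp: c_def case_prod_unfold intro!: sum.neutral)
    qed
    finally show ?thesis by simp
  qed
  have "(\<integral>x. \<bar>f x - p x\<bar> \<partial>circ) \<le> V / sqrt (real D)"
  proof -
    interpret pair: pair_prob_space circ circ ..
    define G where "G x t = \<bar>f (x + t) - f x\<bar> * ?K t" for x t
    have f2: "\<bar>f (x + t) - f x\<bar> \<le> 2 * C" for x t
      using C[of "x + t"] C[of x] by linarith
    have Gm[measurable]: "case_prod G \<in> borel_measurable (circ \<Otimes>\<^sub>M circ)" unfolding G_def by measurable
    have Gb: "\<bar>G x t\<bar> \<le> 2 * C * real D" for x t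
      unfolding G_def by (auto simp: abs_mult intro!: mult_mono f2 fejer_le C0)
    have Gi: "integrable (circ \<Otimes>\<^sub>M circ) (case_prod G)"
      by (rule pair.integrable_const_bound[of _ "2 * C * real D"]) (use Gb in auto)
    have Gt: "integrable circ (G x)" for x
      unfolding G_def using Gb
      by (intro integrable_circ_bounded[of _ "2 * C * real D"]) (auto simp: G_def)
    have "\<bar>f x - p x\<bar> \<le> (\<integral>t. G x t \<partial>circ)" for x
    proof -
      have "p x - f x = (\<integral>t. f (x + t) * ?K t - f x * ?K t \<partial>circ)"
        using fK[of x] Ki integral_fejer[OF D] by (simp add: p_def)
      also have "\<dots> = (\<integral>t. (f (x + t) - f x) * ?K t \<partial>circ)" by (simp add: algebra_simps)
      also have "\<bar>\<dots>\<bar> \<le> (\<integral>t. \<bar>(f (x + t) - f x) * ?K t\<bar> \<partial>circ)" by (rule integral_abs_bound)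
      finally show ?thesis by (simp add: G_def abs_mult fejer_nonneg abs_minus_commute)
    qed
    then have "(\<integral>x. \<bar>f x - p x\<bar> \<partial>circ) \<le> (\<integral>x. \<integral>t. G x t \<partial>circ \<partial>circ)"
    proof (intro integral_mono)
      have "\<bar>f x - p x\<bar> \<le> C + C" for x using C[of x] pC[of x] by linarith
      then show "integrable circ (\<lambda>x. \<bar>f x - p x\<bar>)" by (intro integrable_circ_bounded[of _ "C + C"]) auto
      show "integrable circ (\<lambda>x. \<integral>t. G x t \<partial>circ)" using pair.integrable_fst[OF Gi] .
    qed
    also have "\<dots> = (\<integral>t. \<integral>x. G x t \<partial>circ \<partial>circ)"
      using pair.Fubini_integral[OF Gi] by simp
    also have "\<dots> \<le> (\<integral>t. V * ((?K t / sqrt (real D) + sqrt (real D) * (1 / real D)) / 2) \<partial>circ)"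
    proof (rule integral_mono_AE)
      show "integrable circ (\<lambda>t. \<integral>x. G x t \<partial>circ)" using pair.integrable_snd[OF Gi] .
      show "integrable circ (\<lambda>t. V * ((?K t / sqrt (real D) + sqrt (real D) * (1 / real D)) / 2))"
        using Ki by auto
      \<comment> \<open>The translation estimate is available only for t in [0, 1], which carries
        all the mass.\<close>
      have "AE t in circ. t \<in> {0..<1}" unfolding circ_def by (rule AE_uniform_measureI) auto
      then show "AE t in circ. (\<integral>x. G x t \<partial>circ) \<le> V * ((?K t / sqrt (real D) + sqrt (real D) * (1 / real D)) / 2)"
      proof eventually_elim
        case (elim t)
        let ?s = "sin (pi * t)"
        have s: "min t (1 - t) \<le> ?s" using min_le_sin_pi elim by simp
        have "(\<integral>x. G x t \<partial>circ) = (\<integral>x. \<bar>f (x + t) - f x\<bar> \<partial>circ) * ?K t" by (simp add: G_def)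
        also have "\<dots> \<le> (V * ?s) * ?K t"
          using integral_circ_translation_diff_le[of f C w V t, OF _ C per w1 w] elim s V0
          by (intro mult_right_mono fejer_nonneg order_trans[OF _ mult_left_mono[OF s V0]]) auto
        also have "\<dots> = V * (?s * ?K t)" by simp
        \<comment> \<open>The weighted inequality 2 s \<le> 1 / sqrt D + sqrt D s^2 in place of
          Cauchy-Schwarz; integrated against the kernel, each of the two terms is at most 1 / sqrt
          D.\<close>
        also have "\<dots> \<le> V * (((1 / sqrt (real D) + sqrt (real D) * ?s\<^sup>2) / 2) * ?K t)"
        proof (intro mult_left_mono mult_right_mono fejer_nonneg V0)
          have "0 \<le> (?s * sqrt (real D) - 1)\<^sup>2 / sqrt (real D)" using D by simp
          also have "\<dots> = sqrt (real D) * ?s\<^sup>2 - 2 * ?s + 1 / sqrt (real D)"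
            using D by (simp add: power2_eq_square field_simps)
          finally show "?s \<le> (1 / sqrt (real D) + sqrt (real D) * ?s\<^sup>2) / 2" by simp
        qed
        also have "\<dots> = V * ((?K t / sqrt (real D) + sqrt (real D) * (?K t * ?s\<^sup>2)) / 2)"
          by (simp add: field_simps)
        also have "\<dots> \<le> V * ((?K t / sqrt (real D) + sqrt (real D) * (1 / real D)) / 2)"
          using fejer_sin_le[OF D, of t]
          by (intro mult_left_mono V0 divide_right_mono add_left_mono) auto
        finally show ?case .
      qed
    qed
    also have "\<dots> = V * ((1 / sqrt (real D) + sqrt (real D) * (1 / real D)) / 2)"
      using Ki integral_fejer[OF D] by (simp add: circ.prob_space[simplified])
    also have "sqrt (real D) * (1 / real D) = 1 / sqrt (real D)"
        using D by (simp add: real_div_sqrt field_simps)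
    finally show ?thesis by simp
  qed
  then show thesis using that[OF tp pC pmean] by blast
qed

section \<open>Dissociated frequencies and the independent model\<close>

definition iid :: "(nat \<Rightarrow> real) measure" where
  "iid = PiM UNIV (\<lambda>_. circ)"

lemma prob_space_iid: "prob_space iid"
  unfolding iid_def by (rule prob_space_PiM) (rule prob_space_circ)

interpretation iid: prob_space iid by (rule prob_space_iid)

lemma space_iid [simp]: "space iid = UNIV"
  by (simp add: iid_def space_PiM)

text \<open>Not a measurability rule: as a pattern, \<open>\<omega> k\<close> also matches terms such as \<open>F N x\<close>.\<close>

lemma measurable_iid_component: "(\<lambda>\<omega>. \<omega> k) \<in> borel_measurable iid"
  unfolding iid_def
  using measurable_component_singleton[of k UNIV "\<lambda>_. circ"] by (simp cong: measurable_cong_sets)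

lemma distr_iid_component: "distr iid circ (\<lambda>\<omega>. \<omega> k) = circ"
  unfolding iid_def by (rule distr_PiM_component) (auto intro: prob_space_circ)

lemma measurable_iid_comp:
  "g \<in> borel_measurable borel \<Longrightarrow> (\<lambda>\<omega>. g (\<omega> k)) \<in> borel_measurable iid"
  by (rule measurable_compose[OF measurable_iid_component])

lemma indep_vars_iid: "iid.indep_vars (\<lambda>_. circ) (\<lambda>k \<omega>. \<omega> k) UNIV"
proof (subst iid.indep_vars_iff_distr_eq_PiM)
  have "PiM UNIV (\<lambda>_. circ) = iid" by (simp add: iid_def)
  then show "distr iid (PiM UNIV (\<lambda>_. circ)) (\<lambda>x. \<lambda>i\<in>UNIV. x i) = PiM UNIV (\<lambda>i. distr iid circ (\<lambda>\<omega>. \<omega> i))"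
    by (simp add: distr_iid_component restrict_UNIV)
qed (auto intro: measurable_iid_component cong: measurable_cong_sets)

lemma indep_vars_iid_comp:
  assumes "\<And>k. g k \<in> borel_measurable borel"
  shows "iid.indep_vars (\<lambda>_. borel) (\<lambda>k \<omega>. g k (\<omega> k)) S"
  by (rule iid.indep_vars_subset[of _ _ UNIV])
     (use assms in \<open>auto intro!: iid.indep_vars_compose2[OF indep_vars_iid] cong: measurable_cong_sets\<close>)

lemma integral_iid_component:
  fixes g :: "real \<Rightarrow> 'a :: {banach, second_countable_topology}"
  assumes [measurable]: "g \<in> borel_measurable borel"
  shows "(\<integral>\<omega>. g (\<omega> k) \<partial>iid) = (\<integral>x. g x \<partial>circ)"
proof -
  have "(\<integral>x. g x \<partial>circ) = (\<integral>x. g x \<partial>distr iid circ (\<lambda>\<omega>. \<omega> k))" by (simp add: distr_iid_component)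
  also have "\<dots> = (\<integral>\<omega>. g (\<omega> k) \<partial>iid)" by (subst integral_distr) (auto intro: measurable_iid_component cong: measurable_cong_sets)
  finally show ?thesis ..
qed

lemma integral_iid_prod:
  fixes g :: "nat \<Rightarrow> real \<Rightarrow> 'a :: {real_normed_field, banach, second_countable_topology}"
  assumes S: "finite S" and g[measurable]: "\<And>k. g k \<in> borel_measurable borel" and b: "\<And>k x. norm (g k x) \<le> B k"
  shows "(\<integral>\<omega>. (\<Prod>k\<in>S. g k (\<omega> k)) \<partial>iid) = (\<Prod>k\<in>S. \<integral>x. g k x \<partial>circ)"
proof -
  have "integrable iid (\<lambda>\<omega>. g k (\<omega> k))" for k
    by (rule iid.integrable_const_bound[of _ "B k"]) (use b in \<open>auto intro: measurable_iid_comp\<close>)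
  then have "(\<integral>\<omega>. (\<Prod>k\<in>S. g k (\<omega> k)) \<partial>iid) = (\<Prod>k\<in>S. \<integral>\<omega>. g k (\<omega> k) \<partial>iid)"
    using S indep_vars_iid_comp[of g S, OF g] by (intro iid.indep_vars_lebesgue_integral) auto
  then show ?thesis by (simp add: integral_iid_component)
qed

text \<open>Independence over the integers up to s terms and coefficients of size H. It is applied
  with \<open>H = s * D\<close>: in a moment of order at most s, up to s frequencies of size at most
  D may meet at one index and add up.\<close>

definition dissociated :: "nat \<Rightarrow> nat \<Rightarrow> (nat \<Rightarrow> nat) \<Rightarrow> nat set \<Rightarrow> bool" where
  "dissociated s H n I \<longleftrightarrow> (\<forall>S (b :: nat \<Rightarrow> int). finite S \<longrightarrow> S \<noteq> {} \<longrightarrow> S \<subseteq> I \<longrightarrow> card S \<le> s \<longrightarrow>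
     (\<forall>k\<in>S. b k \<noteq> 0 \<and> \<bar>b k\<bar> \<le> int H) \<longrightarrow> (\<Sum>k\<in>S. b k * int (n k)) \<noteq> 0)"

section \<open>Agreement of moments with the independent model\<close>

lemma prod_cis: "(\<Prod>i\<in>A. cis (f i)) = cis (\<Sum>i\<in>A. f i)"
  by (induction A rule: infinite_finite_induct) (auto simp: cis_mult)

text \<open>
  A product of characters has mean one or zero according as the frequencies cancel, and for
  dissociated frequencies they cancel only if they do so in every variable separately.
\<close>

lemma dissociated_integral_prod_cis:
  fixes \<kappa> :: "nat \<Rightarrow> nat" and a :: "nat \<Rightarrow> int"
  assumes diss: "dissociated s (s * D) n I" and q: "q \<le> s"
    and \<kappa>: "\<And>i. i < q \<Longrightarrow> \<kappa> i \<in> I" and a: "\<And>i. i < q \<Longrightarrow> \<bar>a i\<bar> \<le> int D"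
  shows "(\<integral>x. (\<Prod>i<q. cis (2 * pi * of_int (a i) * (real (n (\<kappa> i)) * x))) \<partial>circ)
       = (\<integral>\<omega>. (\<Prod>i<q. cis (2 * pi * of_int (a i) * \<omega> (\<kappa> i))) \<partial>iid)"
proof -
  define b where "b k = (\<Sum>i | i < q \<and> \<kappa> i = k. a i)" for k
  let ?S = "\<kappa> ` {..<q}"
  have group: "(\<Sum>i<q. of_int (a i) * y (\<kappa> i)) = (\<Sum>k\<in>?S. of_int (b k) * y k)" for y :: "nat \<Rightarrow> real"
  proof -
    have "(\<Sum>i<q. of_int (a i) * y (\<kappa> i)) = (\<Sum>k\<in>?S. \<Sum>i\<in>{i\<in>{..<q}. \<kappa> i = k}. of_int (a i) * y (\<kappa> i))"
      by (rule sum.group[symmetric]) auto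
    also have "\<dots> = (\<Sum>k\<in>?S. of_int (b k) * y k)"
      by (intro sum.cong refl) (auto simp: b_def sum_distrib_right)
    finally show ?thesis .
  qed
  have eq: "(\<Prod>i<q. cis (2 * pi * of_int (a i) * y (\<kappa> i))) = cis (2 * pi * (\<Sum>k\<in>?S. of_int (b k) * y k))" for y
    unfolding prod_cis group[symmetric] by (simp add: sum_distrib_left mult.assoc)
  have bb: "\<bar>b k\<bar> \<le> int (s * D)" for k
  proof -
    have "\<bar>b k\<bar> \<le> (\<Sum>i | i < q \<and> \<kappa> i = k. int D)"
      unfolding b_def by (intro order_trans[OF sum_abs] sum_mono) (simp add: a)
    also have "\<dots> = int (card {i. i < q \<and> \<kappa> i = k} * D)" by simp
    also have "card {i. i < q \<and> \<kappa> i = k} \<le> card {..<q}" by (intro card_mono) auto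
    then have "int (card {i. i < q \<and> \<kappa> i = k} * D) \<le> int (s * D)" using q
      by (simp only: of_nat_le_iff) (intro mult_le_mono; simp)
    finally show ?thesis by simp
  qed
  have zero_iff: "(\<Sum>k\<in>?S. b k * int (n k)) = 0 \<longleftrightarrow> (\<forall>k\<in>?S. b k = 0)"
  proof
    assume 0: "(\<Sum>k\<in>?S. b k * int (n k)) = 0"
    show "\<forall>k\<in>?S. b k = 0"
    proof (rule ccontr)
      assume ne: "\<not> (\<forall>k\<in>?S. b k = 0)"
      \<comment> \<open>Indices at which the frequencies cancel are dropped, since dissociation
        speaks of nonzero coefficients.\<close>
      let ?T = "{k\<in>?S. b k \<noteq> 0}"
      have "(\<Sum>k\<in>?T. b k * int (n k)) = (\<Sum>k\<in>?S. b k * int (n k))"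
        by (intro sum.mono_neutral_left) auto
      moreover have "card ?T \<le> s"
        using card_mono[of ?S ?T] card_image_le[of "{..<q}" \<kappa>] q by simp
      moreover have "?T \<subseteq> I" using \<kappa> by auto
      ultimately show False using diss ne 0 bb unfolding dissociated_def
        by (auto dest!: spec[of _ ?T] spec[of _ b])
    qed
  next
    assume "\<forall>k\<in>?S. b k = 0"
    then show "(\<Sum>k\<in>?S. b k * int (n k)) = 0" by (intro sum.neutral) auto
  qed
  have "(\<integral>x. (\<Prod>i<q. cis (2 * pi * of_int (a i) * (real (n (\<kappa> i)) * x))) \<partial>circ)
      = (\<integral>x. cis (2 * pi * of_int (\<Sum>k\<in>?S. b k * int (n k)) * x) \<partial>circ)"
    unfolding eq[of "\<lambda>k. real (n k) * _"] by (simp add: sum_distrib_right mult.assoc)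
  also have "\<dots> = (if \<forall>k\<in>?S. b k = 0 then 1 else 0)" by (simp only: integral_circ_cis zero_iff)
  also have "\<dots> = (\<Prod>k\<in>?S. if b k = 0 then 1 else 0)"
  proof -
    have "(\<Prod>k\<in>A. if P k then 1 else 0) = (if \<forall>k\<in>A. P k then 1 else (0::complex))" if "finite A" for A and P :: "nat \<Rightarrow> bool"
      using that by induction auto
    then show ?thesis by simp
  qed
  also have "\<dots> = (\<Prod>k\<in>?S. \<integral>x. cis (2 * pi * of_int (b k) * x) \<partial>circ)" by (simp only: integral_circ_cis)
  also have "\<dots> = (\<integral>\<omega>. (\<Prod>k\<in>?S. cis (2 * pi * of_int (b k) * \<omega> k)) \<partial>iid)"
    by (rule integral_iid_prod[symmetric, of _ _ "\<lambda>_. 1"]) auto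
  also have "\<dots> = (\<integral>\<omega>. (\<Prod>i<q. cis (2 * pi * of_int (a i) * \<omega> (\<kappa> i))) \<partial>iid)"
  proof -
    have "(\<Prod>k\<in>?S. cis (2 * pi * of_int (b k) * y k)) = cis (2 * pi * (\<Sum>k\<in>?S. of_int (b k) * y k))" for y
      by (simp add: prod_cis sum_distrib_left mult.assoc)
    then show ?thesis by (simp only: eq)
  qed
  finally show ?thesis .
qed

text \<open>The q-th power is a sum over all ways to pick an index and a frequency q times. Each
  term is a product of q characters, and its mean is the same in both models.\<close>

lemma dissociated_moments:
  assumes trig: "trig_poly D p" and diss: "dissociated s (s * D) n I" and q: "q \<le> s"
    and J: "finite J" "J \<subseteq> I"
  shows "(\<integral>x. (\<Sum>k\<in>J. w k * p (real (n k) * x)) ^ q \<partial>circ) = (\<integral>\<omega>. (\<Sum>k\<in>J. w k * p (\<omega> k)) ^ q \<partial>iid)"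
proof -
  obtain c where c: "\<And>x. complex_of_real (p x) = (\<Sum>a\<in>{- int D..int D}. c a * cis (2 * pi * of_int a * x))"
    using trig unfolding trig_poly_def by blast
  define A where "A = J \<times> {- int D..int D}"
  have A: "finite A" using J by (simp add: A_def)
  define G where "G = PiE {..<q} (\<lambda>_. A)"
  have G: "finite G" unfolding G_def using A by (intro finite_PiE) auto
  define Z where "Z g = (\<Prod>i<q. complex_of_real (w (fst (g i))) * c (snd (g i)))" for g :: "nat \<Rightarrow> nat \<times> int"
  have expand: "complex_of_real ((\<Sum>k\<in>J. w k * p (y k)) ^ q)
      = (\<Sum>g\<in>G. Z g * (\<Prod>i<q. cis (2 * pi * of_int (snd (g i)) * y (fst (g i)))))" for y
  proof -
    have "complex_of_real (\<Sum>k\<in>J. w k * p (y k))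
        = (\<Sum>z\<in>A. complex_of_real (w (fst z)) * c (snd z) * cis (2 * pi * of_int (snd z) * y (fst z)))"
      unfolding A_def by (simp add: c sum_distrib_left mult.assoc sum.cartesian_product case_prod_unfold)
    then have "complex_of_real ((\<Sum>k\<in>J. w k * p (y k)) ^ q)
        = (\<Prod>i<q. \<Sum>z\<in>A. complex_of_real (w (fst z)) * c (snd z) * cis (2 * pi * of_int (snd z) * y (fst z)))"
      by simp
    also have "\<dots> = (\<Sum>g\<in>G. \<Prod>i<q. complex_of_real (w (fst (g i))) * c (snd (g i)) * cis (2 * pi * of_int (snd (g i)) * y (fst (g i))))"
      unfolding G_def by (rule prod_sum_PiE) (use A in auto)
    finally show ?thesis by (simp add: Z_def prod.distrib)
  qed
  have "complex_of_real (\<integral>x. (\<Sum>k\<in>J. w k * p (real (n k) * x)) ^ q \<partial>circ)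
      = (\<integral>x. complex_of_real ((\<Sum>k\<in>J. w k * p (real (n k) * x)) ^ q) \<partial>circ)"
    by (simp del: of_real_power of_real_sum)
  also have "\<dots> = (\<Sum>g\<in>G. Z g * (\<integral>x. (\<Prod>i<q. cis (2 * pi * of_int (snd (g i)) * (real (n (fst (g i))) * x))) \<partial>circ))"
    unfolding expand[of "\<lambda>k. real (n k) * _"]
    by (subst Bochner_Integration.integral_sum)
       (auto intro!: integrable_mult_right integrable_circ_bounded[of _ 1] simp: prod_norm[symmetric])
  also have "\<dots> = (\<Sum>g\<in>G. Z g * (\<integral>\<omega>. (\<Prod>i<q. cis (2 * pi * of_int (snd (g i)) * \<omega> (fst (g i)))) \<partial>iid))"
  proof (intro sum.cong refl arg_cong2[where f = "(*)"])
    fix g assume "g \<in> G"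
    then have "g i \<in> A" if "i < q" for i using that unfolding G_def by auto
    then have "fst (g i) \<in> I" "\<bar>snd (g i)\<bar> \<le> int D" if "i < q" for i
      using that J by (force simp: A_def mem_Times_iff abs_le_iff)+
    then show "(\<integral>x. (\<Prod>i<q. cis (2 * pi * of_int (snd (g i)) * (real (n (fst (g i))) * x))) \<partial>circ)
        = (\<integral>\<omega>. (\<Prod>i<q. cis (2 * pi * of_int (snd (g i)) * \<omega> (fst (g i)))) \<partial>iid)"
      by (intro dissociated_integral_prod_cis[OF diss q])
  qed
  also have "\<dots> = (\<integral>\<omega>. complex_of_real ((\<Sum>k\<in>J. w k * p (\<omega> k)) ^ q) \<partial>iid)"
    unfolding expand
    by (subst Bochner_Integration.integral_sum)
       (auto intro!: integrable_mult_right iid.integrable_const_bound[of _ 1]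
          borel_measurable_prod borel_measurable_cis borel_measurable_times measurable_iid_component simp: prod_norm[symmetric])
  also have "\<dots> = complex_of_real (\<integral>\<omega>. (\<Sum>k\<in>J. w k * p (\<omega> k)) ^ q \<partial>iid)"
    by (simp del: of_real_power of_real_sum)
  finally show ?thesis by simp
qed

section \<open>Exponential bounds\<close>

lemma exp_le_second_order: "exp (y::real) \<le> 1 + y + y\<^sup>2 / 2 * exp \<bar>y\<bar>"
proof -
  obtain t where t: "\<bar>t\<bar> \<le> \<bar>y\<bar>" "exp y = (\<Sum>m<2. y ^ m / fact m) + exp t / fact 2 * y ^ 2"
    using Maclaurin_exp_le[of y 2] by auto
  have "exp t * y\<^sup>2 \<le> exp \<bar>y\<bar> * y\<^sup>2" using t by (intro mult_right_mono) auto
  then show ?thesis using t(2) by (simp add: numeral_2_eq_2 lessThan_Suc field_simps)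
qed

text \<open>The first bound has the right constant v / 2 in the limit of small l, as the iterated
  logarithm demands. The second is valid for all l: where |l| C \<le> 1 it follows from the first
  with v = C^2 and exp 1 \<le> 4, and otherwise |l| C \<le> (l C)^2 makes the trivial bound
  sufficient.\<close>

lemma
  fixes p :: "real \<Rightarrow> real"
  assumes [measurable]: "p \<in> borel_measurable borel" and C: "\<And>x. \<bar>p x\<bar> \<le> C" and mean: "(\<integral>x. p x \<partial>circ) = 0"
  shows mgf_le_variance: "(\<integral>x. (p x)\<^sup>2 \<partial>circ) \<le> v \<Longrightarrow> (\<integral>x. exp (l * p x) \<partial>circ) \<le> exp (l\<^sup>2 * v / 2 * exp (\<bar>l\<bar> * C))"
    and mgf_le: "(\<integral>x. exp (l * p x) \<partial>circ) \<le> exp (2 * l\<^sup>2 * C\<^sup>2)"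
proof -
  have C0: "C \<ge> 0" using C[of 0] by linarith
  have lp: "\<bar>l * p x\<bar> \<le> \<bar>l\<bar> * C" for x by (simp add: abs_mult mult_left_mono C)
  have i1: "integrable circ p" by (rule integrable_circ_bounded[of _ C]) (auto simp: C)
  have p2: "(p x)\<^sup>2 \<le> C\<^sup>2" for x using C[of x] by (metis C abs_le_square_iff abs_of_nonneg C0)
  have i2: "integrable circ (\<lambda>x. (p x)\<^sup>2)" by (rule integrable_circ_bounded[of _ "C\<^sup>2"]) (auto simp: p2)
  have i3: "integrable circ (\<lambda>x. exp (l * p x))"
    by (rule integrable_circ_bounded[of _ "exp (\<bar>l\<bar> * C)"]) (use lp abs_le_iff in auto)
  have *: "(\<integral>x. exp (l * p x) \<partial>circ) \<le> exp (l\<^sup>2 * v / 2 * exp (\<bar>l\<bar> * C))" if v: "(\<integral>x. (p x)\<^sup>2 \<partial>circ) \<le> v" for v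
  proof -
    have "exp (l * p x) \<le> 1 + l * p x + l\<^sup>2 / 2 * exp (\<bar>l\<bar> * C) * (p x)\<^sup>2" for x
    proof -
      have "exp (l * p x) \<le> 1 + l * p x + (l * p x)\<^sup>2 / 2 * exp \<bar>l * p x\<bar>" by (rule exp_le_second_order)
      also have "\<dots> \<le> 1 + l * p x + (l * p x)\<^sup>2 / 2 * exp (\<bar>l\<bar> * C)"
        using lp[of x] by (intro add_left_mono mult_left_mono) auto
      finally show ?thesis by (simp add: power_mult_distrib mult_ac)
    qed
    then have "(\<integral>x. exp (l * p x) \<partial>circ) \<le> (\<integral>x. 1 + l * p x + l\<^sup>2 / 2 * exp (\<bar>l\<bar> * C) * (p x)\<^sup>2 \<partial>circ)"
      using i1 i2 i3 by (intro integral_mono) auto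
    also have "\<dots> = 1 + l\<^sup>2 / 2 * exp (\<bar>l\<bar> * C) * (\<integral>x. (p x)\<^sup>2 \<partial>circ)"
      using i1 i2 mean by (simp add: circ.prob_space[simplified])
    also have "\<dots> \<le> 1 + l\<^sup>2 / 2 * exp (\<bar>l\<bar> * C) * v"
      by (intro add_left_mono mult_left_mono v) auto
    also have "\<dots> \<le> exp (l\<^sup>2 / 2 * exp (\<bar>l\<bar> * C) * v)" by (rule exp_ge_add_one_self)
    finally show ?thesis by (simp add: mult_ac)
  qed
  then show "(\<integral>x. (p x)\<^sup>2 \<partial>circ) \<le> v \<Longrightarrow> (\<integral>x. exp (l * p x) \<partial>circ) \<le> exp (l\<^sup>2 * v / 2 * exp (\<bar>l\<bar> * C))" .
  show "(\<integral>x. exp (l * p x) \<partial>circ) \<le> exp (2 * l\<^sup>2 * C\<^sup>2)"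
  proof (cases "\<bar>l\<bar> * C \<le> 1")
    case True
    have "(\<integral>x. (p x)\<^sup>2 \<partial>circ) \<le> (\<integral>x. C\<^sup>2 \<partial>circ)" using i2 p2 by (intro integral_mono) auto
    then have "(\<integral>x. exp (l * p x) \<partial>circ) \<le> exp (l\<^sup>2 * C\<^sup>2 / 2 * exp (\<bar>l\<bar> * C))"
      by (intro *) (simp add: circ.prob_space[simplified])
    also have "l\<^sup>2 * C\<^sup>2 / 2 * exp (\<bar>l\<bar> * C) \<le> l\<^sup>2 * C\<^sup>2 / 2 * 4"
    proof (intro mult_left_mono)
      have "exp (\<bar>l\<bar> * C) \<le> exp 1" using True by simp
      then show "exp (\<bar>l\<bar> * C) \<le> 4" using exp_le by linarith
    qed auto
    finally show ?thesis by (simp add: mult_ac)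
  next
    case False
    have "(\<integral>x. exp (l * p x) \<partial>circ) \<le> (\<integral>x. exp (\<bar>l\<bar> * C) \<partial>circ)"
      using i3 lp abs_le_iff by (intro integral_mono) auto
    also have "\<dots> = exp (\<bar>l\<bar> * C)" by (simp add: circ.prob_space[simplified])
    also have "\<bar>l\<bar> * C \<le> (\<bar>l\<bar> * C) * (\<bar>l\<bar> * C)" using False by (intro mult_left_le[of _ 1, simplified] mult_le_cancel_left1[THEN iffD2]) auto
    also have "\<dots> \<le> 2 * l\<^sup>2 * C\<^sup>2"
      using zero_le_power2[of "l * C"] by (simp add: power2_eq_square mult_ac)
    finally show ?thesis by simp
  qed
qed

text \<open>
  These polynomials replace the exponential function in Chernoff bounds, as only the moments up
  to some order \<open>s\<close> are the same as in the independent model.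
\<close>

definition even_exp :: "nat \<Rightarrow> real \<Rightarrow> real" where
  "even_exp s y = (\<Sum>k\<le>s. if even k then y ^ k / fact k else 0)"

lemma cosh_sums: "(\<lambda>k. if even k then y ^ k / fact k else 0) sums cosh (y::real)"
proof -
  have "(\<lambda>k. if even k then y ^ k / fact k else 0) = (\<lambda>k. if even k then y ^ k /\<^sub>R fact k else 0)"
    by (auto simp: divide_inverse mult.commute)
  then show ?thesis using cosh_converges[of y] by simp
qed

text \<open>With even powers only, all terms are nonnegative for every real y, so truncation can
  only lower the sum.\<close>

lemma even_exp_le_cosh: "even_exp s y \<le> cosh y"
  unfolding even_exp_def
  using sums_unique[OF cosh_sums[of y]] sum_le_suminf[OF sums_summable[OF cosh_sums[of y]], of "{..s}"]
  by (auto simp: zero_le_even_power)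

lemma even_exp_ge_term: "even q \<Longrightarrow> q \<le> s \<Longrightarrow> y ^ q / fact q \<le> even_exp s y"
  unfolding even_exp_def
  by (rule order_trans[OF _ member_le_sum[of q]]) (auto simp: zero_le_even_power)

lemma even_exp_mono:
  assumes "0 \<le> y" "y \<le> \<bar>z\<bar>" shows "even_exp s y \<le> even_exp s z"
  unfolding even_exp_def
  by (intro sum_mono) (use assms in \<open>auto intro!: divide_right_mono simp: power_even_abs[symmetric, of _ z] intro!: power_mono\<close>)

text \<open>The part of the series beyond \<open>s\<close> is at most \<open>exp (-s) cosh (e y)\<close>.\<close>

lemma even_exp_ge:
  assumes y: "y \<ge> 0" and s: "real s \<ge> 3 * y + 1"
  shows "exp y / 4 \<le> even_exp s y"
proof -
  let ?c = "\<lambda>y k. if even k then y ^ k / fact k else (0::real)"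
  have sm: "summable (?c z)" for z using cosh_sums by (rule sums_summable)
  have suminf: "suminf (?c z) = cosh z" for z
    using sums_unique[OF cosh_sums[of z]] by simp
  have "cosh y = (\<Sum>k. ?c y (k + Suc s)) + (\<Sum>k<Suc s. ?c y k)"
    using suminf_split_initial_segment[OF sm[of y], of "Suc s"] suminf by simp
  then have "cosh y = (\<Sum>k. ?c y (k + Suc s)) + even_exp s y"
    by (simp only: even_exp_def lessThan_Suc_atMost)
  moreover have "(\<Sum>k. ?c y (k + Suc s)) \<le> (\<Sum>k. exp (- real s) * ?c (exp 1 * y) (k + Suc s))"
  proof (intro suminf_le)
    fix k
    \<comment> \<open>Rankin's trick: beyond s the factor exp (m - s) is at least 1 and may be
      inserted.\<close>
    have "y ^ m \<le> exp (- real s) * (exp 1 * y) ^ m" if "m > s" for m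
    proof -
      have "1 \<le> exp (real m - real s)" using that by simp
      then have "1 * y ^ m \<le> exp (real m - real s) * y ^ m" using y by (intro mult_right_mono) auto
      then show ?thesis by (simp add: power_mult_distrib exp_diff exp_minus exp_of_nat_mult[symmetric] field_simps)
    qed
    from this[of "k + Suc s"]
    show "?c y (k + Suc s) \<le> exp (- real s) * ?c (exp 1 * y) (k + Suc s)"
      by (auto simp: divide_right_mono simp del: power_Suc power_mult_distrib)
  qed (use sm summable_iff_shift[of "?c _" "Suc s"] in \<open>auto simp del: add_Suc_right\<close>)
  moreover have "(\<Sum>k. exp (- real s) * ?c (exp 1 * y) (k + Suc s)) \<le> exp (- real s) * cosh (exp 1 * y)"
  proof -
    have s': "summable (\<lambda>k. ?c (exp 1 * y) (k + Suc s))" using sm summable_iff_shift[of "?c _" "Suc s"] by blast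
    have "(\<Sum>k. ?c (exp 1 * y) (k + Suc s)) \<le> cosh (exp 1 * y)"
      using suminf_split_initial_segment[OF sm[of "exp 1 * y"], of "Suc s"] suminf[of "exp 1 * y"]
        sum_nonneg[of "{..<Suc s}" "?c (exp 1 * y)"] y by (auto simp: zero_le_even_power)
    then show ?thesis using suminf_mult[OF s', of "exp (- real s)"] by simp
  qed
  \<comment> \<open>The origin of \<open>3 * y + 1\<close>: here exp 1 \<le> 3, and the extra 1
    leaves a factor exp (-1) \<le> 1 / 2.\<close>
  moreover have "exp (- real s) * cosh (exp 1 * y) \<le> 1 / 2"
  proof -
    have "exp 1 * y \<le> 3 * y" using exp_le y by (intro mult_right_mono) auto
    have "cosh (exp 1 * y) \<le> exp (exp 1 * y)"
      using y by (simp add: cosh_field_def field_simps)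
    also have "\<dots> \<le> exp (3 * y)" using \<open>exp 1 * y \<le> 3 * y\<close> by simp
    finally have "exp (- real s) * cosh (exp 1 * y) \<le> exp (- real s) * exp (3 * y)" by simp
    also have "\<dots> = exp (3 * y - real s)" by (simp add: exp_diff exp_minus field_simps)
    also have "\<dots> \<le> exp (- 1)" using s by simp
    also have "\<dots> \<le> 1 / 2" using exp_ge_add_one_self[of 1] by (simp add: exp_minus field_simps)
    finally show ?thesis .
  qed
  moreover have "1 / 2 \<le> cosh y / 2" using cosh_real_ge_1[of y] by simp
  moreover have "exp y / 2 \<le> cosh y" by (simp add: cosh_field_def)
  ultimately show ?thesis by linarith
qed

section \<open>Transfer of moments, tails and characteristic functions\<close>

lemma norm_integral_le:
  fixes f :: "'a \<Rightarrow> 'b :: {banach, second_countable_topology}"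
  assumes "integrable M f" "integrable M g" "\<And>x. norm (f x) \<le> g x"
  shows "norm (\<integral>x. f x \<partial>M) \<le> (\<integral>x. g x \<partial>M)"
  by (rule order_trans[OF integral_norm_bound]) (use assms in \<open>auto intro!: integral_mono\<close>)

locale dissociated_system =
  fixes n :: "nat \<Rightarrow> nat" and s D :: nat and I :: "nat set" and p :: "real \<Rightarrow> real" and C :: real
  assumes trig: "trig_poly D p" and p_le: "\<And>x. \<bar>p x\<bar> \<le> C" and p_mean: "(\<integral>x. p x \<partial>circ) = 0"
    and diss: "dissociated s (s * D) n I"
begin

text \<open>The weights hold the Laplace or Fourier variable; as they may depend on the index, the
  joint law of two block sums is covered as well.\<close>

definition S :: "nat set \<Rightarrow> (nat \<Rightarrow> real) \<Rightarrow> real \<Rightarrow> real" where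
  "S J w x = (\<Sum>k\<in>J. w k * p (real (n k) * x))"

definition T :: "nat set \<Rightarrow> (nat \<Rightarrow> real) \<Rightarrow> (nat \<Rightarrow> real) \<Rightarrow> real" where
  "T J w \<omega> = (\<Sum>k\<in>J. w k * p (\<omega> k))"

lemma p_borel [measurable]: "p \<in> borel_measurable borel"
  using trig by (rule trig_poly_borel_measurable)

lemma S_measurable [measurable]: "S J w \<in> borel_measurable borel"
  unfolding S_def by measurable

lemma T_measurable [measurable]: "T J w \<in> borel_measurable iid"
  unfolding T_def by (intro borel_measurable_sum borel_measurable_times measurable_iid_comp) auto

lemma S_bounded: "\<bar>S J w x\<bar> \<le> C * (\<Sum>k\<in>J. \<bar>w k\<bar>)"
  unfolding S_def sum_distrib_left
  by (rule order_trans[OF sum_abs]) (auto intro!: sum_mono mult_left_mono simp: abs_mult p_le mult.commute[of C])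

lemma T_bounded: "\<bar>T J w x\<bar> \<le> C * (\<Sum>k\<in>J. \<bar>w k\<bar>)"
  unfolding T_def sum_distrib_left
  by (rule order_trans[OF sum_abs]) (auto intro!: sum_mono mult_left_mono simp: abs_mult p_le mult.commute[of C])

lemma integrable_S_comp:
  fixes h :: "real \<Rightarrow> 'a :: {banach, second_countable_topology}"
  assumes h: "continuous_on UNIV h"
  shows "integrable circ (\<lambda>x. h (S J w x))"
proof -
  let ?b = "C * (\<Sum>k\<in>J. \<bar>w k\<bar>)"
  have "compact (h ` {-?b..?b})" using h by (intro compact_continuous_image continuous_on_subset[OF h]) auto
  then obtain B where B: "\<And>y. y \<in> h ` {-?b..?b} \<Longrightarrow> norm y \<le> B"
    using bounded_iff compact_imp_bounded by metis
  have [measurable]: "h \<in> borel_measurable borel" using h by (rule borel_measurable_continuous_onI)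
  show ?thesis
    by (rule integrable_circ_bounded[of _ B]) (use S_bounded[of J w] in \<open>auto intro!: B simp: abs_le_iff minus_le_iff\<close>)
qed

lemma integrable_T_comp:
  fixes h :: "real \<Rightarrow> 'a :: {banach, second_countable_topology}"
  assumes h: "continuous_on UNIV h"
  shows "integrable iid (\<lambda>x. h (T J w x))"
proof -
  let ?b = "C * (\<Sum>k\<in>J. \<bar>w k\<bar>)"
  have "compact (h ` {-?b..?b})" using h by (intro compact_continuous_image continuous_on_subset[OF h]) auto
  then obtain B where B: "\<And>y. y \<in> h ` {-?b..?b} \<Longrightarrow> norm y \<le> B"
    using bounded_iff compact_imp_bounded by metis
  have [measurable]: "h \<in> borel_measurable borel" using h by (rule borel_measurable_continuous_onI)
  show ?thesis
    by (rule iid.integrable_const_bound[of _ B]) (use T_bounded[of J w] in \<open>auto intro!: B simp: abs_le_iff minus_le_iff\<close>)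
qed

lemma moments_eq:
  assumes "q \<le> s" "finite J" "J \<subseteq> I"
  shows "(\<integral>x. S J w x ^ q \<partial>circ) = (\<integral>x. T J w x ^ q \<partial>iid)"
  unfolding S_def T_def using dissociated_moments[OF trig diss assms] .

lemma mgf_T_prod:
  assumes "finite J"
  shows "(\<integral>x. exp (T J w x) \<partial>iid) = (\<Prod>k\<in>J. \<integral>x. exp (w k * p x) \<partial>circ)"
proof -
  have "\<bar>w k * p x\<bar> \<le> \<bar>w k\<bar> * C" for k x by (simp add: abs_mult mult_left_mono p_le)
  then have b: "norm (exp (w k * p x)) \<le> exp (\<bar>w k\<bar> * C)" for k x by (simp add: abs_le_iff)
  have "(\<integral>x. exp (T J w x) \<partial>iid) = (\<integral>x. (\<Prod>k\<in>J. exp (w k * p (x k))) \<partial>iid)"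
    using assms by (simp add: T_def exp_sum)
  also have "\<dots> = (\<Prod>k\<in>J. \<integral>x. exp (w k * p x) \<partial>circ)"
    by (rule integral_iid_prod[OF assms _ b]) measurable
  finally show ?thesis .
qed

lemma mgf_T_le:
  assumes "finite J"
  shows "(\<integral>x. exp (T J w x) \<partial>iid) \<le> exp (2 * C\<^sup>2 * (\<Sum>k\<in>J. (w k)\<^sup>2))"
proof -
  have "(\<integral>x. exp (T J w x) \<partial>iid) \<le> (\<Prod>k\<in>J. exp (2 * (w k)\<^sup>2 * C\<^sup>2))"
    unfolding mgf_T_prod[OF assms]
    by (intro prod_mono conjI mgf_le p_le p_mean integral_nonneg) auto
  also have "\<dots> = exp (2 * C\<^sup>2 * (\<Sum>k\<in>J. (w k)\<^sup>2))"
    using assms by (simp add: exp_sum[symmetric] sum_distrib_left mult_ac)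
  finally show ?thesis .
qed

lemma mgf_T_le_variance:
  assumes "finite J" and v: "(\<integral>x. (p x)\<^sup>2 \<partial>circ) \<le> v" and l: "\<And>k. k \<in> J \<Longrightarrow> \<bar>w k\<bar> \<le> l"
  shows "(\<integral>x. exp (T J w x) \<partial>iid) \<le> exp (v / 2 * exp (l * C) * (\<Sum>k\<in>J. (w k)\<^sup>2))"
proof -
  have C0: "C \<ge> 0" using p_le[of 0] by linarith
  have v0: "v \<ge> 0" by (rule order_trans[OF _ v]) simp
  have "(\<integral>x. exp (T J w x) \<partial>iid) \<le> (\<Prod>k\<in>J. exp ((w k)\<^sup>2 * v / 2 * exp (\<bar>w k\<bar> * C)))"
    unfolding mgf_T_prod[OF assms(1)]
    by (intro prod_mono conjI mgf_le_variance p_le p_mean integral_nonneg v) auto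
  also have "\<dots> \<le> (\<Prod>k\<in>J. exp ((w k)\<^sup>2 * v / 2 * exp (l * C)))"
    using l C0 v0 by (intro prod_mono) (auto intro!: mult_left_mono mult_right_mono)
  also have "\<dots> = exp (v / 2 * exp (l * C) * (\<Sum>k\<in>J. (w k)\<^sup>2))"
    using assms(1) by (simp add: exp_sum[symmetric] sum_distrib_left mult_ac)
  finally show ?thesis .
qed

text \<open>The interface between the models: the moment and tail bounds for \<open>S\<close> use
  only this, so either the sub-Gaussian or the variance estimate can be plugged in.\<close>

definition cosh_bound :: "nat set \<Rightarrow> (nat \<Rightarrow> real) \<Rightarrow> real \<Rightarrow> bool" where
  "cosh_bound J w B \<longleftrightarrow> (\<integral>x. cosh (T J w x) \<partial>iid) \<le> B"

lemma T_uminus: "T J (\<lambda>k. - w k) x = - T J w x"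
  by (simp add: T_def sum_negf)

lemma cosh_boundI:
  assumes "(\<integral>x. exp (T J w x) \<partial>iid) \<le> B" "(\<integral>x. exp (T J (\<lambda>k. - w k) x) \<partial>iid) \<le> B"
  shows "cosh_bound J w B"
proof -
  have i: "integrable iid (\<lambda>x. exp (T J w x))" "integrable iid (\<lambda>x. exp (- T J w x))"
    by (rule integrable_T_comp, intro continuous_intros)+
  have "(\<integral>x. cosh (T J w x) \<partial>iid) = (\<integral>x. (exp (T J w x) + exp (- T J w x)) / 2 \<partial>iid)"
    by (simp add: cosh_field_def)
  also have "\<dots> = ((\<integral>x. exp (T J w x) \<partial>iid) + (\<integral>x. exp (- T J w x) \<partial>iid)) / 2"
    using i by simp
  also have "\<dots> \<le> B" using assms by (simp add: T_uminus)
  finally show ?thesis by (simp add: cosh_bound_def)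
qed

lemma cosh_bound_le: "finite J \<Longrightarrow> cosh_bound J w (exp (2 * C\<^sup>2 * (\<Sum>k\<in>J. (w k)\<^sup>2)))"
  using mgf_T_le[of J w] mgf_T_le[of J "\<lambda>k. - w k"] by (intro cosh_boundI) auto

lemma cosh_bound_variance:
  assumes "finite J" "(\<integral>x. (p x)\<^sup>2 \<partial>circ) \<le> v" "\<And>k. k \<in> J \<Longrightarrow> \<bar>w k\<bar> \<le> l"
  shows "cosh_bound J w (exp (v / 2 * exp (l * C) * (\<Sum>k\<in>J. (w k)\<^sup>2)))"
  using mgf_T_le_variance[OF assms(1,2), of w l] mgf_T_le_variance[OF assms(1,2), of "\<lambda>k. - w k" l] assms(3)
  by (intro cosh_boundI) auto

text \<open>The polynomial has degree at most s, so its mean can be computed in the independent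
  model, where cosh dominates it.\<close>

lemma integral_even_exp_le:
  assumes J: "finite J" "J \<subseteq> I" and q: "q \<le> s" and B: "cosh_bound J w B"
  shows "(\<integral>x. even_exp q (S J w x) \<partial>circ) \<le> B"
proof -
  have i: "integrable circ (\<lambda>x. S J w x ^ k)" "integrable iid (\<lambda>x. T J w x ^ k)" for k
    by (rule integrable_S_comp integrable_T_comp, intro continuous_intros)+
  have c: "integrable iid (\<lambda>x. cosh (T J w x))"
    by (rule integrable_T_comp) (auto simp: cosh_field_def intro!: continuous_intros)
  have eq: "even_exp q y = (\<Sum>k\<le>q. (if even k then 1 / fact k else 0) * y ^ k)" for y
    by (auto simp: even_exp_def intro!: sum.cong)
  have "(\<integral>x. even_exp q (S J w x) \<partial>circ) = (\<Sum>k\<le>q. (if even k then 1 / fact k else 0) * (\<integral>x. S J w x ^ k \<partial>circ))"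
    unfolding eq using i by (subst Bochner_Integration.integral_sum) auto
  also have "\<dots> = (\<Sum>k\<le>q. (if even k then 1 / fact k else 0) * (\<integral>x. T J w x ^ k \<partial>iid))"
    using J q by (intro sum.cong refl) (auto simp: moments_eq)
  also have "\<dots> = (\<integral>x. even_exp q (T J w x) \<partial>iid)"
    unfolding eq using i by (subst Bochner_Integration.integral_sum) auto
  also have "\<dots> \<le> (\<integral>x. cosh (T J w x) \<partial>iid)"
    unfolding eq using i c even_exp_le_cosh[of q] by (intro integral_mono) (auto simp: eq)
  finally show ?thesis using B by (simp add: cosh_bound_def)
qed

lemma integrable_even_exp_S: "integrable circ (\<lambda>x. even_exp q (S J w x))"
proof (rule integrable_S_comp)
  have "even_exp q = (\<lambda>y. \<Sum>k\<le>q. (if even k then 1 / fact k else 0) * y ^ k)"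
    by (intro ext) (auto simp: even_exp_def intro!: sum.cong)
  then show "continuous_on UNIV (even_exp q)" by (auto intro!: continuous_intros)
qed

lemma even_moment_le:
  assumes J: "finite J" "J \<subseteq> I" and q: "q \<le> s" "even q" and B: "cosh_bound J w B"
  shows "(\<integral>x. S J w x ^ q \<partial>circ) \<le> fact q * B"
proof -
  have i: "integrable circ (\<lambda>x. S J w x ^ q)" by (rule integrable_S_comp, intro continuous_intros)
  have "(\<integral>x. S J w x ^ q / fact q \<partial>circ) \<le> (\<integral>x. even_exp q (S J w x) \<partial>circ)"
    using i integrable_even_exp_S even_exp_ge_term[OF q(2) order_refl] by (intro integral_mono) auto
  also have "\<dots> \<le> B" by (rule integral_even_exp_le) fact+
  finally show ?thesis by (simp add: field_simps)
qed

text \<open>A Chernoff bound whose Laplace variable is already inside w. The order s must exceed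
  three times the exponent y, since below that the truncated exponential is no longer comparable to
  the exponential.\<close>

lemma tail_le:
  assumes J: "finite J" "J \<subseteq> I" and y: "y \<ge> 0" "real s \<ge> 3 * y + 1" and B: "cosh_bound J w B"
  shows "circ.prob {x. \<bar>S J w x\<bar> \<ge> y} \<le> 4 * B * exp (- y)"
proof -
  have "circ.prob {x. \<bar>S J w x\<bar> \<ge> y} * (exp y / 4) = (\<integral>x. indicator {x. \<bar>S J w x\<bar> \<ge> y} x * (exp y / 4) \<partial>circ)"
    by simp
  also have "\<dots> \<le> (\<integral>x. even_exp s (S J w x) \<partial>circ)"
  proof (intro integral_mono)
    show "indicator {x. \<bar>S J w x\<bar> \<ge> y} x * (exp y / 4) \<le> even_exp s (S J w x)" for x
    proof (cases "\<bar>S J w x\<bar> \<ge> y")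
      case True
      then have "exp y / 4 \<le> even_exp s (S J w x)"
        using even_exp_ge[OF y] even_exp_mono[OF y(1) True, of s] by linarith
      then show ?thesis using True by simp
    next
      case False
      then show ?thesis by (auto simp: even_exp_def zero_le_even_power intro!: sum_nonneg)
    qed
  qed (use integrable_even_exp_S in \<open>auto intro!: integrable_circ_bounded[of _ "exp y / 4"] simp: indicator_def\<close>)
  also have "\<dots> \<le> B" by (rule integral_even_exp_le) (use J B in auto)
  finally show ?thesis by (simp add: exp_minus field_simps)
qed

text \<open>Taylor polynomials of degree s - 1 have equal means in both models, and both remainders
  are at most the s-th moment divided by s!, again a common value as s is even.\<close>

lemma char_diff_le:
  assumes J: "finite J" "J \<subseteq> I" and s: "even s" "s > 0"
  shows "cmod ((\<integral>x. iexp (S J w x) \<partial>circ) - (\<integral>x. iexp (T J w x) \<partial>iid))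
    \<le> 2 * exp (15 * C\<^sup>2 * (\<Sum>k\<in>J. (w k)\<^sup>2) - real s)"
proof -
  define m where "m = s - 1"
  have m: "Suc m = s" "m \<le> s" using s by (auto simp: m_def)
  let ?P = "\<lambda>y. \<Sum>k\<le>m. (\<i> * complex_of_real y) ^ k / fact k"
  let ?M = "\<integral>x. T J w x ^ s \<partial>iid"
  have i: "integrable circ (\<lambda>x. complex_of_real (S J w x) ^ k)" "integrable iid (\<lambda>x. complex_of_real (T J w x) ^ k)" 
    and ir: "integrable circ (\<lambda>x. S J w x ^ k)" "integrable iid (\<lambda>x. T J w x ^ k)" for k
    by (rule integrable_S_comp[of "\<lambda>y. complex_of_real y ^ k"] integrable_T_comp[of "\<lambda>y. complex_of_real y ^ k"] 
        integrable_S_comp[of "\<lambda>y. y ^ k"] integrable_T_comp[of "\<lambda>y. y ^ k"], intro continuous_intros)+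
  have ie: "integrable circ (\<lambda>x. iexp (S J w x))" "integrable iid (\<lambda>x. iexp (T J w x))"
    by (rule integrable_S_comp[of iexp] integrable_T_comp[of iexp], intro continuous_intros)+
  have eqm: "(\<integral>x. complex_of_real (S J w x) ^ k \<partial>circ) = (\<integral>x. complex_of_real (T J w x) ^ k \<partial>iid)" if "k \<le> s" for k
    using moments_eq[OF that J, of w] by (simp del: of_real_power add: of_real_power[symmetric])
  have iP: "integrable circ (\<lambda>x. ?P (S J w x))" "integrable iid (\<lambda>x. ?P (T J w x))"
    using i by (auto simp: power_mult_distrib)
  have eqP: "(\<integral>x. ?P (S J w x) \<partial>circ) = (\<integral>x. ?P (T J w x) \<partial>iid)"
    using i eqm m by (simp add: power_mult_distrib)
  have app: "cmod (iexp y - ?P y) \<le> y ^ s / fact s" for y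
    using iexp_approx1[of y m] m s by (simp add: power_even_abs)
  have 1: "cmod ((\<integral>x. iexp (S J w x) \<partial>circ) - (\<integral>x. ?P (S J w x) \<partial>circ)) \<le> (\<integral>x. S J w x ^ s / fact s \<partial>circ)"
  proof -
    have "(\<integral>x. iexp (S J w x) \<partial>circ) - (\<integral>x. ?P (S J w x) \<partial>circ) = (\<integral>x. iexp (S J w x) - ?P (S J w x) \<partial>circ)"
      using ie iP by (subst Bochner_Integration.integral_diff) auto
    also have "cmod \<dots> \<le> (\<integral>x. S J w x ^ s / fact s \<partial>circ)"
      using ie iP ir app by (intro norm_integral_le) auto
    finally show ?thesis .
  qed
  have 2: "cmod ((\<integral>x. iexp (T J w x) \<partial>iid) - (\<integral>x. ?P (T J w x) \<partial>iid)) \<le> (\<integral>x. T J w x ^ s / fact s \<partial>iid)"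
  proof -
    have "(\<integral>x. iexp (T J w x) \<partial>iid) - (\<integral>x. ?P (T J w x) \<partial>iid) = (\<integral>x. iexp (T J w x) - ?P (T J w x) \<partial>iid)"
      using ie iP by (subst Bochner_Integration.integral_diff) auto
    also have "cmod \<dots> \<le> (\<integral>x. T J w x ^ s / fact s \<partial>iid)"
      using ie iP ir app by (intro norm_integral_le) auto
    finally show ?thesis .
  qed
  have "?M / fact s = (\<integral>x. S J w x ^ s \<partial>circ) / fact s" using moments_eq[of s J w] J by simp
  then have "cmod ((\<integral>x. iexp (S J w x) \<partial>circ) - (\<integral>x. iexp (T J w x) \<partial>iid)) \<le> 2 * (?M / fact s)"
    using 1 2 eqP norm_triangle_ineq4[of "(\<integral>x. iexp (S J w x) \<partial>circ) - (\<integral>x. ?P (S J w x) \<partial>circ)"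
        "(\<integral>x. iexp (T J w x) \<partial>iid) - (\<integral>x. ?P (T J w x) \<partial>iid)"] by simp
  also have "?M / fact s \<le> exp (15 * C\<^sup>2 * (\<Sum>k\<in>J. (w k)\<^sup>2) - real s)"
  proof -
    \<comment> \<open>Estimating the moment of the sum dilated by exp 1 gains the factor exp (-s);
      the price is (exp 1)^2 in the exponent, whence 15 \<ge> 2 (exp 1)^2.\<close>
    have "(\<integral>x. S J (\<lambda>k. exp 1 * w k) x ^ s \<partial>circ) \<le> fact s * exp (2 * C\<^sup>2 * (\<Sum>k\<in>J. (exp 1 * w k)\<^sup>2))"
      by (intro even_moment_le cosh_bound_le) (use J s in auto)
    also have "(\<lambda>x. S J (\<lambda>k. exp 1 * w k) x) = (\<lambda>x. exp 1 * S J w x)"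
      by (simp add: S_def sum_distrib_left mult.assoc)
    also have "(\<integral>x. (exp 1 * S J w x) ^ s \<partial>circ) = exp (real s) * ?M"
      using moments_eq[of s J w] J by (simp add: power_mult_distrib exp_of_nat_mult[symmetric])
    also have "(\<Sum>k\<in>J. (exp 1 * w k)\<^sup>2) = (exp 1)\<^sup>2 * (\<Sum>k\<in>J. (w k)\<^sup>2)"
      by (simp add: power_mult_distrib sum_distrib_left)
    finally have "exp (real s) * ?M \<le> fact s * exp (2 * C\<^sup>2 * ((exp 1)\<^sup>2 * (\<Sum>k\<in>J. (w k)\<^sup>2)))" .
    also have "\<dots> \<le> fact s * exp (15 * C\<^sup>2 * (\<Sum>k\<in>J. (w k)\<^sup>2))"
    proof (intro mult_left_mono)
      have "exp 1 \<le> (2.73::real)" using abs_le_D1[OF e_approx_32] by (simp add: field_simps)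
      then have "(exp 1)\<^sup>2 \<le> (2.73::real)\<^sup>2" by (intro power_mono) auto
      also have "\<dots> \<le> 15 / 2" by (simp add: power2_eq_square)
      finally have "2 * (exp 1)\<^sup>2 \<le> (15::real)" by simp
      then have "2 * (exp 1)\<^sup>2 * (C\<^sup>2 * (\<Sum>k\<in>J. (w k)\<^sup>2)) \<le> 15 * (C\<^sup>2 * (\<Sum>k\<in>J. (w k)\<^sup>2))"
        by (intro mult_right_mono mult_nonneg_nonneg sum_nonneg) auto
      then show "exp (2 * C\<^sup>2 * ((exp 1)\<^sup>2 * (\<Sum>k\<in>J. (w k)\<^sup>2))) \<le> exp (15 * C\<^sup>2 * (\<Sum>k\<in>J. (w k)\<^sup>2))"
        by (simp add: mult_ac)
    qed simp
    finally show ?thesis by (simp add: exp_diff field_simps)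
  qed
  finally show ?thesis by simp
qed

end

text \<open>Take for B the indices of the M smallest elements: a forbidden relation outside B would,
  by Condition A, involve an index of B. Injectivity bounds the size of B.\<close>

lemma condition_A_dissociated:
  assumes cond: "condition_A \<omega> n" and n_pos: "\<And>k. 1 \<le> k \<Longrightarrow> 0 < n k" and inj: "inj_on n {1..}"
  obtains N0 where "\<And>M s H. M \<ge> N0 \<Longrightarrow> real s \<le> \<omega> M \<Longrightarrow> real H \<le> real M powr \<omega> M \<Longrightarrow>
    \<exists>B. finite B \<and> card B \<le> M \<and> dissociated s H n ({1..} - B)"
proof -
  obtain N0 where N0: "\<And>N r (k :: nat \<Rightarrow> nat) (a :: nat \<Rightarrow> int). N \<ge> N0 \<Longrightarrow> 2 \<le> r \<Longrightarrow> real r \<le> \<omega> N \<Longrightarrow>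
        k ` {1..r} \<subseteq> {1..} \<Longrightarrow> inj_on k {1..r} \<Longrightarrow>
        (\<forall>i\<in>{1..r}. a i \<noteq> 0 \<and> real_of_int \<bar>a i\<bar> \<le> real N powr \<omega> N) \<Longrightarrow>
        (\<Sum>i=1..r. a i * int (n (k i))) = 0 \<Longrightarrow>
        (\<forall>i\<in>{1..r}. n (k i) \<in> smallest_elements n N)"
    using cond unfolding condition_A_def by blast
  show thesis
  proof (rule that)
    fix M s H assume M: "M \<ge> N0" and s: "real s \<le> \<omega> M" and H: "real H \<le> real M powr \<omega> M"
    define B where "B = {k\<in>{1..}. n k \<in> smallest_elements n M}"
    have injB: "inj_on n B" using inj by (rule inj_on_subset) (auto simp: B_def)
    have sub: "n ` B \<subseteq> smallest_elements n M" by (auto simp: B_def)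
    have fin: "finite (smallest_elements n M)" "card (smallest_elements n M) \<le> M"
      using card_image_le[of "{..<M}" "enumerate (n ` {1..})"] by (auto simp: smallest_elements_def)
    have "finite B" "card B \<le> M"
      using inj_on_finite[OF injB sub fin(1)] card_inj_on_le[OF injB sub fin(1)] fin(2) by auto
    moreover have "dissociated s H n ({1..} - B)"
      unfolding dissociated_def
    proof (intro allI impI notI)
      fix S :: "nat set" and b :: "nat \<Rightarrow> int"
      assume S: "finite S" "S \<noteq> {}" "S \<subseteq> {1..} - B" "card S \<le> s" and b: "\<forall>k\<in>S. b k \<noteq> 0 \<and> \<bar>b k\<bar> \<le> int H"
        and 0: "(\<Sum>k\<in>S. b k * int (n k)) = 0"
      show False
      proof (cases "card S \<ge> 2")
        case True
        obtain h where h: "bij_betw h {1..card S} S" using ex_bij_betw_nat_finite_1[OF S(1)] by blast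
        then have hS: "h ` {1..card S} = S" and hi: "inj_on h {1..card S}" by (auto simp: bij_betw_def)
        have "\<forall>i\<in>{1..card S}. n (h i) \<in> smallest_elements n M"
        proof (rule N0[where a = "\<lambda>i. b (h i)"])
          show "\<forall>i\<in>{1..card S}. b (h i) \<noteq> 0 \<and> real_of_int \<bar>b (h i)\<bar> \<le> real M powr \<omega> M"
          proof
            fix i assume "i \<in> {1..card S}"
            then have "h i \<in> S" using hS by blast
            then have "b (h i) \<noteq> 0" "\<bar>b (h i)\<bar> \<le> int H" using b by auto
            moreover from this(2) have "real_of_int \<bar>b (h i)\<bar> \<le> real H" by linarith
            ultimately show "b (h i) \<noteq> 0 \<and> real_of_int \<bar>b (h i)\<bar> \<le> real M powr \<omega> M" using H by auto
          qed
          show "(\<Sum>i = 1..card S. b (h i) * int (n (h i))) = 0"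
            using sum.reindex_bij_betw[OF h, of "\<lambda>k. b k * int (n k)"] 0 by simp
        qed (use M True s S hS hi in auto)
        then have "h 1 \<in> B" using S hS True by (auto simp: B_def)
        moreover have "h 1 \<in> S" using hS True by auto
        ultimately show False using S by auto
      next
        case False
        \<comment> \<open>One-term relations are outside Condition A, which starts at two terms;
          positivity of \<open>n k\<close> excludes them.\<close>
        then have "card S = 1" using S card_gt_0_iff[of S] by linarith
        then obtain k where k: "S = {k}" by (rule card_1_singletonE)
        then show False using 0 b S n_pos[of k] by auto
      qed
    qed
    ultimately show "\<exists>B. finite B \<and> card B \<le> M \<and> dissociated s H n ({1..} - B)" by blast
  qed
qed

section \<open>Comparison with the independent model\<close>

lemma cmod_iexp_diff_le: "cmod (iexp a - iexp b) \<le> \<bar>a - b\<bar>" for a b :: real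
proof -
  have "iexp a - iexp b = iexp b * (iexp (a - b) - 1)"
    by (simp add: right_diff_distrib exp_add[symmetric])
  also have "cmod \<dots> = cmod (iexp (a - b) - 1)" by (simp add: norm_mult)
  also have "\<dots> \<le> \<bar>a - b\<bar>" using iexp_approx1[of "a - b" 0] by simp
  finally show ?thesis .
qed

text \<open>
  \<open>B\<close> holds the indices \<open>k\<close> for which \<open>n k\<close> is among the smallest elements of the sequence, and
  \<open>p\<close> is a Fejer mean of \<open>f\<close>.
\<close>

locale approx_system = dissociated_system n s D "{1..} - B" p C for n s D B p C +
  fixes f :: "real \<Rightarrow> real" and \<delta> :: real
  assumes f_borel [measurable]: "f \<in> borel_measurable borel" and f_per: "\<And>x. f (x + 1) = f x"
    and f_le: "\<And>x. \<bar>f x\<bar> \<le> C" and dist: "(\<integral>x. \<bar>f x - p x\<bar> \<partial>circ) \<le> \<delta>"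
    and n_pos: "\<And>k. 1 \<le> k \<Longrightarrow> 0 < n k" and finite_B: "finite B"
begin

text \<open>A majorant of the replacement error at each point, estimated in mean only. It grows with
  J, so a single exceptional set serves all initial segments or blocks in a range.\<close>

definition R :: "nat set \<Rightarrow> (nat \<Rightarrow> real) \<Rightarrow> real \<Rightarrow> real" where
  "R J w x = (\<Sum>k\<in>J. \<bar>w k\<bar> * \<bar>f (real (n k) * x) - p (real (n k) * x)\<bar>)"

definition R' :: "nat set \<Rightarrow> (nat \<Rightarrow> real) \<Rightarrow> (nat \<Rightarrow> real) \<Rightarrow> real" where
  "R' J w \<omega> = (\<Sum>k\<in>J. \<bar>w k\<bar> * \<bar>f (\<omega> k) - p (\<omega> k)\<bar>)"

lemma f_component [measurable]: "(\<lambda>\<omega>. f (\<omega> k)) \<in> borel_measurable iid"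
  and p_component [measurable]: "(\<lambda>\<omega>. p (\<omega> k)) \<in> borel_measurable iid"
  by (rule measurable_iid_comp; measurable)+

lemma R_measurable [measurable]: "R J w \<in> borel_measurable borel"
  and R'_measurable [measurable]: "R' J w \<in> borel_measurable iid"
  unfolding R_def R'_def by measurable

lemma diff_le: "\<bar>f x - p x\<bar> \<le> 2 * C"
  using f_le[of x] p_le[of x] by linarith

lemma C_nonneg: "C \<ge> 0" using p_le[of 0] by linarith

lemma R_integrable: "integrable circ (R J w)"
  unfolding R_def using diff_le
  by (intro Bochner_Integration.integrable_sum integrable_mult_right integrable_circ_bounded[of _ "2 * C"]) auto

lemma R'_integrable: "integrable iid (R' J w)"
  unfolding R'_def using diff_le
  by (intro Bochner_Integration.integrable_sum integrable_mult_right iid.integrable_const_bound[of _ "2 * C"]) auto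

lemma R_le:
  assumes "J \<subseteq> {1..}"
  shows "(\<integral>x. R J w x \<partial>circ) \<le> (\<Sum>k\<in>J. \<bar>w k\<bar>) * \<delta>"
proof -
  have i: "integrable circ (\<lambda>x. \<bar>f (a * x) - p (a * x)\<bar>)" for a
    using diff_le by (intro integrable_circ_bounded[of _ "2 * C"]) auto
  have "(\<integral>x. R J w x \<partial>circ) = (\<Sum>k\<in>J. \<bar>w k\<bar> * (\<integral>x. \<bar>f (real (n k) * x) - p (real (n k) * x)\<bar> \<partial>circ))"
    unfolding R_def using i by simp
  also have "\<dots> = (\<Sum>k\<in>J. \<bar>w k\<bar> * (\<integral>x. \<bar>f x - p x\<bar> \<partial>circ))"
  proof (intro sum.cong refl arg_cong2[where f = "(*)"])
    fix k assume "k \<in> J"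
    then have "n k > 0" using assms n_pos[of k] by auto
    then show "(\<integral>x. \<bar>f (real (n k) * x) - p (real (n k) * x)\<bar> \<partial>circ) = (\<integral>x. \<bar>f x - p x\<bar> \<partial>circ)"
      using integral_circ_affine[of "\<lambda>x. \<bar>f x - p x\<bar>" "n k" 0] by (simp add: f_per trig_poly_periodic[OF trig])
  qed
  also have "\<dots> \<le> (\<Sum>k\<in>J. \<bar>w k\<bar> * \<delta>)" by (intro sum_mono mult_left_mono dist) auto
  finally show ?thesis by (simp add: sum_distrib_right)
qed

lemma R'_le: "(\<integral>x. R' J w x \<partial>iid) \<le> (\<Sum>k\<in>J. \<bar>w k\<bar>) * \<delta>"
proof -
  have i: "integrable iid (\<lambda>\<omega>. \<bar>f (\<omega> k) - p (\<omega> k)\<bar>)" for k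
    using diff_le by (intro iid.integrable_const_bound[of _ "2 * C"]) auto
  have "(\<integral>x. R' J w x \<partial>iid) = (\<Sum>k\<in>J. \<bar>w k\<bar> * (\<integral>\<omega>. \<bar>f (\<omega> k) - p (\<omega> k)\<bar> \<partial>iid))"
    unfolding R'_def using i by simp
  also have "\<dots> = (\<Sum>k\<in>J. \<bar>w k\<bar> * (\<integral>x. \<bar>f x - p x\<bar> \<partial>circ))"
    by (subst integral_iid_component[of "\<lambda>x. \<bar>f x - p x\<bar>"]) auto
  also have "\<dots> \<le> (\<Sum>k\<in>J. \<bar>w k\<bar> * \<delta>)" by (intro sum_mono mult_left_mono dist) auto
  finally show ?thesis by (simp add: sum_distrib_right)
qed

lemma sum_approx_aux:
  assumes J: "finite J"
  shows "\<bar>(\<Sum>k\<in>J. w k * f (y k)) - (\<Sum>k\<in>J - B. w k * p (y k))\<bar>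
    \<le> (\<Sum>k\<in>J. \<bar>w k\<bar> * \<bar>f (y k) - p (y k)\<bar>) + C * (\<Sum>k\<in>J \<inter> B. \<bar>w k\<bar>)"
proof -
  have "(\<Sum>k\<in>J. w k * p (y k)) = (\<Sum>k\<in>J - B. w k * p (y k)) + (\<Sum>k\<in>J \<inter> B. w k * p (y k))"
    using sum.Int_Diff[OF J, of "\<lambda>k. w k * p (y k)" B] by simp
  then have "(\<Sum>k\<in>J. w k * f (y k)) - (\<Sum>k\<in>J - B. w k * p (y k))
     = (\<Sum>k\<in>J. w k * (f (y k) - p (y k))) + (\<Sum>k\<in>J \<inter> B. w k * p (y k))"
    by (simp add: sum_subtractf right_diff_distrib)
  also have "\<bar>\<dots>\<bar> \<le> (\<Sum>k\<in>J. \<bar>w k * (f (y k) - p (y k))\<bar>) + (\<Sum>k\<in>J \<inter> B. \<bar>w k * p (y k)\<bar>)"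
    by (intro order_trans[OF abs_triangle_ineq] add_mono sum_abs)
  also have "\<dots> \<le> (\<Sum>k\<in>J. \<bar>w k\<bar> * \<bar>f (y k) - p (y k)\<bar>) + C * (\<Sum>k\<in>J \<inter> B. \<bar>w k\<bar>)"
    unfolding sum_distrib_left
    by (intro add_mono sum_mono) (auto simp: abs_mult mult.commute[of C] intro!: mult_left_mono p_le)
  finally show ?thesis .
qed

lemma S_approx:
  "finite J \<Longrightarrow> \<bar>(\<Sum>k\<in>J. w k * f (real (n k) * x)) - S (J - B) w x\<bar> \<le> R J w x + C * (\<Sum>k\<in>J \<inter> B. \<bar>w k\<bar>)"
  unfolding S_def R_def by (rule sum_approx_aux)

lemma T_approx:
  "finite J \<Longrightarrow> \<bar>(\<Sum>k\<in>J. w k * f (\<omega> k)) - T (J - B) w \<omega>\<bar> \<le> R' J w \<omega> + C * (\<Sum>k\<in>J \<inter> B. \<bar>w k\<bar>)"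
  unfolding T_def R'_def by (rule sum_approx_aux)

text \<open>Passing from f to p costs the same in both models, hence the factor 2; the last term is
  the comparison for p.\<close>

lemma char_compare:
  assumes J: "finite J" "J \<subseteq> {1..}" and s: "even s" "s > 0"
  shows "cmod ((\<integral>x. iexp (\<Sum>k\<in>J. w k * f (real (n k) * x)) \<partial>circ) - (\<integral>\<omega>. iexp (\<Sum>k\<in>J. w k * f (\<omega> k)) \<partial>iid))
    \<le> 2 * ((\<Sum>k\<in>J. \<bar>w k\<bar>) * \<delta> + C * (\<Sum>k\<in>J \<inter> B. \<bar>w k\<bar>)) + 2 * exp (15 * C\<^sup>2 * (\<Sum>k\<in>J. (w k)\<^sup>2) - real s)"
proof -
  let ?c = "C * (\<Sum>k\<in>J \<inter> B. \<bar>w k\<bar>)"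
  have m1: "(\<lambda>x. \<Sum>k\<in>J. w k * f (real (n k) * x)) \<in> borel_measurable circ"
    by measurable
  have m2: "(\<lambda>\<omega>. \<Sum>k\<in>J. w k * f (\<omega> k)) \<in> borel_measurable iid" by measurable
  have i: "integrable circ (\<lambda>x. iexp (S (J - B) w x))" "integrable iid (\<lambda>x. iexp (T (J - B) w x))"
    by (rule integrable_S_comp[of iexp] integrable_T_comp[of iexp], intro continuous_intros)+
  have i2: "integrable circ (\<lambda>x. iexp (\<Sum>k\<in>J. w k * f (real (n k) * x)))"
    "integrable iid (\<lambda>\<omega>. iexp (\<Sum>k\<in>J. w k * f (\<omega> k)))"
    using m1 m2 by (auto intro!: circ.integrable_const_bound[of _ 1] iid.integrable_const_bound[of _ 1] simp del: of_real_sum)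
  have 1: "cmod ((\<integral>x. iexp (\<Sum>k\<in>J. w k * f (real (n k) * x)) \<partial>circ) - (\<integral>x. iexp (S (J - B) w x) \<partial>circ))
      \<le> (\<Sum>k\<in>J. \<bar>w k\<bar>) * \<delta> + ?c"
  proof -
    have "(\<integral>x. iexp (\<Sum>k\<in>J. w k * f (real (n k) * x)) \<partial>circ) - (\<integral>x. iexp (S (J - B) w x) \<partial>circ)
      = (\<integral>x. iexp (\<Sum>k\<in>J. w k * f (real (n k) * x)) - iexp (S (J - B) w x) \<partial>circ)"
      using i i2 by (subst Bochner_Integration.integral_diff) auto
    also have "cmod \<dots> \<le> (\<integral>x. R J w x + ?c \<partial>circ)"
      using i i2 R_integrable[of J w]
      by (intro norm_integral_le order_trans[OF cmod_iexp_diff_le S_approx[OF J(1)]]) auto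
    also have "\<dots> = (\<integral>x. R J w x \<partial>circ) + ?c"
      using R_integrable[of J w] by (simp add: circ.prob_space[simplified])
    finally show ?thesis using R_le[OF J(2), of w] by linarith
  qed
  have 2: "cmod ((\<integral>\<omega>. iexp (\<Sum>k\<in>J. w k * f (\<omega> k)) \<partial>iid) - (\<integral>x. iexp (T (J - B) w x) \<partial>iid))
      \<le> (\<Sum>k\<in>J. \<bar>w k\<bar>) * \<delta> + ?c"
  proof -
    have "(\<integral>\<omega>. iexp (\<Sum>k\<in>J. w k * f (\<omega> k)) \<partial>iid) - (\<integral>x. iexp (T (J - B) w x) \<partial>iid)
      = (\<integral>\<omega>. iexp (\<Sum>k\<in>J. w k * f (\<omega> k)) - iexp (T (J - B) w \<omega>) \<partial>iid)"
      using i i2 by (subst Bochner_Integration.integral_diff) auto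
    also have "cmod \<dots> \<le> (\<integral>x. R' J w x + ?c \<partial>iid)"
      using i i2 R'_integrable[of J w]
      by (intro norm_integral_le order_trans[OF cmod_iexp_diff_le T_approx[OF J(1)]]) auto
    also have "\<dots> = (\<integral>x. R' J w x \<partial>iid) + ?c"
      using R'_integrable[of J w] by (simp add: iid.prob_space[simplified])
    finally show ?thesis using R'_le[of J w] by linarith
  qed
  have "cmod ((\<integral>x. iexp (S (J - B) w x) \<partial>circ) - (\<integral>x. iexp (T (J - B) w x) \<partial>iid))
      \<le> 2 * exp (15 * C\<^sup>2 * (\<Sum>k\<in>J - B. (w k)\<^sup>2) - real s)"
    by (rule char_diff_le) (use J s in auto)
  also have "15 * C\<^sup>2 * (\<Sum>k\<in>J - B. (w k)\<^sup>2) \<le> 15 * C\<^sup>2 * (\<Sum>k\<in>J. (w k)\<^sup>2)"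
    using J by (intro mult_left_mono sum_mono2) auto
  finally have 3: "cmod ((\<integral>x. iexp (S (J - B) w x) \<partial>circ) - (\<integral>x. iexp (T (J - B) w x) \<partial>iid))
      \<le> 2 * exp (15 * C\<^sup>2 * (\<Sum>k\<in>J. (w k)\<^sup>2) - real s)" by simp
  have *: "cmod (a - d) \<le> 2 * r + e" if "cmod (a - b) \<le> r" "cmod (d - c) \<le> r" "cmod (b - c) \<le> e" for a b c d r e
    using norm_triangle_ineq[of "a - b" "b - c"] norm_triangle_ineq4[of "a - c" "d - c"] that by simp
  show ?thesis by (rule *[OF 1 2 3])
qed

end

text \<open>Condition A is present in the form \<open>diss_ex\<close>, bounded variation in the form
  of the majorant w.\<close>

locale weakly_lacunary =
  fixes \<omega> :: "nat \<Rightarrow> real" and n :: "nat \<Rightarrow> nat" and f w :: "real \<Rightarrow> real" and C V :: real and N0 :: nat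
  assumes f_borel [measurable]: "f \<in> borel_measurable borel" and f_per: "\<And>x. f (x + 1) = f x"
    and f_le: "\<And>x. \<bar>f x\<bar> \<le> C" and f_mean: "(\<integral>x. f x \<partial>circ) = 0"
    and w_shift: "\<And>x. w (x + 1) = w x + V" and w_bound: "\<And>x y. x \<le> y \<Longrightarrow> \<bar>f y - f x\<bar> \<le> w y - w x"
    and n_pos: "\<And>k. 1 \<le> k \<Longrightarrow> 0 < n k"
    and omega_lim: "filterlim \<omega> at_top sequentially"
    and diss_ex: "\<And>M s H. M \<ge> N0 \<Longrightarrow> real s \<le> \<omega> M \<Longrightarrow> real H \<le> real M powr \<omega> M \<Longrightarrow>
      \<exists>B. finite B \<and> card B \<le> M \<and> dissociated s H n ({1..} - B)"
begin

definition v :: real where "v = (\<integral>x. (f x)\<^sup>2 \<partial>circ)"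

definition F :: "nat \<Rightarrow> real \<Rightarrow> real" where
  "F N x = (\<Sum>k=1..N. f (real (n k) * x))"

lemma F_measurable [measurable]: "F N \<in> borel_measurable borel"
  unfolding F_def by measurable

lemma f_component [measurable]: "(\<lambda>\<omega>. f (\<omega> k)) \<in> borel_measurable iid"
  by (rule measurable_iid_comp) measurable

lemma C_nonneg: "C \<ge> 0" using f_le[of 0] by linarith

lemma f_square_le: "(f x)\<^sup>2 \<le> C\<^sup>2"
  using power_mono[OF f_le[of x], of 2] by simp

lemma V_nonneg: "V \<ge> 0" using w_bound[of 0 1] w_shift[of 0] by auto

text \<open>Since s \<le> M, coefficients up to \<open>s * M ^ (2 * L)\<close> are at most
  \<open>M ^ (2 * L + 1)\<close>, which Condition A allows once \<omega> M \<ge> 2 L + 1. The L1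
  error is V divided by the root of the degree.\<close>

lemma scale_ex:
  fixes L :: nat
  shows "eventually (\<lambda>M. \<forall>s. real s \<le> \<omega> M \<longrightarrow> s \<le> M \<longrightarrow>
    (\<exists>B p. card B \<le> M \<and> approx_system n s (M ^ (2 * L)) B p C f (V / real M ^ L))) sequentially"
proof -
  have "eventually (\<lambda>M. \<omega> M \<ge> real (2 * L + 1)) sequentially"
    using omega_lim by (simp add: filterlim_at_top)
  moreover have "eventually (\<lambda>M. M \<ge> max N0 1) sequentially" by (rule eventually_ge_at_top)
  ultimately show ?thesis
  proof eventually_elim
    case (elim M)
    show ?case
    proof (intro allI impI)
      fix s assume s: "real s \<le> \<omega> M" "s \<le> M"
      have "real (s * M ^ (2 * L)) \<le> real (M * M ^ (2 * L))" using s by (intro of_nat_mono mult_right_mono) auto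
      also have "\<dots> = real M ^ (2 * L + 1)" by simp
      also have "\<dots> = real M powr real (2 * L + 1)" using elim by (intro powr_realpow[symmetric]) simp
      also have "\<dots> \<le> real M powr \<omega> M" using elim by (intro powr_mono) auto
      finally obtain B where B: "finite B" "card B \<le> M" "dissociated s (s * M ^ (2 * L)) n ({1..} - B)"
        using diss_ex[of M s "s * M ^ (2 * L)"] elim s by (auto simp del: of_nat_mult)
      obtain p where p: "trig_poly (M ^ (2 * L)) p" "\<And>x. \<bar>p x\<bar> \<le> C" "(\<integral>x. p x \<partial>circ) = 0"
        "(\<integral>x. \<bar>f x - p x\<bar> \<partial>circ) \<le> V / sqrt (real (M ^ (2 * L)))"
        using fejer_approximation[OF f_borel f_le f_per f_mean w_shift w_bound, of "M ^ (2 * L)"] elim by auto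
      have "sqrt (real (M ^ (2 * L))) = real M ^ L" by (simp add: mult.commute[of 2] power_mult)
      then have "approx_system n s (M ^ (2 * L)) B p C f (V / real M ^ L)"
        using B p by unfold_locales (auto simp: f_per f_le n_pos)
      then show "\<exists>B p. card B \<le> M \<and> approx_system n s (M ^ (2 * L)) B p C f (V / real M ^ L)"
        using B by blast
    qed
  qed
qed

section \<open>The central limit theorem\<close>

lemma iid_char_sum:
  assumes "finite J"
  shows "(\<integral>\<omega>. iexp (\<Sum>k\<in>J. t * f (\<omega> k)) \<partial>iid) = (\<integral>x. iexp (t * f x) \<partial>circ) ^ card J"
proof -
  have "(\<integral>\<omega>. iexp (\<Sum>k\<in>J. t * f (\<omega> k)) \<partial>iid) = (\<integral>\<omega>. (\<Prod>k\<in>J. iexp (t * f (\<omega> k))) \<partial>iid)"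
    using assms by (simp add: sum_distrib_left exp_sum)
  also have "\<dots> = (\<Prod>k\<in>J. \<integral>x. iexp (t * f x) \<partial>circ)"
    by (rule integral_iid_prod[OF assms, of _ "\<lambda>_. 1"]) auto
  finally show ?thesis by simp
qed

lemma iid_clt:
  assumes v: "v > 0"
  shows "weak_conv_m (\<lambda>N. distr iid borel (\<lambda>\<omega>. (\<Sum>i<N. f (\<omega> i)) / sqrt (real N * v))) std_normal_distribution"
proof -
  have i2: "integrable circ (\<lambda>x. (f x)\<^sup>2)"
    by (rule integrable_circ_bounded[of _ "C\<^sup>2"]) (auto simp: f_square_le)
  have "weak_conv_m (\<lambda>N. distr iid borel (\<lambda>\<omega>. (\<Sum>i<N. f (\<omega> i)) / sqrt (real N * (sqrt v)\<^sup>2))) std_normal_distribution"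
  proof (rule iid.central_limit_theorem_zero_mean)
    show "iid.indep_vars (\<lambda>i. borel) (\<lambda>i \<omega>. f (\<omega> i)) UNIV" by (rule indep_vars_iid_comp) simp
    show mean: "iid.expectation (\<lambda>\<omega>. f (\<omega> k)) = 0" for k
      by (subst integral_iid_component) (auto simp: f_mean)
    show "integrable iid (\<lambda>\<omega>. (f (\<omega> k))\<^sup>2)" for k
      by (rule iid.integrable_const_bound[of _ "C\<^sup>2"]) (auto simp: f_square_le)
    show "iid.variance (\<lambda>\<omega>. f (\<omega> k)) = (sqrt v)\<^sup>2" for k
      unfolding mean using v integral_iid_component[of "\<lambda>x. (f x)\<^sup>2" k] by (simp add: v_def)
    show "distr iid borel (\<lambda>\<omega>. f (\<omega> k)) = distr circ borel f" for k
      by (subst distr_iid_component[of k, symmetric], subst distr_distr) (auto simp: comp_def intro: measurable_iid_component cong: measurable_cong_sets)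
  qed (use v in simp)
  then show ?thesis using v by simp
qed

lemma iid_char_limit:
  assumes v: "v > 0"
  shows "(\<lambda>N. (\<integral>x. iexp (t / sqrt (real N) * f x) \<partial>circ) ^ N) \<longlonglongrightarrow> exp (- (v * t\<^sup>2) / 2)"
proof -
  let ?D = "\<lambda>N. distr iid borel (\<lambda>\<omega>. (\<Sum>i<N. f (\<omega> i)) / sqrt (real N * v))"
  have "(\<lambda>N. char (?D N) (t * sqrt v)) \<longlonglongrightarrow> char std_normal_distribution (t * sqrt v)"
    by (rule levy_continuity1[OF _ real_dist_normal_dist iid_clt[OF v]])
       (auto intro!: iid.real_distribution_distr)
  moreover have "char (?D N) (t * sqrt v) = (\<integral>x. iexp (t / sqrt (real N) * f x) \<partial>circ) ^ N" for N
  proof -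
    have "char (?D N) (t * sqrt v) = (\<integral>\<omega>. iexp (t * sqrt v * ((\<Sum>i<N. f (\<omega> i)) / sqrt (real N * v))) \<partial>iid)"
      unfolding char_def by (subst integral_distr) auto
    also have "\<dots> = (\<integral>\<omega>. iexp (\<Sum>i<N. t / sqrt (real N) * f (\<omega> i)) \<partial>iid)"
      using v by (intro Bochner_Integration.integral_cong refl arg_cong[where f = iexp] arg_cong[where f = complex_of_real])
        (simp add: real_sqrt_mult sum_distrib_left sum_divide_distrib)
    also have "\<dots> = (\<integral>x. iexp (t / sqrt (real N) * f x) \<partial>circ) ^ N"
      by (subst iid_char_sum) auto
    finally show ?thesis .
  qed
  ultimately show ?thesis using v by (simp add: char_std_normal_distribution power_mult_distrib mult.commute)
qed

lemma char_F_limit: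
  assumes v: "v > 0"
  shows "(\<lambda>N. \<integral>x. iexp (t * (real N powr (- 1 / 2) * F N x)) \<partial>circ) \<longlonglongrightarrow> exp (- (v * t\<^sup>2) / 2)"
proof -
  define a where "a N = (\<integral>x. iexp (t * (real N powr (- 1 / 2) * F N x)) \<partial>circ)" for N
  define b where "b N = (\<integral>x. iexp (t / sqrt (real N) * f x) \<partial>circ) ^ N" for N
  have "(\<lambda>N. a N - b N) \<longlonglongrightarrow> 0"
  proof (rule LIMSEQ_I)
    fix e :: real assume e: "e > 0"
    have "eventually (\<lambda>s. 2 * exp (15 * C\<^sup>2 * t\<^sup>2 - real s) < e / 2) sequentially"
    proof -
      have "(\<lambda>s. 2 * exp (15 * C\<^sup>2 * t\<^sup>2 - real s)) \<longlonglongrightarrow> 0" by real_asymp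
      then show ?thesis by (rule order_tendstoD(2)) (use e in simp)
    qed
    then obtain s0 where s0: "\<And>s. s \<ge> s0 \<Longrightarrow> 2 * exp (15 * C\<^sup>2 * t\<^sup>2 - real s) < e / 2"
      by (auto simp: eventually_sequentially)
    \<comment> \<open>The order is fixed, depending on t and e, before N grows; \<omega> exceeds it
      eventually. It is even and positive as the comparison of characteristic functions
      requires.\<close>
    define s where "s = 2 * Suc s0"
    have s: "even s" "s > 0" "2 * exp (15 * C\<^sup>2 * t\<^sup>2 - real s) < e / 2"
      using s0[of s] by (auto simp: s_def)
    \<comment> \<open>With M about N^(1/4) the exceptional indices contribute M / sqrt N, of order
      N^(-1/4), and L = 4 makes the L1 error sqrt N / M^4, of order N^(-1/2).\<close>
    define M where "M N = nat \<lfloor>real N powr (1/4)\<rfloor>" for N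
    have Mlim: "filterlim M at_top sequentially" unfolding M_def by real_asymp
    have "eventually (\<lambda>M. (\<forall>s. real s \<le> \<omega> M \<longrightarrow> s \<le> M \<longrightarrow>
        (\<exists>B p. card B \<le> M \<and> approx_system n s (M ^ (2 * 4)) B p C f (V / real M ^ 4))) \<and> \<omega> M \<ge> real s \<and> M \<ge> max s 1) sequentially"
      using omega_lim by (intro eventually_conj scale_ex eventually_ge_at_top) (simp add: filterlim_at_top)
    then have "eventually (\<lambda>N. \<exists>B p. card B \<le> M N \<and> approx_system n s (M N ^ (2 * 4)) B p C f (V / real (M N) ^ 4)) sequentially"
      using Mlim by (rule eventually_compose_filterlim[THEN eventually_mono]) auto
    moreover have "eventually (\<lambda>N. 2 * (\<bar>t\<bar> * (sqrt (real N) * (V / real (M N) ^ 4) + C * real (M N) / sqrt (real N))) < e / 2) sequentially"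
    proof -
      have "(\<lambda>N. 2 * (\<bar>t\<bar> * (sqrt (real N) * (V / real (M N) ^ 4) + C * real (M N) / sqrt (real N)))) \<longlonglongrightarrow>
        2 * (\<bar>t\<bar> * (V * 0 + C * 0))"
      proof -
        have 1: "(\<lambda>N. sqrt (real N) / real (M N) ^ 4) \<longlonglongrightarrow> 0" unfolding M_def by real_asymp
        have 2: "(\<lambda>N. real (M N) / sqrt (real N)) \<longlonglongrightarrow> 0" unfolding M_def by real_asymp
        have "(\<lambda>N. 2 * (\<bar>t\<bar> * (V * (sqrt (real N) / real (M N) ^ 4) + C * (real (M N) / sqrt (real N))))) \<longlonglongrightarrow>
            2 * (\<bar>t\<bar> * (V * 0 + C * 0))"
          by (intro tendsto_intros 1 2)
        then show ?thesis by (simp add: mult_ac)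
      qed
      then show ?thesis by (rule order_tendstoD(2)) (use e in simp)
    qed
    moreover have "eventually (\<lambda>N. N \<ge> 1) sequentially" by (rule eventually_ge_at_top)
    ultimately have "eventually (\<lambda>N. cmod (a N - b N - 0) < e) sequentially"
    proof eventually_elim
      case (elim N)
      then obtain B p where B: "card B \<le> M N" and ap: "approx_system n s (M N ^ (2 * 4)) B p C f (V / real (M N) ^ 4)" by blast
      interpret A: approx_system n s "M N ^ (2 * 4)" B p C f "V / real (M N) ^ 4" by (rule ap)
      let ?w = "t / sqrt (real N)"
      have "a N = (\<integral>x. iexp (\<Sum>k=1..N. ?w * f (real (n k) * x)) \<partial>circ)"
      proof -
        have "real N powr (- (1 / 2)) = 1 / sqrt (real N)"
          unfolding powr_minus powr_half_sqrt[OF of_nat_0_le_iff] by (rule inverse_eq_divide)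
        then have "t * (real N powr (- 1 / 2) * F N x) = (\<Sum>k=1..N. ?w * f (real (n k) * x))" for x
          by (simp add: F_def sum_distrib_left)
        then show ?thesis by (simp only: a_def)
      qed
      moreover have "b N = (\<integral>\<omega>. iexp (\<Sum>k=1..N. ?w * f (\<omega> k)) \<partial>iid)"
        unfolding b_def by (subst iid_char_sum) auto
      ultimately have "cmod (a N - b N) \<le> 2 * ((\<Sum>k=1..N. \<bar>?w\<bar>) * (V / real (M N) ^ 4) + C * (\<Sum>k\<in>{1..N} \<inter> B. \<bar>?w\<bar>))
          + 2 * exp (15 * C\<^sup>2 * (\<Sum>k=1..N. ?w\<^sup>2) - real s)"
        using A.char_compare[of "{1..N}" "\<lambda>_. ?w"] s by auto
      also have "(\<Sum>k=1..N. ?w\<^sup>2) = t\<^sup>2" using elim by (simp add: power_divide)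
      also have "2 * ((\<Sum>k=1..N. \<bar>?w\<bar>) * (V / real (M N) ^ 4) + C * (\<Sum>k\<in>{1..N} \<inter> B. \<bar>?w\<bar>))
        \<le> 2 * (\<bar>t\<bar> * (sqrt (real N) * (V / real (M N) ^ 4) + C * real (M N) / sqrt (real N)))"
      proof -
        have "(\<Sum>k=1..N. \<bar>?w\<bar>) = \<bar>t\<bar> * sqrt (real N)"
        proof -
          have "(\<Sum>k=1..N. \<bar>?w\<bar>) = \<bar>t\<bar> * (real N / sqrt (real N))" by (simp add: abs_divide)
          then show ?thesis by (simp only: real_div_sqrt[OF of_nat_0_le_iff])
        qed
        then have e1: "(\<Sum>k=1..N. \<bar>?w\<bar>) * (V / real (M N) ^ 4) = \<bar>t\<bar> * (sqrt (real N) * (V / real (M N) ^ 4))"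
          by simp
        have "card ({1..N} \<inter> B) \<le> M N"
          using card_mono[of B "{1..N} \<inter> B"] A.finite_B B by auto
        then have "(\<Sum>k\<in>{1..N} \<inter> B. \<bar>?w\<bar>) \<le> real (M N) * \<bar>?w\<bar>"
          by (simp add: mult_right_mono del: abs_divide)
        then have "C * (\<Sum>k\<in>{1..N} \<inter> B. \<bar>?w\<bar>) \<le> C * (real (M N) * \<bar>?w\<bar>)" by (intro mult_left_mono C_nonneg)
        also have "\<dots> = \<bar>t\<bar> * (C * real (M N) / sqrt (real N))" by (simp add: abs_divide)
        finally have e2: "C * (\<Sum>k\<in>{1..N} \<inter> B. \<bar>?w\<bar>) \<le> \<bar>t\<bar> * (C * real (M N) / sqrt (real N))" .
        have "2 * (a + b) \<le> 2 * (c * (p + q))" if "a = c * p" "b \<le> c * q" for a b c p q :: real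
          using that by (simp add: distrib_left)
        then show ?thesis using e1 e2 by blast
      qed
      finally show ?case using s elim by simp
    qed
    then show "\<exists>no. \<forall>N\<ge>no. cmod (a N - b N - 0) < e" by (simp add: eventually_sequentially)
  qed
  moreover have "b \<longlonglongrightarrow> exp (- (v * t\<^sup>2) / 2)" unfolding b_def by (rule iid_char_limit[OF v])
  ultimately have "(\<lambda>N. (a N - b N) + b N) \<longlonglongrightarrow> 0 + complex_of_real (exp (- (v * t\<^sup>2) / 2))" by (rule tendsto_add)
  then show ?thesis by (simp add: a_def)
qed

lemma f_AE_zero:
  assumes "v = 0" "m > 0"
  shows "AE x in circ. f (real m * x) = 0"
proof -
  have "integrable circ (\<lambda>x. (f (real m * x + 0))\<^sup>2)"
    by (rule integrable_circ_bounded[of _ "C\<^sup>2"]) (auto simp: f_square_le)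
  moreover have "(\<integral>x. (f (real m * x + 0))\<^sup>2 \<partial>circ) = 0"
    using integral_circ_affine[of "\<lambda>x. (f x)\<^sup>2" m 0] assms by (simp add: f_per v_def)
  ultimately show ?thesis by (subst (asm) integral_nonneg_eq_0_iff_AE) auto
qed

theorem clt: "weak_conv_m (\<lambda>N. distr circ borel (\<lambda>x. real N powr (- 1 / 2) * F N x)) (centered_normal v)"
proof (rule levy_continuity)
  show "real_distribution (distr circ borel (\<lambda>x. real N powr (- 1 / 2) * F N x))" for N
    by (rule circ.real_distribution_distr) measurable
  have v0: "v \<ge> 0" by (simp add: v_def)
  \<comment> \<open>As a scaled image of the standard normal law, the limit has a known
    characteristic function. For v = 0 the law is a point mass and the sums vanish almost
    surely.\<close>
  have cn: "centered_normal v = distr std_normal_distribution borel (\<lambda>x. sqrt v * x)" if "v \<noteq> 0"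
  proof -
    have s: "sqrt v > 0" using v0 that by simp
    interpret N: prob_space std_normal_distribution using real_dist_normal_dist by (simp add: real_distribution_def)
    have "distributed std_normal_distribution lborel (\<lambda>x. x) std_normal_density"
      unfolding distributed_def by (auto simp: distr_id2 normal_density_nonneg)
    then have "distributed std_normal_distribution lborel (\<lambda>x. sqrt v * x) (normal_density 0 (sqrt v))"
      using N.normal_standard_normal_convert[OF s, of "\<lambda>x. sqrt v * x" 0] s by simp
    then have "distr std_normal_distribution lborel (\<lambda>x. sqrt v * x) = centered_normal v"
      using that by (simp add: distributed_def centered_normal_def)
    moreover have "distr std_normal_distribution lborel (\<lambda>x. sqrt v * x) = distr std_normal_distribution borel (\<lambda>x. sqrt v * x)"
      by (rule distr_cong) auto
    ultimately show ?thesis by simp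
  qed
  show "real_distribution (centered_normal v)"
  proof (cases "v = 0")
    case True
    then show ?thesis by (auto simp: centered_normal_def real_distribution_def real_distribution_axioms_def intro: prob_space_return)
  next
    case False
    interpret N: prob_space std_normal_distribution using real_dist_normal_dist by (simp add: real_distribution_def)
    show ?thesis unfolding cn[OF False] by (rule N.real_distribution_distr) auto
  qed
  fix t
  have ch: "char (distr circ borel (\<lambda>x. real N powr (- 1 / 2) * F N x)) t
      = (\<integral>x. iexp (t * (real N powr (- 1 / 2) * F N x)) \<partial>circ)" for N
    unfolding char_def by (subst integral_distr) auto
  show "(\<lambda>N. char (distr circ borel (\<lambda>x. real N powr (- 1 / 2) * F N x)) t) \<longlonglongrightarrow> char (centered_normal v) t"
  proof (cases "v = 0")
    case True
    have "(\<integral>x. iexp (t * (real N powr (- 1 / 2) * F N x)) \<partial>circ) = (\<integral>x. 1 \<partial>circ)" for N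
    proof (rule integral_cong_AE)
      have "AE x in circ. \<forall>k\<in>{1..N}. f (real (n k) * x) = 0"
        by (rule AE_finite_allI) (use f_AE_zero True n_pos in auto)
      then show "AE x in circ. iexp (t * (real N powr (- 1 / 2) * F N x)) = 1"
        by eventually_elim (simp add: F_def)
    qed auto
    moreover have "char (centered_normal v) t = 1"
      using True by (simp add: centered_normal_def char_def integral_return)
    ultimately show ?thesis unfolding ch by (simp add: circ.prob_space[simplified])
  next
    case False
    then have v: "v > 0" using v0 by simp
    have "char (centered_normal v) t = char std_normal_distribution (t * sqrt v)"
      unfolding cn[OF False] char_def by (subst integral_distr) (auto simp: mult_ac)
    then have "char (centered_normal v) t = exp (- (v * t\<^sup>2) / 2)"
      using v by (simp add: char_std_normal_distribution power_mult_distrib mult.commute)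
    then show ?thesis unfolding ch using char_F_limit[OF v, of t] by simp
  qed
qed

end

section \<open>The upper half of the law of the iterated logarithm\<close>

lemma (in prob_space) markov_le:
  fixes g :: "'a \<Rightarrow> real"
  assumes "integrable M g" "\<And>x. g x \<ge> 0" "c > 0" and sp: "space M = UNIV"
  shows "prob {x. g x \<ge> c} \<le> (\<integral>x. g x \<partial>M) / c"
proof -
  have [measurable]: "g \<in> borel_measurable M" using assms by auto
  have "{x. g x \<ge> c} = {x\<in>space M. g x \<ge> c}" by (simp add: sp)
  also have "\<dots> \<in> sets M" by measurable
  finally have s: "{x. g x \<ge> c} \<in> sets M" .
  have "prob {x. g x \<ge> c} * c = (\<integral>x. indicator {x. g x \<ge> c} x * c \<partial>M)"
    using s by (simp add: sp)
  also have "\<dots> \<le> (\<integral>x. g x \<partial>M)"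
    using assms s by (intro integral_mono integrable_mult_left integrable_real_indicator) (auto simp: indicator_def emeasure_eq_measure)
  finally show ?thesis using assms by (simp add: field_simps)
qed

lemma (in dissociated_system) S_scale: "S J (\<lambda>_. l) x = l * S J (\<lambda>_. 1) x"
  by (simp add: S_def sum_distrib_left)

text \<open>Markov's inequality for the moment of order 2 u. In contrast to \<open>tail_le\<close>
  the bound is a power of m / y^2 and improves for short sums at a fixed order, which is what
  chaining needs.\<close>

lemma (in dissociated_system) moment_tail_le:
  assumes J: "finite J" "J \<subseteq> I" "real (card J) \<le> m" and m: "m > 0" and u: "u > 0" "2 * u \<le> s"
    and y: "y > 0" and C: "C > 0"
  shows "circ.prob {x. \<bar>S J (\<lambda>_. 1) x\<bar> \<ge> y} \<le> (C\<^sup>2 * exp 4 * (2 * real u) * m / y\<^sup>2) ^ u"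
proof -
  \<comment> \<open>Chosen so that the sub-Gaussian exponent 2 C^2 l^2 m equals 4 u, of the same
    order as the moment.\<close>
  define l where "l = sqrt (2 * real u / (C\<^sup>2 * m))"
  have l: "l > 0" "l\<^sup>2 = 2 * real u / (C\<^sup>2 * m)" using m u C by (auto simp: l_def)
  have i: "integrable circ (\<lambda>x. S J (\<lambda>_. l) x ^ (2 * u))" by (rule integrable_S_comp, intro continuous_intros)
  have "{x. \<bar>S J (\<lambda>_. 1) x\<bar> \<ge> y} \<subseteq> {x. S J (\<lambda>_. l) x ^ (2 * u) \<ge> (l * y) ^ (2 * u)}"
  proof safe
    fix x assume "y \<le> \<bar>S J (\<lambda>_. 1) x\<bar>"
    then have "(l * y) ^ (2 * u) \<le> \<bar>l * S J (\<lambda>_. 1) x\<bar> ^ (2 * u)"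
      using l y by (intro power_mono) (auto simp: abs_mult)
    then show "(l * y) ^ (2 * u) \<le> S J (\<lambda>_. l) x ^ (2 * u)" by (simp add: S_scale[of J l] power_even_abs)
  qed
  then have "circ.prob {x. \<bar>S J (\<lambda>_. 1) x\<bar> \<ge> y} \<le> circ.prob {x. S J (\<lambda>_. l) x ^ (2 * u) \<ge> (l * y) ^ (2 * u)}"
    by (intro circ.finite_measure_mono) auto
  also have "\<dots> \<le> (\<integral>x. S J (\<lambda>_. l) x ^ (2 * u) \<partial>circ) / (l * y) ^ (2 * u)"
    using i l y by (intro circ.markov_le) auto
  also have "\<dots> \<le> ((2 * real u) ^ (2 * u) * exp (4 * real u)) / (l * y) ^ (2 * u)"
  proof (intro divide_right_mono)
    have "(\<integral>x. S J (\<lambda>_. l) x ^ (2 * u) \<partial>circ) \<le> fact (2 * u) * exp (2 * C\<^sup>2 * (\<Sum>k\<in>J. l\<^sup>2))"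
      using J u by (intro even_moment_le cosh_bound_le) auto
    also have "\<dots> \<le> (2 * real u) ^ (2 * u) * exp (4 * real u)"
    proof (intro mult_mono)
      show "fact (2 * u) \<le> (2 * real u) ^ (2 * u)" using fact_le_power[of "2 * u", where 'a = real] by simp
      have "2 * C\<^sup>2 * (\<Sum>k\<in>J. l\<^sup>2) = 2 * C\<^sup>2 * l\<^sup>2 * real (card J)" by simp
      also have "\<dots> \<le> 2 * C\<^sup>2 * l\<^sup>2 * m" using J by (intro mult_left_mono) auto
      also have "\<dots> = 4 * real u" using l m C by simp
      finally show "exp (2 * C\<^sup>2 * (\<Sum>k\<in>J. l\<^sup>2)) \<le> exp (4 * real u)" by simp
    qed auto
    finally show "(\<integral>x. S J (\<lambda>_. l) x ^ (2 * u) \<partial>circ) \<le> (2 * real u) ^ (2 * u) * exp (4 * real u)" .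
  qed simp
  also have "\<dots> = ((2 * real u)\<^sup>2 * exp 4 / (l\<^sup>2 * y\<^sup>2)) ^ u"
  proof -
    have "exp (4 * real u) = exp 4 ^ u" using exp_of_nat_mult[of u "4::real"] by (simp add: mult.commute)
    then show ?thesis by (simp only: power_mult power_divide power_mult_distrib)
  qed
  also have "(2 * real u)\<^sup>2 * exp 4 / (l\<^sup>2 * y\<^sup>2) = C\<^sup>2 * exp 4 * (2 * real u) * m / y\<^sup>2"
  proof -
    have "2 * real u = l\<^sup>2 * (C\<^sup>2 * m)" using l(2) m C by simp
    then have "(2 * real u)\<^sup>2 = (2 * real u) * (l\<^sup>2 * (C\<^sup>2 * m))" by (simp add: power2_eq_square)
    then show ?thesis unfolding \<open>(2 * real u)\<^sup>2 = _\<close> using l(1) by (simp del: power_mult_distrib)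
  qed
  finally show ?thesis .
qed

text \<open>Both functions are bounded by C, so closeness in L1 already controls the difference of
  the variances.\<close>

lemma (in approx_system) p_square_le:
  "(\<integral>x. (p x)\<^sup>2 \<partial>circ) \<le> (\<integral>x. (f x)\<^sup>2 \<partial>circ) + 2 * C * \<delta>"
proof -
  have sq: "(g x)\<^sup>2 \<le> C\<^sup>2" if "\<bar>g x\<bar> \<le> C" for g :: "real \<Rightarrow> real" and x
    using power_mono[OF that, of 2] by simp
  have i: "integrable circ (\<lambda>x. (p x)\<^sup>2)" "integrable circ (\<lambda>x. (f x)\<^sup>2)"
    by (rule integrable_circ_bounded[of _ "C\<^sup>2"]; use sq p_le f_le in auto)+
  have i3: "integrable circ (\<lambda>x. \<bar>f x - p x\<bar>)"
    using diff_le by (intro integrable_circ_bounded[of _ "2 * C"]) auto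
  have "(p x)\<^sup>2 \<le> (f x)\<^sup>2 + 2 * C * \<bar>f x - p x\<bar>" for x
  proof -
    have "(p x)\<^sup>2 - (f x)\<^sup>2 = (p x + f x) * (p x - f x)" by (simp add: power2_eq_square algebra_simps)
    also have "\<dots> \<le> \<bar>p x + f x\<bar> * \<bar>p x - f x\<bar>" by (metis abs_ge_self abs_mult)
    also have "\<dots> \<le> (2 * C) * \<bar>p x - f x\<bar>" using p_le[of x] f_le[of x] by (intro mult_right_mono) auto
    finally show ?thesis by (simp add: abs_minus_commute)
  qed
  then have "(\<integral>x. (p x)\<^sup>2 \<partial>circ) \<le> (\<integral>x. (f x)\<^sup>2 + 2 * C * \<bar>f x - p x\<bar> \<partial>circ)"
    using i i3 by (intro integral_mono) auto
  also have "\<dots> = (\<integral>x. (f x)\<^sup>2 \<partial>circ) + 2 * C * (\<integral>x. \<bar>f x - p x\<bar> \<partial>circ)" using i i3 by simp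
  also have "\<dots> \<le> (\<integral>x. (f x)\<^sup>2 \<partial>circ) + 2 * C * \<delta>"
    using dist C_nonneg by (intro add_left_mono mult_left_mono) auto
  finally show ?thesis .
qed

text \<open>Binary expansion of m: if m exceeds half the range, split off the full first half,
  otherwise stay in it. At most one dyadic interval of each length below the full one is used, and
  one more single term at the end, which accounts for the extra \<open>\<Lambda> 0\<close>.\<close>

lemma dyadic_chaining:
  fixes x \<Lambda> :: "nat \<Rightarrow> real"
  assumes "\<And>i d. i \<le> l \<Longrightarrow> d < 2 ^ (l - i) \<Longrightarrow> \<bar>\<Sum>k\<in>{a + d * 2 ^ i<..a + (d + 1) * 2 ^ i}. x k\<bar> \<le> \<Lambda> i"
    and "m \<le> 2 ^ l"
  shows "\<bar>\<Sum>k\<in>{a<..a + m}. x k\<bar> \<le> \<Lambda> 0 + (\<Sum>i<l. \<Lambda> i)"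
  using assms
proof (induction l arbitrary: a m)
  case 0
  have L0: "\<Lambda> 0 \<ge> 0" using 0(1)[of 0 0] by (auto intro: order_trans[OF abs_ge_zero])
  from 0(2) have "m = 0 \<or> m = 1" by auto
  then show ?case using 0(1)[of 0 0] L0 by auto
next
  case (Suc l)
  have first: "\<bar>\<Sum>k\<in>{a + d * 2 ^ i<..a + (d + 1) * 2 ^ i}. x k\<bar> \<le> \<Lambda> i" if "i \<le> l" "d < 2 ^ (l - i)" for i d
    using that by (intro Suc.prems(1)) (auto simp: Suc_diff_le)
  have second: "\<bar>\<Sum>k\<in>{(a + 2 ^ l) + d * 2 ^ i<..(a + 2 ^ l) + (d + 1) * 2 ^ i}. x k\<bar> \<le> \<Lambda> i"
    if "i \<le> l" "d < 2 ^ (l - i)" for i d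
  proof -
    have "(2::nat) ^ l = 2 ^ (l - i) * 2 ^ i" using that by (simp add: power_add[symmetric])
    then have e: "(a + 2 ^ l) + d * 2 ^ i = a + (d + 2 ^ (l - i)) * 2 ^ i"
      "(a + 2 ^ l) + (d + 1) * 2 ^ i = a + (d + 2 ^ (l - i) + 1) * 2 ^ i"
      by (simp_all add: algebra_simps)
    show ?thesis unfolding e using that by (intro Suc.prems(1)) (auto simp: Suc_diff_le)
  qed
  have Ll: "\<Lambda> l \<ge> 0" using first[of l 0] by (auto intro: order_trans[OF abs_ge_zero])
  show ?case
  proof (cases "m \<le> 2 ^ l")
    case True
    have "\<bar>\<Sum>k\<in>{a<..a + m}. x k\<bar> \<le> \<Lambda> 0 + (\<Sum>i<l. \<Lambda> i)" using first True by (rule Suc.IH)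
    then show ?thesis using Ll by simp
  next
    case False
    then have "{a<..a + m} = {a<..a + 2 ^ l} \<union> {a + 2 ^ l<..(a + 2 ^ l) + (m - 2 ^ l)}" by auto
    then have "(\<Sum>k\<in>{a<..a + m}. x k) = (\<Sum>k\<in>{a<..a + 2 ^ l}. x k) + (\<Sum>k\<in>{a + 2 ^ l<..(a + 2 ^ l) + (m - 2 ^ l)}. x k)"
      by (simp add: sum.union_disjoint)
    moreover have "\<bar>\<Sum>k\<in>{a<..a + 2 ^ l}. x k\<bar> \<le> \<Lambda> l" using first[of l 0] by simp
    moreover have "\<bar>\<Sum>k\<in>{a + 2 ^ l<..(a + 2 ^ l) + (m - 2 ^ l)}. x k\<bar> \<le> \<Lambda> 0 + (\<Sum>i<l. \<Lambda> i)"
      using second Suc.prems(2) by (intro Suc.IH) auto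
    ultimately show ?thesis by simp
  qed
qed

text \<open>Only moments of order \<open>ln (ln N)\<close> enter, so a power of \<open>ln k\<close> is more growth than needed.\<close>

locale weakly_lacunary_lil = weakly_lacunary +
  assumes omega_growth: "\<And>K. eventually (\<lambda>M. \<omega> M \<ge> K * ln (ln (real M))) sequentially"
    and v_pos: "v > 0"
begin

lemma C_pos: "C > 0"
proof (rule ccontr)
  assume "\<not> C > 0"
  then have "f x = 0" for x using f_le[of x] by simp
  then show False using v_pos by (simp add: v_def)
qed

text \<open>For N = 2^j, ln j agrees with ln (ln N) up to a bounded term. Doubling the ceiling makes
  the order even.\<close>

definition moment_order :: "real \<Rightarrow> nat \<Rightarrow> nat" where
  "moment_order K j = 2 * nat \<lceil>K * ln (real j)\<rceil>"

lemma moment_order_ge: "2 * (K * ln (real j)) \<le> real (moment_order K j)"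
  unfolding moment_order_def by linarith

lemma moment_order_even: "even (moment_order K j)" by (simp add: moment_order_def)

text \<open>\<open>scale_ex\<close> at M = 2^(j div c), about N^(1/c) for N = 2^j. Then ln (ln M) is
  ln j up to a bounded term, so the growth assumption with constant 8 K leaves room for an order
  near 2 K ln j.\<close>

lemma dyadic_scale_ex:
  fixes L c :: nat and K :: real
  assumes c: "c > 0" and K: "K > 0"
  shows "eventually (\<lambda>j. \<exists>B p. card B \<le> 2 ^ (j div c) \<and>
    approx_system n (moment_order K j) ((2 ^ (j div c)) ^ (2 * L)) B p C f (V / (2 ^ (j div c)) ^ L)) sequentially"
proof -
  have lim: "filterlim (\<lambda>j. (2::nat) ^ (j div c)) at_top sequentially"
  proof -
    have "filterlim (\<lambda>j. j div c) at_top sequentially"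
      unfolding filterlim_at_top
    proof
      fix Z show "eventually (\<lambda>j. Z \<le> j div c) sequentially"
        using eventually_ge_at_top[of "Z * c"] by eventually_elim (simp add: less_eq_div_iff_mult_less_eq c)
    qed
    moreover have "filterlim (\<lambda>i. (2::nat) ^ i) at_top sequentially" by real_asymp
    ultimately show ?thesis by (rule filterlim_compose[rotated])
  qed
  \<comment> \<open>The 2 in the denominator absorbs the rounding in \<open>j div c\<close>.\<close>
  define r where "r = ln 2 / (2 * real c)"
  have r: "r > 0" using c by (simp add: r_def)
  have "eventually (\<lambda>M. (\<forall>s. real s \<le> \<omega> M \<longrightarrow> s \<le> M \<longrightarrow>
        (\<exists>B p. card B \<le> M \<and> approx_system n s (M ^ (2 * L)) B p C f (V / real M ^ L)))
        \<and> \<omega> M \<ge> (8 * K) * ln (ln (real M))) sequentially"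
    by (intro eventually_conj scale_ex omega_growth)
  then have "eventually (\<lambda>j. (\<forall>s. real s \<le> \<omega> (2 ^ (j div c)) \<longrightarrow> s \<le> 2 ^ (j div c) \<longrightarrow>
        (\<exists>B p. card B \<le> 2 ^ (j div c) \<and> approx_system n s ((2 ^ (j div c)) ^ (2 * L)) B p C f (V / real (2 ^ (j div c)) ^ L)))
        \<and> \<omega> (2 ^ (j div c)) \<ge> (8 * K) * ln (ln (real (2 ^ (j div c))))) sequentially"
    using lim by (rule eventually_compose_filterlim)
  moreover have "eventually (\<lambda>j. (8 * K) * ln (r * real j) \<ge> 2 * (K * ln (real j)) + 2) sequentially"
    using K r by real_asymp
  moreover have "eventually (\<lambda>j. 2 * (K * ln (real j)) + 2 \<le> r * real j) sequentially"
    using K r by real_asymp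
  moreover have "eventually (\<lambda>j. K * ln (real j) > 0) sequentially"
    using K r by real_asymp
  moreover have "eventually (\<lambda>j. j \<ge> 2 * c) sequentially" by (rule eventually_ge_at_top)
  ultimately show ?thesis
  proof eventually_elim
    case (elim j)
    have "real (moment_order K j) \<le> 2 * (K * ln (real j)) + 2" using elim(4) unfolding moment_order_def by linarith
    moreover have rj: "r * real j \<le> real (j div c) * ln 2"
    proof -
      have "j < (j div c + 1) * c" using c
        by (metis add.commute div_less_iff_less_mult less_add_one mult.commute)
      then have "real j < (real (j div c) + 1) * real c" by (metis of_nat_1 of_nat_add of_nat_less_iff of_nat_mult)
      moreover have "real c \<le> real (j div c) * real c"
      proof -
        have "1 \<le> j div c" using elim(5) c by (simp add: less_eq_div_iff_mult_less_eq)
        then have "1 * c \<le> (j div c) * c" by (rule mult_le_mono1)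
        then show ?thesis by (metis mult_1 of_nat_le_iff of_nat_mult)
      qed
      ultimately have "real j \<le> 2 * (real (j div c) * real c)" by (simp add: algebra_simps)
      then have "r * real j \<le> r * (2 * (real (j div c) * real c))" using r by (intro mult_left_mono) auto
      also have "\<dots> = real (j div c) * ln 2" using c by (simp add: r_def)
      finally show ?thesis .
    qed
    moreover have "(8 * K) * ln (r * real j) \<le> (8 * K) * ln (ln (real (2 ^ (j div c))))"
      using K r rj elim(5) c by (intro mult_left_mono ln_mono) (auto simp: ln_realpow)
    ultimately have s1: "real (moment_order K j) \<le> \<omega> (2 ^ (j div c))" using elim by linarith
    have "real (moment_order K j) \<le> real (j div c) * ln 2" using \<open>real (moment_order K j) \<le> 2 * (K * ln (real j)) + 2\<close> elim(3) rj by linarith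
    also have "\<dots> \<le> real (j div c) * 1" using ln_2_less_1 by (intro mult_left_mono) auto
    finally have "moment_order K j \<le> j div c" by simp
    also have "\<dots> \<le> 2 ^ (j div c)" by (rule less_imp_le) (rule less_exp)
    finally show ?case using s1 elim(1) by simp
  qed
qed

end

text \<open>2^(1/4), the ratio between thresholds on neighbouring chaining levels. The thresholds
  still form a geometric series, while the variance divided by the squared threshold falls by sqrt 2
  / 2 from each level to the next finer one.\<close>

definition root4 :: real where "root4 = sqrt (sqrt 2)"

lemma root4: "root4 > 1" "root4 ^ 2 = sqrt 2" "root4 ^ 4 = 2"
proof -
  show 1: "root4 > 1" "root4 ^ 2 = sqrt 2" by (auto simp: root4_def)
  have "root4 ^ 4 = (root4 ^ 2) ^ 2" by (simp flip: power_mult)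
  then show "root4 ^ 4 = 2" using 1 by simp
qed

lemma sum_geometric_le:
  fixes q :: real
  assumes "0 \<le> q" "q < 1"
  shows "(\<Sum>i\<le>l. q ^ (l - i)) \<le> 1 / (1 - q)"
proof -
  have "(\<Sum>i\<le>l. q ^ (l - i)) = (\<Sum>i\<le>l. q ^ i)"
    by (rule sum.reindex_bij_witness[of _ "\<lambda>i. l - i" "\<lambda>i. l - i"]) auto
  also have "\<dots> \<le> (\<Sum>i. q ^ i)" using assms by (intro sum_le_suminf summable_geometric) auto
  also have "\<dots> = 1 / (1 - q)" using assms by (intro suminf_geometric) auto
  finally show ?thesis .
qed

text \<open>Each refinement doubles the number of intervals but multiplies the single probability by
  (sqrt 2 / 2)^u, at most 1 / 4 as u \<ge> 4. The union bound is thus a geometric series of ratio 1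
  / 2, headed by exp (-2 u), which \<open>small\<close> provides.\<close>

lemma (in dissociated_system) chain_prob_le:
  assumes I: "{a<..a + 2 ^ l} - B \<subseteq> I" and u: "u \<ge> 4" "2 * u \<le> s" and C: "C > 0" and \<Lambda>: "\<Lambda> > 0"
    and small: "C\<^sup>2 * exp 4 * (2 * real u) * 2 ^ l / \<Lambda>\<^sup>2 \<le> exp (- 2)"
  defines "A \<equiv> \<lambda>i d. {x. \<bar>S ({a + d * 2 ^ i<..a + (d + 1) * 2 ^ i} - B) (\<lambda>_. 1) x\<bar> \<ge> \<Lambda> / root4 ^ (l - i)}"
  shows "circ.prob (\<Union>i\<in>{..l}. \<Union>d\<in>{..<2 ^ (l - i)}. A i d) \<le> 2 * exp (- 2 * real u)"
proof -
  have A_sets: "A i d \<in> sets circ" for i d unfolding A_def by measurable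
  have one: "circ.prob (A i d) \<le> exp (- 2 * real u) * (1 / 4) ^ (l - i)" if i: "i \<le> l" and d: "d < 2 ^ (l - i)" for i d
  proof -
    let ?J = "{a + d * 2 ^ i<..a + (d + 1) * 2 ^ i} - B"
    have pw: "(2::nat) ^ l = 2 ^ (l - i) * 2 ^ i" using i by (simp add: power_add[symmetric])
    have "(d + 1) * 2 ^ i \<le> 2 ^ l" unfolding pw using d by (intro mult_le_mono1) simp
    then have sub: "?J \<subseteq> I" using I by (intro subset_trans[OF _ I]) auto
    have "card ?J \<le> card {a + d * 2 ^ i<..a + (d + 1) * 2 ^ i}" by (intro card_mono) auto
    then have "card ?J \<le> 2 ^ i" by simp
    then have cd: "real (card ?J) \<le> 2 ^ i" by (metis of_nat_le_iff of_nat_numeral of_nat_power)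
    have "circ.prob (A i d) \<le> (C\<^sup>2 * exp 4 * (2 * real u) * 2 ^ i / (\<Lambda> / root4 ^ (l - i))\<^sup>2) ^ u"
      unfolding A_def using sub cd u C \<Lambda> root4 by (intro moment_tail_le) auto
    also have "\<dots> \<le> (exp (- 2) * (sqrt 2 / 2) ^ (l - i)) ^ u"
    proof (intro power_mono)
      have p2: "(2::real) ^ l = 2 ^ (l - i) * 2 ^ i" using i by (simp add: power_add[symmetric])
      have "C\<^sup>2 * exp 4 * (2 * real u) * 2 ^ i / (\<Lambda> / root4 ^ (l - i))\<^sup>2
          = C\<^sup>2 * exp 4 * (2 * real u) * 2 ^ i / \<Lambda>\<^sup>2 * (sqrt 2) ^ (l - i)"
        using root4(2) by (simp add: power_divide power_mult[symmetric] mult.commute[of "l - i"] power_mult)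
      also have "\<dots> = (C\<^sup>2 * exp 4 * (2 * real u) * 2 ^ l / \<Lambda>\<^sup>2) * (sqrt 2 / 2) ^ (l - i)"
        unfolding p2 by (simp add: power_divide)
      also have "\<dots> \<le> exp (- 2) * (sqrt 2 / 2) ^ (l - i)" by (intro mult_right_mono small) auto
      finally show "C\<^sup>2 * exp 4 * (2 * real u) * 2 ^ i / (\<Lambda> / root4 ^ (l - i))\<^sup>2 \<le> exp (- 2) * (sqrt 2 / 2) ^ (l - i)" .
    qed auto
    also have "\<dots> = exp (- 2 * real u) * ((sqrt 2 / 2) ^ u) ^ (l - i)"
      using exp_of_nat_mult[of u "- 2 :: real"]
      by (simp add: power_mult_distrib power_mult[symmetric] mult.commute)
    also have "\<dots> \<le> exp (- 2 * real u) * (1 / 4) ^ (l - i)"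
    proof (intro mult_left_mono power_mono)
      have "sqrt 2 \<le> 2" by (rule real_le_lsqrt) auto
      then have "(sqrt 2 / 2) ^ u \<le> (sqrt 2 / 2) ^ 4" using u by (intro power_decreasing) auto
      also have "(sqrt 2 / 2) ^ 4 = 1 / 4" using power_mult[of "sqrt 2" 2 2] by (simp add: power_divide)
      finally show "(sqrt 2 / 2) ^ u \<le> 1 / 4" .
    qed auto
    finally show ?thesis .
  qed
  have "circ.prob (\<Union>i\<in>{..l}. \<Union>d\<in>{..<2 ^ (l - i)}. A i d) \<le> (\<Sum>i\<le>l. circ.prob (\<Union>d\<in>{..<2 ^ (l - i)}. A i d))"
    using A_sets by (intro measure_UNION_le) auto
  also have "\<dots> \<le> (\<Sum>i\<le>l. \<Sum>d<2 ^ (l - i). circ.prob (A i d))"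
    using A_sets by (intro sum_mono measure_UNION_le) auto
  also have "\<dots> \<le> (\<Sum>i\<le>l. \<Sum>d<(2::nat) ^ (l - i). exp (- 2 * real u) * (1 / 4) ^ (l - i))"
    by (intro sum_mono one) auto
  also have "\<dots> = exp (- 2 * real u) * (\<Sum>i\<le>l. (1 / 2) ^ (l - i))"
  proof -
    have "2 ^ m * (1 / 4) ^ m = ((1 / 2) ^ m :: real)" for m
      by (simp flip: power_mult_distrib)
    moreover have "(\<Sum>i\<le>l. \<Sum>d<(2::nat) ^ (l - i). exp (- 2 * real u) * (1 / 4) ^ (l - i))
        = (\<Sum>i\<le>l. exp (- 2 * real u) * (2 ^ (l - i) * (1 / 4) ^ (l - i)))"
      by (simp add: mult_ac)
    ultimately show ?thesis by (simp only: sum_distrib_left)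
  qed
  also have "\<dots> \<le> exp (- 2 * real u) * 2"
    using sum_geometric_le[of "1/2" l] by (intro mult_left_mono) auto
  finally show ?thesis by simp
qed

text \<open>The factor in front of y in the exponent tends to 1 - 2 = -1 as the approximation error
  \<delta> and the Laplace parameter become small: the Gaussian tail with the exact
  variance.\<close>

lemma (in approx_system) grid_prob_le:
  assumes v: "(\<integral>x. (f x)\<^sup>2 \<partial>circ) = v" "v > 0" and q: "q > 0" and y: "y \<ge> 0" and s: "real s \<ge> 6 * y + 1"
  shows "circ.prob {x. \<bar>S ({1..q} - B) (\<lambda>_. 1) x\<bar> \<ge> sqrt (2 * v * real q * y)}
     \<le> 4 * exp (y * ((v + 2 * C * \<delta>) / v * exp (sqrt (2 * y / (v * real q)) * C) - 2))"
proof -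
  let ?J = "{1..q} - B"
  \<comment> \<open>The optimal Chernoff parameter for a Gaussian of variance v q: at the given
    level its exponent is 2 y.\<close>
  define l where "l = sqrt (2 * y / (v * real q))"
  have l0: "l \<ge> 0" using v q y by (simp add: l_def)
  have l2: "l\<^sup>2 = 2 * y / (v * real q)" using v q y by (simp add: l_def)
  have ly: "l * sqrt (2 * v * real q * y) = 2 * y"
  proof -
    have "l * sqrt (2 * v * real q * y) = sqrt (2 * y / (v * real q) * (2 * v * real q * y))"
      by (simp add: l_def real_sqrt_mult[symmetric] del: real_sqrt_mult)
    also have "2 * y / (v * real q) * (2 * v * real q * y) = (2 * y)\<^sup>2" using v q by (simp add: power2_eq_square)
    finally show ?thesis using y by (simp only: real_sqrt_abs)
  qed
  let ?v' = "v + 2 * C * \<delta>"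
  have p2: "(\<integral>x. (p x)\<^sup>2 \<partial>circ) \<le> ?v'" using p_square_le v by simp
  have v'0: "?v' \<ge> 0" by (rule order_trans[OF _ p2]) simp
  have "{x. \<bar>S ?J (\<lambda>_. 1) x\<bar> \<ge> sqrt (2 * v * real q * y)} \<subseteq> {x. \<bar>S ?J (\<lambda>_. l) x\<bar> \<ge> 2 * y}"
    unfolding S_scale[of _ l] ly[symmetric] using l0 by (auto simp: abs_mult mult_left_mono)
  then have "circ.prob {x. \<bar>S ?J (\<lambda>_. 1) x\<bar> \<ge> sqrt (2 * v * real q * y)} \<le> circ.prob {x. \<bar>S ?J (\<lambda>_. l) x\<bar> \<ge> 2 * y}"
    by (intro circ.finite_measure_mono) auto
  also have "\<dots> \<le> 4 * exp (?v' / 2 * exp (l * C) * (\<Sum>k\<in>?J. l\<^sup>2)) * exp (- (2 * y))"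
    using y s l0 by (intro tail_le cosh_bound_variance p2) auto
  also have "\<dots> \<le> 4 * exp (y * (?v' / v * exp (l * C))) * exp (- (2 * y))"
  proof -
    have "card ?J \<le> q" using card_mono[of "{1..q}" ?J] by auto
    then have "(\<Sum>k\<in>?J. l\<^sup>2) \<le> real q * l\<^sup>2" by (simp add: mult_right_mono)
    also have "\<dots> = 2 * y / v" using l2 q v by simp
    finally have "?v' / 2 * exp (l * C) * (\<Sum>k\<in>?J. l\<^sup>2) \<le> ?v' / 2 * exp (l * C) * (2 * y / v)"
      using v'0 by (intro mult_left_mono) auto
    also have "\<dots> = y * (?v' / v * exp (l * C))"
    proof -
      have "a / 2 * b * (2 * c / d) = c * (a / d * b)" for a b c d :: real by simp
      then show ?thesis by blast
    qed
    finally show ?thesis by simp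
  qed
  also have "\<dots> = 4 * exp (y * (?v' / v * exp (l * C) - 2))"
    by (simp add: exp_diff exp_minus right_diff_distrib mult.commute[of y 2] divide_inverse)
  finally show ?thesis by (simp add: l_def)
qed

lemma (in dissociated_system) sum_if_B:
  assumes "finite J"
  shows "(\<Sum>k\<in>J. if k \<in> B then 0 else p (real (n k) * x)) = S (J - B) (\<lambda>_. 1) x"
proof -
  have "(\<Sum>k\<in>J. if k \<in> B then 0 else p (real (n k) * x)) = (\<Sum>k\<in>J - B. if k \<in> B then 0 else p (real (n k) * x))"
    using assms by (intro sum.mono_neutral_right) auto
  then show ?thesis by (simp add: S_def)
qed

section \<open>Exceptional sets of dyadic ranges are summable\<close>

context weakly_lacunary_lil
begin

text \<open>The range is covered by 2^h grid points, a number independent of j. Each costs about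
  j^(-(1 + \<epsilon>)), which is summable, and the fluctuations between neighbouring grid points
  are left to chaining. The three terms of g belong to the L1 error, the grid and the
  chaining.\<close>

lemma upper_bad_summable:
  assumes \<epsilon>: "\<epsilon> > 0"
  obtains g where "summable g" "eventually (\<lambda>j. circ.prob {x. \<exists>N\<in>{2 ^ j..<2 ^ (j + 1)}.
     \<bar>F N x\<bar> > (1 + 2 * \<epsilon>) * sqrt (2 * v * real N * ln (real j))} \<le> g j) sequentially"
proof -
  define \<theta> where "\<theta> = 1 + \<epsilon>"
  define \<kappa> where "\<kappa> = 1 / (1 - 1 / root4)"
  have \<kappa>: "\<kappa> > 0" using root4(1) by (simp add: \<kappa>_def)
  \<comment> \<open>Makes the chained bound 2 \<kappa> \<Lambda> equal to \<epsilon> / 2 times the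
    normalisation at 2^j.\<close>
  define e where "e = \<epsilon> * sqrt (2 * v) / (4 * \<kappa>)"
  have e: "e > 0" using \<epsilon> \<kappa> v_pos by (simp add: e_def)
  \<comment> \<open>The grid is made so fine that hypothesis \<open>small\<close> of
    \<open>chain_prob_le\<close> holds; the 4 comes from u \<le> 2 ln j.\<close>
  obtain h where h: "4 * C\<^sup>2 * exp 4 / (e\<^sup>2 * exp (- 2)) < 2 ^ h"
    using real_arch_pow[of 2] by auto
  \<comment> \<open>The order must be at least 6 y + 1 for the grid, with y = \<theta>^2 ln j, and
    at least 2 u for the chaining.\<close>
  define K where "K = 6 * \<theta>\<^sup>2 + 1"
  have \<theta>: "\<theta> > 1" using \<epsilon> by (simp add: \<theta>_def)
  have K: "K > 0" "K \<ge> 6 * \<theta>\<^sup>2" "K \<ge> 2" 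
  proof -
    have "\<theta>\<^sup>2 \<ge> 1" using \<theta> by (intro one_le_power) simp
    then show "K > 0" "K \<ge> 6 * \<theta>\<^sup>2" "K \<ge> 2" unfolding K_def by linarith+
  qed
  define g where "g j = 2 ^ 29 * V * (1 / 8) ^ j + 2 ^ h * (4 * real j powr (- (1 + \<epsilon>))) + 2 ^ h * (2 * real j powr (- 2))" for j
  have "summable g"
    unfolding g_def using \<epsilon> by (intro summable_add summable_mult) (auto simp: summable_real_powr_iff)
  moreover have "eventually (\<lambda>j. circ.prob {x. \<exists>N\<in>{2 ^ j..<2 ^ (j + 1)}.
     \<bar>F N x\<bar> > (1 + 2 * \<epsilon>) * sqrt (2 * v * real N * ln (real j))} \<le> g j) sequentially"
  proof -
    \<comment> \<open>The limit is 1. The slack is tuned so that the exponent becomes (1 +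
      \<epsilon>)^2 (\<epsilon> / (1 + \<epsilon>) - 1) = -(1 + \<epsilon>).\<close>
    have "eventually (\<lambda>j. (v + 2 * C * (V / (real j / 8 - 1))) / v * exp (sqrt (2 * (\<theta>\<^sup>2 * ln (real j)) / (v * 2 ^ j)) * C) \<le> 1 + \<epsilon> / (1 + \<epsilon>)) sequentially"
    proof -
      have "((\<lambda>j. (v + 2 * C * (V / (real j / 8 - 1))) / v * exp (sqrt (2 * (\<theta>\<^sup>2 * ln (real j)) / (v * 2 ^ j)) * C)) \<longlongrightarrow> (v + 2 * C * 0) / v * exp (0 * C)) sequentially"
      proof (intro tendsto_intros)
        show "((\<lambda>j. V / (real j / 8 - 1)) \<longlongrightarrow> 0) sequentially" by real_asymp
        have "((\<lambda>j. sqrt (ln (real j) / 2 ^ j)) \<longlongrightarrow> 0) sequentially" by real_asymp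
        then have "((\<lambda>j. sqrt (2 * \<theta>\<^sup>2 / v) * sqrt (ln (real j) / 2 ^ j)) \<longlongrightarrow> sqrt (2 * \<theta>\<^sup>2 / v) * 0) sequentially"
          by (intro tendsto_intros)
        then show "((\<lambda>j. sqrt (2 * (\<theta>\<^sup>2 * ln (real j)) / (v * 2 ^ j))) \<longlongrightarrow> 0) sequentially"
          by (simp add: real_sqrt_mult[symmetric] mult_ac del: real_sqrt_mult)
      qed (use v_pos in auto)
      moreover have "(v + 2 * C * 0) / v * exp (0 * C) < 1 + \<epsilon> / (1 + \<epsilon>)" using \<epsilon> v_pos by simp
      ultimately show ?thesis by (rule order_tendstoD(2)[THEN eventually_mono]) auto
    qed
    moreover have "eventually (\<lambda>j. 1 + C * 2 powr (real j / 8) \<le> \<epsilon> / 2 * sqrt (2 * v * 2 ^ j * ln (real j))) sequentially"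
    proof -
      have "eventually (\<lambda>j. 1 + C * 2 powr (real j / 8) \<le> \<epsilon> / 2 * sqrt (2 * v) * sqrt (2 ^ j * ln (real j))) sequentially"
      proof -
        have "((\<lambda>j. (1 + C * 2 powr (real j / 8)) / sqrt (2 ^ j * ln (real j))) \<longlongrightarrow> 0) sequentially"
          by real_asymp
        moreover have "0 < \<epsilon> / 2 * sqrt (2 * v)" using \<epsilon> v_pos by simp
        ultimately have "eventually (\<lambda>j. (1 + C * 2 powr (real j / 8)) / sqrt (2 ^ j * ln (real j)) < \<epsilon> / 2 * sqrt (2 * v)) sequentially"
          by (rule order_tendstoD(2))
        moreover have "eventually (\<lambda>j. ln (real j) > 0) sequentially" by real_asymp
        ultimately show ?thesis by eventually_elim (simp add: field_simps)
      qed
      then show ?thesis by (simp add: real_sqrt_mult mult.assoc)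
    qed
    moreover have "eventually (\<lambda>j. j \<ge> max h 64) sequentially" by (rule eventually_ge_at_top)
    moreover have "eventually (\<lambda>j. ln (real j) \<ge> 4) sequentially" by real_asymp
    \<comment> \<open>About N^(1/8) exceptional indices are harmless, and with L = 32 the power M^32
      is of order 16^j, so the L1 errors of all 2^(j + 1) terms add up to order 8^(-j).\<close>
    moreover have "eventually (\<lambda>j. \<exists>B p. card B \<le> 2 ^ (j div 8) \<and>
       approx_system n (moment_order K j) ((2 ^ (j div 8)) ^ (2 * 32)) B p C f (V / (2 ^ (j div 8)) ^ 32)) sequentially"
      using dyadic_scale_ex[of 8 K 32] K by simp
    ultimately show ?thesis
    proof eventually_elim
      case (elim j)
      then obtain B p where B: "card B \<le> 2 ^ (j div 8)" and
        ap: "approx_system n (moment_order K j) ((2 ^ (j div 8)) ^ (2 * 32)) B p C f (V / (2 ^ (j div 8)) ^ 32)" by blast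
      define \<delta> where "\<delta> = V / (2 ^ (j div 8)) ^ 32"
      interpret A: approx_system n "moment_order K j" "(2 ^ (j div 8)) ^ (2 * 32)" B p C f \<delta>
        using ap unfolding \<delta>_def .
      have jh: "h \<le> j" and j64: "j \<ge> 64" and lj: "ln (real j) \<ge> 4" using elim by auto
      define l where "l = j - h"
      have pl: "(2::nat) ^ j = 2 ^ h * 2 ^ l" using jh by (simp add: l_def power_add[symmetric])
      define Q where "Q b = 2 ^ j + b * 2 ^ l" for b :: nat
      define \<Lambda> where "\<Lambda> = e * sqrt (2 ^ j * ln (real j))"
      have \<Lambda>: "\<Lambda> > 0" using e lj by (simp add: \<Lambda>_def)
      define u where "u = nat \<lceil>ln (real j)\<rceil>"
      have u: "real u \<ge> ln (real j)" "real u \<le> 2 * ln (real j)" "u \<ge> 4" unfolding u_def using lj by linarith+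
      have mom: "real (moment_order K j) \<ge> 2 * (K * ln (real j))" by (rule moment_order_ge)
      have d8: "real j / 8 - 1 \<le> real (j div 8)" "j div 8 \<ge> 1" "real (j div 8) \<le> real j / 8" using j64 by linarith+
      have \<delta>1: "\<delta> \<le> V / (real j / 8 - 1)"
      proof -
        have "real j / 8 - 1 \<le> real (2 ^ (j div 8))" using d8(1) of_nat_mono[OF less_imp_le[OF less_exp[of "j div 8"]], where 'a = real] by linarith
        also have "\<dots> \<le> (2 ^ (j div 8)) ^ 32" using self_le_power[of "2 ^ (j div 8) :: real" 32] by simp
        finally show ?thesis unfolding \<delta>_def using j64 V_nonneg by (intro divide_left_mono mult_pos_pos) auto
      qed
      have \<delta>2: "2 ^ (j + 1) * \<delta> \<le> 2 ^ 29 * V * (1 / 8) ^ j"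
      proof -
        have "j * 4 \<le> (j div 8) * 32 + 28" by linarith
        then have "(2::real) ^ (j * 4) \<le> 2 ^ ((j div 8) * 32 + 28)" by (intro power_increasing) auto
        then have "(16::real) ^ j \<le> 2 ^ 28 * (2 ^ (j div 8)) ^ 32"
          by (simp add: power_mult[symmetric] power_add power_mult[of 2 4 j, simplified] mult.commute[of j])
        then have "1 / (2 ^ (j div 8)) ^ 32 \<le> 2 ^ 28 / (16::real) ^ j"
          by (simp add: field_simps)
        then have "2 ^ (j + 1) * (V * (1 / (2 ^ (j div 8)) ^ 32)) \<le> 2 ^ (j + 1) * (V * (2 ^ 28 / (16::real) ^ j))"
          using V_nonneg by (intro mult_left_mono) auto
        also have "\<dots> = 2 ^ 29 * V * (2 ^ j / 16 ^ j)" by simp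
        also have "2 ^ j / 16 ^ j = ((1 / 8) ^ j :: real)" by (simp add: power_divide[symmetric])
        finally show ?thesis by (simp add: \<delta>_def)
      qed
      define A1 where "A1 = {x. A.R {1..2 ^ (j + 1)} (\<lambda>_. 1) x \<ge> 1}"
      define A2 where "A2 b = {x. \<bar>A.S ({1..Q b} - B) (\<lambda>_. 1) x\<bar> \<ge> sqrt (2 * v * real (Q b) * (\<theta>\<^sup>2 * ln (real j)))}" for b
      define A3' where "A3' b i d = {x. \<bar>A.S ({Q b + d * 2 ^ i<..Q b + (d + 1) * 2 ^ i} - B) (\<lambda>_. 1) x\<bar> \<ge> \<Lambda> / root4 ^ (l - i)}" for b i d
      define A3 where "A3 b = (\<Union>i\<in>{..l}. \<Union>d\<in>{..<2 ^ (l - i)}. A3' b i d)" for b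
      have sets: "A1 \<in> sets circ" "\<And>b. A2 b \<in> sets circ" "\<And>b i d. A3' b i d \<in> sets circ"
        unfolding A1_def A2_def A3'_def by measurable
      then have sets3: "A3 b \<in> sets circ" for b unfolding A3_def by auto
      have P1: "circ.prob A1 \<le> 2 ^ 29 * V * (1 / 8) ^ j"
      proof -
        have "circ.prob A1 \<le> (\<integral>x. A.R {1..2 ^ (j + 1)} (\<lambda>_. 1) x \<partial>circ) / 1"
          unfolding A1_def by (intro circ.markov_le A.R_integrable) (auto simp: A.R_def sum_nonneg)
        also have "\<dots> \<le> 2 ^ (j + 1) * \<delta>" using A.R_le[of "{1..2 ^ (j + 1)}" "\<lambda>_. 1"] by simp
        finally show ?thesis using \<delta>2 by linarith
      qed
      have P2: "circ.prob (A2 b) \<le> 4 * real j powr (- (1 + \<epsilon>))" for b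
      proof -
        let ?y = "\<theta>\<^sup>2 * ln (real j)"
        have Qb: "Q b \<ge> 2 ^ j" by (simp add: Q_def)
        then have Qb': "real (Q b) \<ge> 2 ^ j" by (metis of_nat_le_iff of_nat_numeral of_nat_power)
        have y0: "?y \<ge> 0" using lj by simp
        have "real (moment_order K j) \<ge> 6 * ?y + 1"
        proof -
          have "6 * \<theta>\<^sup>2 * ln (real j) \<le> K * ln (real j)" using K lj by (intro mult_right_mono) auto
          moreover have "1 \<le> K * ln (real j)" using K lj mult_mono[of 2 K 4 "ln (real j)"] by simp
          ultimately show ?thesis using mom by (simp add: mult_ac)
        qed
        then have "circ.prob (A2 b) \<le> 4 * exp (?y * ((v + 2 * C * \<delta>) / v * exp (sqrt (2 * ?y / (v * real (Q b))) * C) - 2))"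
          unfolding A2_def using v_pos y0 Qb by (intro A.grid_prob_le) (auto simp: v_def Q_def)
        also have "\<dots> \<le> 4 * exp (?y * ((1 + \<epsilon> / (1 + \<epsilon>)) - 2))"
        proof -
          have "(v + 2 * C * \<delta>) / v * exp (sqrt (2 * ?y / (v * real (Q b))) * C)
              \<le> (v + 2 * C * (V / (real j / 8 - 1))) / v * exp (sqrt (2 * ?y / (v * 2 ^ j)) * C)"
          proof (intro mult_mono)
            show "(v + 2 * C * \<delta>) / v \<le> (v + 2 * C * (V / (real j / 8 - 1))) / v"
              using \<delta>1 C_pos v_pos by (intro divide_right_mono add_left_mono mult_left_mono) auto
            have "2 * ?y / (v * real (Q b)) \<le> 2 * ?y / (v * 2 ^ j)"
              using Qb' v_pos y0 by (intro divide_left_mono mult_left_mono mult_pos_pos) (auto simp: Q_def add_pos_nonneg)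
            then show "exp (sqrt (2 * ?y / (v * real (Q b))) * C) \<le> exp (sqrt (2 * ?y / (v * 2 ^ j)) * C)"
              using C_pos by (simp add: mult_right_mono)
            show "0 \<le> (v + 2 * C * (V / (real j / 8 - 1))) / v" using v_pos C_pos V_nonneg j64 by simp
          qed auto
          then show ?thesis using elim(1) y0 by (simp add: mult_left_mono)
        qed
        also have "?y * ((1 + \<epsilon> / (1 + \<epsilon>)) - 2) = - (1 + \<epsilon>) * ln (real j)"
          using \<epsilon> by (simp add: \<theta>_def power2_eq_square field_simps)
        also have "exp (- (1 + \<epsilon>) * ln (real j)) = real j powr (- (1 + \<epsilon>))" using j64 by (simp add: powr_def)
        finally show ?thesis .
      qed
      have P3: "circ.prob (A3 b) \<le> 2 * real j powr (- 2)" for b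
      proof -
        have "C\<^sup>2 * exp 4 * (2 * real u) * 2 ^ l / \<Lambda>\<^sup>2 \<le> exp (- 2)"
        proof -
          have pl': "(2::real) ^ j = 2 ^ h * 2 ^ l" using jh by (simp add: l_def power_add[symmetric])
          have "\<Lambda>\<^sup>2 = e\<^sup>2 * (2 ^ h * 2 ^ l * ln (real j))" using lj by (simp add: \<Lambda>_def power_mult_distrib pl')
          then have "C\<^sup>2 * exp 4 * (2 * real u) * 2 ^ l / \<Lambda>\<^sup>2 = C\<^sup>2 * exp 4 * (2 * real u) / (e\<^sup>2 * 2 ^ h * ln (real j))"
            by simp
          also have "\<dots> \<le> C\<^sup>2 * exp 4 * (4 * ln (real j)) / (e\<^sup>2 * 2 ^ h * ln (real j))"
            using u lj by (intro divide_right_mono mult_left_mono) auto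
          also have "\<dots> = 4 * C\<^sup>2 * exp 4 / (e\<^sup>2 * 2 ^ h)" using lj by simp
          also have "\<dots> \<le> exp (- 2)" using h e by (simp add: field_simps)
          finally show ?thesis .
        qed
        moreover have "2 * u \<le> moment_order K j"
        proof -
          have "2 * ln (real j) \<le> K * ln (real j)" using K lj by (intro mult_right_mono) auto
          then have "2 * real u \<le> real (moment_order K j)" using mom u lj by linarith
          then show ?thesis by simp
        qed
        ultimately have "circ.prob (A3 b) \<le> 2 * exp (- 2 * real u)"
          unfolding A3_def A3'_def using u C_pos \<Lambda> by (intro A.chain_prob_le) auto
        also have "exp (- 2 * real u) \<le> exp (- 2 * ln (real j))" using u by simp
        also have "\<dots> = real j powr (- 2)" using j64 by (simp add: powr_def)
        finally show ?thesis by simp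
      qed
      have "{x. \<exists>N\<in>{2 ^ j..<2 ^ (j + 1)}. \<bar>F N x\<bar> > (1 + 2 * \<epsilon>) * sqrt (2 * v * real N * ln (real j))}
         \<subseteq> A1 \<union> (\<Union>b\<in>{..<2 ^ h}. A2 b) \<union> (\<Union>b\<in>{..<2 ^ h}. A3 b)" (is "?L \<subseteq> ?R")
      proof (rule ccontr)
        assume "\<not> ?L \<subseteq> ?R"
        then obtain x where "x \<in> ?L" and nR: "x \<notin> ?R" by blast
        then obtain N where N: "N \<in> {2 ^ j..<2 ^ (j + 1)}"
          and FN: "\<bar>F N x\<bar> > (1 + 2 * \<epsilon>) * sqrt (2 * v * real N * ln (real j))" by blast
        \<comment> \<open>N lies less than 2^l beyond the grid point Q b; the grid event bounds the
          sum up to Q b, chaining the remainder.\<close>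
        define b where "b = (N - 2 ^ j) div 2 ^ l"
        define m where "m = (N - 2 ^ j) mod 2 ^ l"
        have Nj: "2 ^ j \<le> N" using N by simp
        have "b * 2 ^ l + m = N - 2 ^ j" unfolding b_def m_def by (rule div_mult_mod_eq)
        then have Nb: "N = Q b + m" unfolding Q_def using Nj by linarith
        have m: "m < 2 ^ l" by (simp add: m_def)
        have "N - 2 ^ j < 2 ^ h * 2 ^ l" using N pl by auto
        then have b: "b < 2 ^ h" unfolding b_def by (simp add: less_mult_imp_div_less)
        define X where "X = sqrt (2 * v * real N * ln (real j))"
        have N2: "real N \<ge> 2 ^ j" using N by (metis atLeastLessThan_iff of_nat_le_iff of_nat_numeral of_nat_power)
        have X2: "sqrt (2 * v * 2 ^ j * ln (real j)) \<le> X"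
          unfolding X_def using v_pos lj N2 by (intro real_sqrt_le_mono mult_right_mono mult_left_mono) auto
        have r1: "A.R {1..N} (\<lambda>_. 1) x < 1"
        proof -
          have "A.R {1..N} (\<lambda>_. 1) x \<le> A.R {1..2 ^ (j + 1)} (\<lambda>_. 1) x"
            unfolding A.R_def using N by (intro sum_mono2) auto
          then show ?thesis using nR by (auto simp: A1_def)
        qed
        have r2: "\<bar>A.S ({1..Q b} - B) (\<lambda>_. 1) x\<bar> \<le> \<theta> * X"
        proof -
          have "\<bar>A.S ({1..Q b} - B) (\<lambda>_. 1) x\<bar> \<le> sqrt (2 * v * real (Q b) * (\<theta>\<^sup>2 * ln (real j)))"
          proof -
            have "x \<notin> A2 b" using nR b by blast
            then show ?thesis by (simp add: A2_def)
          qed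
          also have "\<dots> \<le> sqrt (2 * v * real N * (\<theta>\<^sup>2 * ln (real j)))"
            unfolding Nb using v_pos lj by (intro real_sqrt_le_mono mult_right_mono mult_left_mono) auto
          also have "\<dots> = sqrt (\<theta>\<^sup>2) * X" unfolding X_def real_sqrt_mult by simp
          finally show ?thesis using \<theta> by simp
        qed
        have r3: "\<bar>A.S ({Q b<..N} - B) (\<lambda>_. 1) x\<bar> \<le> \<epsilon> / 2 * X"
        proof -
          let ?x = "\<lambda>k. if k \<in> B then 0 else p (real (n k) * x)"
          have "\<bar>\<Sum>k\<in>{Q b<..Q b + m}. ?x k\<bar> \<le> \<Lambda> / root4 ^ (l - 0) + (\<Sum>i<l. \<Lambda> / root4 ^ (l - i))"
          proof (rule dyadic_chaining[where l = l])
            fix i d :: nat assume "i \<le> l" "d < 2 ^ (l - i)"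
            then have "x \<notin> A3' b i d" using nR b by (auto simp: A3_def)
            then show "\<bar>\<Sum>k\<in>{Q b + d * 2 ^ i<..Q b + (d + 1) * 2 ^ i}. ?x k\<bar> \<le> \<Lambda> / root4 ^ (l - i)"
              by (subst A.sum_if_B) (auto simp: A3'_def)
          qed (use m in simp)
          also have "\<dots> \<le> 2 * (\<Sum>i\<le>l. \<Lambda> / root4 ^ (l - i))"
          proof -
            have nn: "0 \<le> \<Lambda> / root4 ^ (l - i)" for i using \<Lambda> root4 by simp
            have "\<Lambda> / root4 ^ (l - 0) \<le> (\<Sum>i\<le>l. \<Lambda> / root4 ^ (l - i))"
              using nn member_le_sum[of 0 "{..l}" "\<lambda>i. \<Lambda> / root4 ^ (l - i)"] \<Lambda> by simp
            moreover have "(\<Sum>i<l. \<Lambda> / root4 ^ (l - i)) \<le> (\<Sum>i\<le>l. \<Lambda> / root4 ^ (l - i))"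
              using nn \<Lambda> by (intro sum_mono2) auto
            ultimately show ?thesis by linarith
          qed
          also have "\<dots> = 2 * (\<Lambda> * (\<Sum>i\<le>l. (1 / root4) ^ (l - i)))"
            by (simp add: sum_distrib_left power_divide)
          also have "\<dots> \<le> 2 * (\<Lambda> * \<kappa>)"
            unfolding \<kappa>_def using \<Lambda> root4 by (intro mult_left_mono sum_geometric_le) auto
          also have "\<dots> = \<epsilon> / 2 * sqrt (2 * v * 2 ^ j * ln (real j))"
            using \<kappa> by (simp add: \<Lambda>_def e_def real_sqrt_mult)
          also have "\<dots> \<le> \<epsilon> / 2 * X" using X2 \<epsilon> by (intro mult_left_mono) auto
          finally show ?thesis unfolding Nb by (subst (asm) A.sum_if_B) auto
        qed
        have "{1..N} - B = ({1..Q b} - B) \<union> ({Q b<..N} - B)" using Nb by auto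
        then have "A.S ({1..N} - B) (\<lambda>_. 1) x = A.S ({1..Q b} - B) (\<lambda>_. 1) x + A.S ({Q b<..N} - B) (\<lambda>_. 1) x"
          unfolding A.S_def by (simp only:) (rule sum.union_disjoint; auto)
        moreover have "\<bar>F N x - A.S ({1..N} - B) (\<lambda>_. 1) x\<bar> \<le> A.R {1..N} (\<lambda>_. 1) x + C * real (card ({1..N} \<inter> B))"
          using A.S_approx[of "{1..N}" "\<lambda>_. 1" x] by (simp add: F_def)
        moreover have "C * real (card ({1..N} \<inter> B)) \<le> C * 2 powr (real j / 8)"
        proof (intro mult_left_mono C_nonneg)
          have "card ({1..N} \<inter> B) \<le> 2 ^ (j div 8)"
            using card_mono[OF A.finite_B, of "{1..N} \<inter> B"] B by auto
          then have "real (card ({1..N} \<inter> B)) \<le> 2 ^ (j div 8)" by (metis of_nat_le_iff of_nat_numeral of_nat_power)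
          also have "\<dots> = 2 powr (real (j div 8))" by (simp add: powr_realpow)
          also have "\<dots> \<le> 2 powr (real j / 8)" using d8 by (intro powr_mono) auto
          finally show "real (card ({1..N} \<inter> B)) \<le> 2 powr (real j / 8)" .
        qed
        moreover have "1 + C * 2 powr (real j / 8) \<le> \<epsilon> / 2 * X"
          using elim(2) mult_left_mono[OF X2, of "\<epsilon> / 2"] \<epsilon> by linarith
        ultimately have "\<bar>F N x\<bar> \<le> \<theta> * X + \<epsilon> / 2 * X + \<epsilon> / 2 * X"
          using r1 r2 r3 by linarith
        also have "\<dots> = (1 + 2 * \<epsilon>) * X" by (simp add: \<theta>_def algebra_simps)
        finally show False using FN by (simp add: X_def)
      qed
      then have "circ.prob ?L \<le> circ.prob ?R"
        using sets sets3 by (intro circ.finite_measure_mono) auto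
      also have "\<dots> \<le> circ.prob A1 + circ.prob (\<Union>b\<in>{..<2 ^ h}. A2 b) + circ.prob (\<Union>b\<in>{..<2 ^ h}. A3 b)"
        using sets sets3 by (intro order_trans[OF measure_Un_le] add_right_mono measure_Un_le) auto
      also have "\<dots> \<le> 2 ^ 29 * V * (1 / 8) ^ j + (\<Sum>b<(2::nat) ^ h. 4 * real j powr (- (1 + \<epsilon>))) + (\<Sum>b<(2::nat) ^ h. 2 * real j powr (- 2))"
        using sets sets3 P1 P2 P3
        by (intro add_mono order_trans[OF measure_UNION_le] sum_mono) auto
      also have "\<dots> = g j" by (simp add: g_def)
      finally show ?case .
    qed
  qed
  ultimately show thesis by (rule that)
qed

end

section \<open>The almost sure upper bound\<close>

context weakly_lacunary_lil
begin

lemma upper_AE: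
  assumes e: "0 < e"
  shows "AE x in circ. eventually (\<lambda>N. \<bar>F N x\<bar> \<le> (1 + e) * sqrt v * sqrt (2 * real N * ln (ln (real N)))) sequentially"
proof -
  \<comment> \<open>The losses (1 + 2 \<epsilon>) from the exceptional sets and (1 + \<epsilon>)
    from the logarithm must multiply to at most 1 + e.\<close>
  define \<epsilon> where "\<epsilon> = min e 1 / 8"
  have \<epsilon>: "\<epsilon> > 0" "\<epsilon> \<le> 1 / 8" "8 * \<epsilon> \<le> e" using e by (auto simp: \<epsilon>_def)
  define A where "A j = {x. \<exists>N\<in>{2 ^ j..<2 ^ (j + 1)}. \<bar>F N x\<bar> > (1 + 2 * \<epsilon>) * sqrt (2 * v * real N * ln (real j))}" for j :: nat
  obtain g where g: "summable g" "eventually (\<lambda>j. circ.prob (A j) \<le> g j) sequentially"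
    using upper_bad_summable[OF \<epsilon>(1)] unfolding A_def by blast
  have A_sets: "A j \<in> sets circ" for j
  proof -
    have "A j = (\<Union>N\<in>{2 ^ j..<2 ^ (j + 1)}. {x. \<bar>F N x\<bar> > (1 + 2 * \<epsilon>) * sqrt (2 * v * real N * ln (real j))})"
      by (auto simp: A_def)
    also have "\<dots> \<in> sets circ" by measurable
    finally show ?thesis .
  qed
  have "summable (\<lambda>j. circ.prob (A j))"
    by (rule summable_comparison_test_ev[OF _ g(1)]) (use g(2) in auto)
  then have "AE x in circ. eventually (\<lambda>j. x \<in> space circ - A j) sequentially"
    by (intro borel_cantelli_AE1 A_sets) (auto simp: circ.emeasure_eq_measure)
  then show ?thesis
  proof eventually_elim
    case (elim x)
    \<comment> \<open>The exceptional sets are normalised with ln j; since ln N \<ge> j ln 2, this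
      exceeds ln (ln N) by a factor tending to 1 at most.\<close>
    have "eventually (\<lambda>j. x \<notin> A j \<and> ln (real j) \<ge> 0 \<and> j \<ge> 1 \<and> ln (real j) \<le> (1 + \<epsilon>)\<^sup>2 * ln (real j * ln 2)) sequentially"
    proof (intro eventually_conj)
      show "eventually (\<lambda>j. x \<notin> A j) sequentially" using elim by eventually_elim auto
      have "(1 + \<epsilon>)\<^sup>2 > 1" using \<epsilon> by simp
      then show "eventually (\<lambda>j. ln (real j) \<le> (1 + \<epsilon>)\<^sup>2 * ln (real j * ln 2)) sequentially"
        by real_asymp
      show "eventually (\<lambda>j. ln (real j) \<ge> 0) sequentially" by real_asymp
    qed (rule eventually_ge_at_top)
    then obtain j0 where j0: "\<And>j. j \<ge> j0 \<Longrightarrow> x \<notin> A j \<and> ln (real j) \<ge> 0 \<and> j \<ge> 1 \<and> ln (real j) \<le> (1 + \<epsilon>)\<^sup>2 * ln (real j * ln 2)"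
      by (auto simp: eventually_sequentially)
    show ?case
      unfolding eventually_sequentially
    proof (intro exI[of _ "2 ^ j0"] allI impI)
      fix N :: nat assume N: "2 ^ j0 \<le> N"
      then have N1: "N \<ge> 1" by (metis one_le_numeral one_le_power order_trans)
      obtain j where j: "2 ^ j \<le> N" "N < 2 ^ (j + 1)" using ex_power_ivl1[of 2 N] N1 by auto
      have "(2::nat) ^ j0 < 2 ^ (j + 1)" using N j by linarith
      then have "j0 \<le> j" by (simp only: power_strict_increasing_iff)
      note J = j0[OF this]
      have Nr: "real N \<ge> 2 ^ j" using j(1) by (metis of_nat_le_iff of_nat_numeral of_nat_power)
      have "real j * ln 2 = ln (2 ^ j)" by (simp add: ln_realpow)
      also have "\<dots> \<le> ln (real N)" using Nr N1 by (intro ln_mono) auto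
      finally have "ln (real j * ln 2) \<le> ln (ln (real N))" using J by (intro ln_mono) auto
      then have le: "ln (real j) \<le> (1 + \<epsilon>)\<^sup>2 * ln (ln (real N))"
        using J mult_left_mono[OF _ zero_le_power2[of "1 + \<epsilon>"]] order_trans by blast
      have "\<bar>F N x\<bar> \<le> (1 + 2 * \<epsilon>) * sqrt (2 * v * real N * ln (real j))"
        using J j by (auto simp: A_def not_less)
      also have "\<dots> \<le> (1 + 2 * \<epsilon>) * sqrt (2 * v * real N * ((1 + \<epsilon>)\<^sup>2 * ln (ln (real N))))"
        using le v_pos \<epsilon> by (intro mult_left_mono real_sqrt_le_mono) auto
      also have "\<dots> = (1 + 2 * \<epsilon>) * (1 + \<epsilon>) * sqrt v * sqrt (2 * real N * ln (ln (real N)))"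
        using \<epsilon> by (simp add: real_sqrt_mult)
      also have "\<dots> \<le> (1 + e) * sqrt v * sqrt (2 * real N * ln (ln (real N)))"
      proof (intro mult_right_mono)
        have "\<epsilon> * \<epsilon> \<le> 1 / 8 * \<epsilon>" using \<epsilon> by (intro mult_right_mono) auto
        moreover have "(1 + 2 * \<epsilon>) * (1 + \<epsilon>) = 1 + 3 * \<epsilon> + 2 * (\<epsilon> * \<epsilon>)" by (simp add: algebra_simps)
        ultimately show "(1 + 2 * \<epsilon>) * (1 + \<epsilon>) \<le> 1 + e" using \<epsilon> by linarith
        have "0 \<le> (1 + \<epsilon>)\<^sup>2 * ln (ln (real N))" using le J by linarith
        then have "0 \<le> ln (ln (real N))" using \<epsilon> by (simp add: zero_le_mult_iff)
        then show "0 \<le> sqrt (2 * real N * ln (ln (real N)))" by simp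
      qed (use v_pos in auto)
      finally show "\<bar>F N x\<bar> \<le> (1 + e) * sqrt v * sqrt (2 * real N * ln (ln (real N)))" .
    qed
  qed
qed

end

section \<open>Moderate deviations for independent variables\<close>

lemma indep_vars_iid_blocks:
  fixes g :: "real \<Rightarrow> real" and K :: "'i \<Rightarrow> nat set"
  assumes [measurable]: "g \<in> borel_measurable borel" and "disjoint_family_on K L"
  shows "iid.indep_vars (\<lambda>_. borel) (\<lambda>b \<omega>. \<Sum>k\<in>K b. g (\<omega> k)) L"
proof -
  have "iid.indep_vars (\<lambda>b. PiM (K b) (\<lambda>_. circ)) (\<lambda>b \<omega>. restrict (\<lambda>k. \<omega> k) (K b)) L"
    by (rule iid.indep_vars_restrict[OF indep_vars_iid]) (use assms in auto)
  then have "iid.indep_vars (\<lambda>_. borel) (\<lambda>b \<omega>. \<Sum>k\<in>K b. g (restrict (\<lambda>k. \<omega> k) (K b) k)) L"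
  proof (rule iid.indep_vars_compose2)
    fix b
    show "(\<lambda>\<omega>. \<Sum>k\<in>K b. g (\<omega> k)) \<in> borel_measurable (PiM (K b) (\<lambda>_. circ))"
    proof (rule borel_measurable_sum)
      fix k assume k: "k \<in> K b"
      have "(\<lambda>\<omega>. \<omega> k) \<in> measurable (PiM (K b) (\<lambda>_. circ)) circ" using k by (rule measurable_component_singleton)
      then show "(\<lambda>\<omega>. g (\<omega> k)) \<in> borel_measurable (PiM (K b) (\<lambda>_. circ))"
        by (rule measurable_compose) (simp cong: measurable_cong_sets)
    qed
  qed
  then show ?thesis by (simp cong: sum.cong)
qed

text \<open>The density decreases on the unit interval, so its value at the right end is a lower
  bound; the loss from A to A + 1 is immaterial as A becomes large.\<close>

lemma std_normal_interval_ge: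
  assumes "0 \<le> A"
  shows "measure std_normal_distribution {A<..A + 1} \<ge> std_normal_density (A + 1)"
proof -
  interpret N: prob_space std_normal_distribution
    using real_dist_normal_dist by (simp add: real_distribution_def)
  have "ennreal (std_normal_density (A + 1)) = (\<integral>\<^sup>+x. ennreal (std_normal_density (A + 1)) * indicator {A<..A + 1} x \<partial>lborel)"
    by (simp add: nn_integral_cmult)
  also have "\<dots> \<le> (\<integral>\<^sup>+x. ennreal (std_normal_density x) * indicator {A<..A + 1} x \<partial>lborel)"
  proof (intro nn_integral_mono)
    fix x
    show "ennreal (std_normal_density (A + 1)) * indicator {A<..A + 1} x \<le> ennreal (std_normal_density x) * indicator {A<..A + 1} x"
    proof (cases "x \<in> {A<..A + 1}")
      case True
      then have "x\<^sup>2 \<le> (A + 1)\<^sup>2" using assms by (intro power_mono) auto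
      then show ?thesis using True by (auto simp: std_normal_density_def intro!: ennreal_leI divide_right_mono)
    qed simp
  qed
  also have "\<dots> = emeasure std_normal_distribution {A<..A + 1}"
    by (subst emeasure_density) auto
  finally show ?thesis by (simp add: N.emeasure_eq_measure)
qed

section \<open>Lower bounds for the probability of moderate deviations\<close>

context weakly_lacunary
begin

text \<open>Characteristic functions of such sums depend on the number of terms only, and they
  determine the law.\<close>

lemma iid_block_distr:
  assumes "finite K"
  shows "distr iid borel (\<lambda>\<omega>. \<Sum>k\<in>K. f (\<omega> k)) = distr iid borel (\<lambda>\<omega>. \<Sum>i<card K. f (\<omega> i))"
proof (rule Levy_uniqueness)
  have c: "char (distr iid borel (\<lambda>\<omega>. \<Sum>k\<in>K. f (\<omega> k))) t = (\<integral>x. iexp (t * f x) \<partial>circ) ^ card K" if "finite K" for K t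
  proof -
    have "char (distr iid borel (\<lambda>\<omega>. \<Sum>k\<in>K. f (\<omega> k))) t = (\<integral>\<omega>. iexp (t * (\<Sum>k\<in>K. f (\<omega> k))) \<partial>iid)"
      unfolding char_def by (subst integral_distr) auto
    also have "\<dots> = (\<integral>\<omega>. iexp (\<Sum>k\<in>K. t * f (\<omega> k)) \<partial>iid)" by (simp only: sum_distrib_left)
    finally show ?thesis by (simp only: iid_char_sum[OF that])
  qed
  show "char (distr iid borel (\<lambda>\<omega>. \<Sum>k\<in>K. f (\<omega> k))) = char (distr iid borel (\<lambda>\<omega>. \<Sum>i<card K. f (\<omega> i)))"
    using c[OF assms] c[of "{..<card K}"] by (auto simp: fun_eq_iff)
qed (auto intro!: iid.real_distribution_distr)

lemma iid_interval_limit: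
  assumes v: "v > 0"
  shows "(\<lambda>l. iid.prob {\<omega>. (\<Sum>i<l. f (\<omega> i)) / sqrt (real l * v) \<in> {A<..A + 1}})
    \<longlonglongrightarrow> measure std_normal_distribution {A<..A + 1}"
proof -
  let ?D = "\<lambda>N. distr iid borel (\<lambda>\<omega>. (\<Sum>i<N. f (\<omega> i)) / sqrt (real N * v))"
  interpret N: real_distribution std_normal_distribution by (rule real_dist_normal_dist)
  have D: "real_distribution (?D l)" for l by (auto intro!: iid.real_distribution_distr)
  have "measure std_normal_distribution {x} = 0" for x
  proof -
    have "emeasure std_normal_distribution {x} = (\<integral>\<^sup>+y. ennreal (std_normal_density y) * indicator {x} y \<partial>lborel)"
      by (subst emeasure_density) auto
    also have "\<dots> = 0"
      by (subst nn_integral_indicator_singleton) auto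
    finally show ?thesis by (simp add: measure_def)
  qed
  then have cont: "isCont (cdf std_normal_distribution) x" for x by (simp add: N.isCont_cdf)
  have "(\<lambda>l. cdf (?D l) x) \<longlonglongrightarrow> cdf std_normal_distribution x" for x
    using iid_clt[OF v] cont unfolding weak_conv_m_def weak_conv_def by blast
  then have "(\<lambda>l. cdf (?D l) (A + 1) - cdf (?D l) A) \<longlonglongrightarrow> cdf std_normal_distribution (A + 1) - cdf std_normal_distribution A"
    by (intro tendsto_diff)
  moreover have "cdf (?D l) (A + 1) - cdf (?D l) A = iid.prob {\<omega>. (\<Sum>i<l. f (\<omega> i)) / sqrt (real l * v) \<in> {A<..A + 1}}" for l
  proof -
    interpret D: real_distribution "?D l" by (rule D)
    have "cdf (?D l) (A + 1) - cdf (?D l) A = measure (?D l) {A<..A + 1}" by (rule D.cdf_diff_eq) simp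
    also have "\<dots> = iid.prob {\<omega>. (\<Sum>i<l. f (\<omega> i)) / sqrt (real l * v) \<in> {A<..A + 1}}"
      by (subst measure_distr) (auto simp: vimage_def)
    finally show ?thesis .
  qed
  moreover have "cdf std_normal_distribution (A + 1) - cdf std_normal_distribution A = measure std_normal_distribution {A<..A + 1}"
    by (rule N.cdf_diff_eq) simp
  ultimately show ?thesis by simp
qed

text \<open>
  Splitting the sum into \<open>q\<close> blocks and asking each normalised block sum to lie in \<open>(A, A + 1]\<close>
  costs \<open>q\<close> factors of about \<open>exp (-A\<^sup>2 / 2)\<close> by the central limit theorem, and places the whole sum
  near \<open>A sqrt (q m v)\<close>.
\<close>

lemma iid_blocks_prob_ge:
  assumes J: "finite J" "q * l \<le> card J" and q: "q > 0" and l: "l > 0" and v: "v > 0"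
  shows "iid.prob {\<omega>. (\<Sum>k\<in>J. f (\<omega> k)) \<in> {real q * (sqrt (real l * v) * A) - C * real (card J - q * l)..
        real q * (sqrt (real l * v) * (A + 1)) + C * real (card J - q * l)}}
    \<ge> (iid.prob {\<omega>. (\<Sum>i<l. f (\<omega> i)) / sqrt (real l * v) \<in> {A<..A + 1}}) ^ q"
proof -
  \<comment> \<open>J is an arbitrary finite set, so blocks of consecutive indices are taken along
    an enumeration of it.\<close>
  obtain e where e: "bij_betw e {0..<card J} J" using ex_bij_betw_nat_finite[OF J(1)] by blast
  define K where "K b = e ` {b * l..<(b + 1) * l}" for b
  have ivl: "{b * l..<(b + 1) * l} \<subseteq> {0..<card J}" if "b < q" for b
  proof -
    have "(b + 1) * l \<le> q * l" using that by (intro mult_le_mono1) simp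
    then show ?thesis using J by auto
  qed
  have inj: "inj_on e {0..<card J}" and img: "e ` {0..<card J} = J" using e by (auto simp: bij_betw_def)
  have Kc: "card (K b) = l" "K b \<subseteq> J" "finite (K b)" if "b < q" for b
    using card_image[OF inj_on_subset[OF inj ivl[OF that]]] ivl[OF that] img by (auto simp: K_def)
  have disj: "disjoint_family_on K {..<q}"
    unfolding disjoint_family_on_def
  proof (intro ballI impI)
    fix b c assume bc: "b \<in> {..<q}" "c \<in> {..<q}" "b \<noteq> c"
    have "{b * l..<(b + 1) * l} \<inter> {c * l..<(c + 1) * l} = {}"
    proof -
      have "(b + 1) * l \<le> c * l \<or> (c + 1) * l \<le> b * l"
        using bc(3) by (metis Suc_eq_plus1 Suc_leI linorder_neqE_nat mult_le_mono1)
      then show ?thesis by auto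
    qed
    then show "K b \<inter> K c = {}"
      unfolding K_def using bc by (subst inj_on_image_Int[OF inj, symmetric]) (use ivl in auto)
  qed
  let ?I = "{A<..A + 1}"
  define P where "P = iid.prob {\<omega>. (\<Sum>i<l. f (\<omega> i)) / sqrt (real l * v) \<in> ?I}"
  have s: "sqrt (real l * v) > 0" using l v by simp
  let ?E = "(\<lambda>x. x / sqrt (real l * v)) -` ?I"
  have E: "?E \<in> sets borel" by (rule measurable_sets_borel[of _ borel]) auto
  have PK: "iid.prob ((\<lambda>\<omega>. \<Sum>k\<in>K b. f (\<omega> k)) -` ?E \<inter> space iid) = P" if "b < q" for b
  proof -
    have "iid.prob ((\<lambda>\<omega>. \<Sum>k\<in>K b. f (\<omega> k)) -` ?E \<inter> space iid) = measure (distr iid borel (\<lambda>\<omega>. \<Sum>k\<in>K b. f (\<omega> k))) ?E"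
      using E by (subst measure_distr) auto
    also have "\<dots> = measure (distr iid borel (\<lambda>\<omega>. \<Sum>i<l. f (\<omega> i))) ?E"
      using iid_block_distr[of "K b"] Kc[OF that] by simp
    also have "\<dots> = P" unfolding P_def using E by (subst measure_distr) (auto simp: vimage_def)
    finally show ?thesis .
  qed
  have "iid.prob (\<Inter>b\<in>{..<q}. (\<lambda>\<omega>. \<Sum>k\<in>K b. f (\<omega> k)) -` ?E \<inter> space iid) = (\<Prod>b\<in>{..<q}. P)"
    using iid.indep_varsD_finite[OF indep_vars_iid_blocks[OF f_borel disj], of "\<lambda>_. ?E"] q E PK by auto
  then have "P ^ q = iid.prob (\<Inter>b\<in>{..<q}. (\<lambda>\<omega>. \<Sum>k\<in>K b. f (\<omega> k)) -` ?E \<inter> space iid)" by simp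
  also have "\<dots> \<le> iid.prob {\<omega>. (\<Sum>k\<in>J. f (\<omega> k)) \<in> {real q * (sqrt (real l * v) * A) - C * real (card J - q * l)..
        real q * (sqrt (real l * v) * (A + 1)) + C * real (card J - q * l)}}"
  proof (rule iid.finite_measure_mono)
    show "{\<omega>. (\<Sum>k\<in>J. f (\<omega> k)) \<in> {real q * (sqrt (real l * v) * A) - C * real (card J - q * l)..
        real q * (sqrt (real l * v) * (A + 1)) + C * real (card J - q * l)}} \<in> iid.events"
    proof -
      have "{\<omega>. (\<Sum>k\<in>J. f (\<omega> k)) \<in> {a..b}} = (\<lambda>\<omega>. \<Sum>k\<in>J. f (\<omega> k)) -` {a..b} \<inter> space iid" for a b by auto
      also have "\<dots> a b \<in> iid.events" for a b by (rule measurable_sets[where A = borel]) auto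
      finally show ?thesis .
    qed
    show "(\<Inter>b\<in>{..<q}. (\<lambda>\<omega>. \<Sum>k\<in>K b. f (\<omega> k)) -` ?E \<inter> space iid) \<subseteq>
        {\<omega>. (\<Sum>k\<in>J. f (\<omega> k)) \<in> {real q * (sqrt (real l * v) * A) - C * real (card J - q * l)..
        real q * (sqrt (real l * v) * (A + 1)) + C * real (card J - q * l)}}"
    proof
      fix \<omega> assume w: "\<omega> \<in> (\<Inter>b\<in>{..<q}. (\<lambda>\<omega>. \<Sum>k\<in>K b. f (\<omega> k)) -` ?E \<inter> space iid)"
      define U where "U = (\<Union>b\<in>{..<q}. K b)"
      have U: "finite U" "U \<subseteq> J" using Kc by (auto simp: U_def)
      have cU: "card U = q * l"
      proof -
        have "card U = (\<Sum>b<q. card (K b))" unfolding U_def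
          using disj Kc by (intro card_UN_disjoint) (auto simp: disjoint_family_on_def)
        then show ?thesis using Kc by simp
      qed
      have sU: "(\<Sum>k\<in>U. f (\<omega> k)) = (\<Sum>b<q. \<Sum>k\<in>K b. f (\<omega> k))" unfolding U_def
        using disj Kc by (intro sum.UNION_disjoint) (auto simp: disjoint_family_on_def)
      have bd: "sqrt (real l * v) * A \<le> (\<Sum>k\<in>K b. f (\<omega> k)) \<and> (\<Sum>k\<in>K b. f (\<omega> k)) \<le> sqrt (real l * v) * (A + 1)"
        if "b < q" for b
      proof -
        have "(\<Sum>k\<in>K b. f (\<omega> k)) / sqrt (real l * v) \<in> ?I" using w that by auto
        then show ?thesis using s by (auto simp: less_divide_eq divide_le_eq mult.commute[of A] mult.commute[of "A + 1"])
      qed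
      have lo: "real q * (sqrt (real l * v) * A) \<le> (\<Sum>k\<in>U. f (\<omega> k))"
        unfolding sU using sum_mono[of "{..<q}" "\<lambda>_. sqrt (real l * v) * A" "\<lambda>b. \<Sum>k\<in>K b. f (\<omega> k)"] bd by simp
      have hi: "(\<Sum>k\<in>U. f (\<omega> k)) \<le> real q * (sqrt (real l * v) * (A + 1))"
        unfolding sU using sum_mono[of "{..<q}" "\<lambda>b. \<Sum>k\<in>K b. f (\<omega> k)" "\<lambda>_. sqrt (real l * v) * (A + 1)"] bd by simp
      have rest: "\<bar>\<Sum>k\<in>J - U. f (\<omega> k)\<bar> \<le> C * real (card J - q * l)"
      proof -
        have "\<bar>\<Sum>k\<in>J - U. f (\<omega> k)\<bar> \<le> (\<Sum>k\<in>J - U. C)" by (intro order_trans[OF sum_abs] sum_mono f_le)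
        also have "\<dots> = C * real (card J - q * l)" using card_Diff_subset[OF U] cU by simp
        finally show ?thesis .
      qed
      have "(\<Sum>k\<in>J. f (\<omega> k)) = (\<Sum>k\<in>J - U. f (\<omega> k)) + (\<Sum>k\<in>U. f (\<omega> k))"
        by (rule sum.subset_diff[OF U(2) J(1)])
      then show "\<omega> \<in> {\<omega>. (\<Sum>k\<in>J. f (\<omega> k)) \<in> {real q * (sqrt (real l * v) * A) - C * real (card J - q * l)..
        real q * (sqrt (real l * v) * (A + 1)) + C * real (card J - q * l)}}"
        using lo hi rest by (simp add: abs_le_iff)
    qed
  qed
  finally show ?thesis unfolding P_def .
qed

text \<open>Use q blocks, about a y of them with a = c^2 / (v A^2), each with normalised sum near A:
  the total is near A sqrt (q m v) = c sqrt (m y) with m = card J. The cost per unit of y is a ((A +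
  1)^2 / 2 + const), which tends to c^2 / (2 v) as A grows; A is fixed before y. The size y^4 of J
  makes the blocks long enough for the central limit theorem and the at most q left-over terms
  negligible against sqrt (m y).\<close>

lemma moderate_deviation_ge:
  assumes v: "v > 0" and c: "c > 0" and \<eta>: "\<eta> > 0" and \<gamma>: "\<gamma> > c\<^sup>2 / (2 * v)"
  shows "eventually (\<lambda>y::real. \<forall>J. finite J \<longrightarrow> y ^ 4 \<le> real (card J) \<longrightarrow>
    iid.prob {\<omega>. \<bar>(\<Sum>k\<in>J. f (\<omega> k)) / sqrt (real (card J) * y) - c\<bar> \<le> \<eta>} \<ge> exp (- \<gamma> * y)) at_top"
proof -
  define \<gamma>' where "\<gamma>' = (\<gamma> + c\<^sup>2 / (2 * v)) / 2"
  have \<gamma>': "c\<^sup>2 / (2 * v) < \<gamma>'" "\<gamma>' < \<gamma>" using \<gamma> by (auto simp: \<gamma>'_def)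
  have "eventually (\<lambda>A. c\<^sup>2 / (v * A\<^sup>2) * ((A + 1)\<^sup>2 / 2 + ln (2 * sqrt (2 * pi))) < \<gamma>') at_top"
  proof -
    have "((\<lambda>A::real. ((A + 1)\<^sup>2 / 2 + ln (2 * sqrt (2 * pi))) / A\<^sup>2) \<longlongrightarrow> 1 / 2) at_top" by real_asymp
    then have "((\<lambda>A::real. c\<^sup>2 / v * (((A + 1)\<^sup>2 / 2 + ln (2 * sqrt (2 * pi))) / A\<^sup>2)) \<longlongrightarrow> c\<^sup>2 / v * (1 / 2)) at_top"
      by (rule tendsto_mult_left)
    then have "eventually (\<lambda>A. c\<^sup>2 / v * (((A + 1)\<^sup>2 / 2 + ln (2 * sqrt (2 * pi))) / A\<^sup>2) < \<gamma>') at_top"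
      by (rule order_tendstoD(2)) (use \<gamma>' in simp)
    then show ?thesis by simp
  qed
  moreover have "eventually (\<lambda>A. A > max 1 (2 * c / \<eta>)) at_top" by (rule eventually_gt_at_top)
  ultimately have "eventually (\<lambda>A. c\<^sup>2 / (v * A\<^sup>2) * ((A + 1)\<^sup>2 / 2 + ln (2 * sqrt (2 * pi))) < \<gamma>' \<and> A > max 1 (2 * c / \<eta>)) at_top"
    by (rule eventually_conj)
  then obtain A where A: "c\<^sup>2 / (v * A\<^sup>2) * ((A + 1)\<^sup>2 / 2 + ln (2 * sqrt (2 * pi))) < \<gamma>'"
      and A1: "A > 1" "A > 2 * c / \<eta>"
    by (auto dest!: eventually_happens)
  \<comment> \<open>Half the density at A + 1, hence strictly below the limiting probability, so
    that long blocks eventually exceed it.\<close>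
  define \<rho> where "\<rho> = exp (- ((A + 1)\<^sup>2 / 2 + ln (2 * sqrt (2 * pi))))"
  have \<rho>: "\<rho> > 0" "\<rho> < measure std_normal_distribution {A<..A + 1}"
  proof -
    show "\<rho> > 0" by (simp add: \<rho>_def)
    have "exp (- (D + ln X)) = exp (- D) / X" if "X > 0" for D X :: real
      using exp_diff[of "- D" "ln X"] that by simp
    then have "\<rho> = exp (- ((A + 1)\<^sup>2 / 2)) / (2 * sqrt (2 * pi))" unfolding \<rho>_def by simp
    also have "\<dots> < exp (- ((A + 1)\<^sup>2 / 2)) / sqrt (2 * pi)" by (intro divide_strict_left_mono) auto
    also have "\<dots> = std_normal_density (A + 1)" by (simp add: std_normal_density_def)
    also have "\<dots> \<le> measure std_normal_distribution {A<..A + 1}" using A1 by (intro std_normal_interval_ge) auto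
    finally show "\<rho> < measure std_normal_distribution {A<..A + 1}" .
  qed
  obtain l0 where l0: "\<And>l. l \<ge> l0 \<Longrightarrow> iid.prob {\<omega>. (\<Sum>i<l. f (\<omega> i)) / sqrt (real l * v) \<in> {A<..A + 1}} > \<rho>"
    using order_tendstoD(1)[OF iid_interval_limit[OF v, of A] \<rho>(2)] by (auto simp: eventually_sequentially)
  define a where "a = c\<^sup>2 / (v * A\<^sup>2)"
  have a: "a > 0" using c v A1 by (simp add: a_def)
  have e1: "eventually (\<lambda>y. c - \<eta> \<le> c * sqrt (1 - (a * y + 1) / y ^ 4) - C * (a * y + 1) / (y ^ 2 * sqrt y)) at_top"
  proof -
    have "((\<lambda>y. c * sqrt (1 - (a * y + 1) / y ^ 4) - C * (a * y + 1) / (y ^ 2 * sqrt y)) \<longlongrightarrow> c * sqrt (1 - 0) - 0) at_top"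
    proof (intro tendsto_intros)
      show "((\<lambda>y. (a * y + 1) / y ^ 4) \<longlongrightarrow> 0) at_top" by real_asymp
      have "((\<lambda>y. (a * y + 1) / (y ^ 2 * sqrt y)) \<longlongrightarrow> 0) at_top" by real_asymp
      then have "((\<lambda>y. C * ((a * y + 1) / (y ^ 2 * sqrt y))) \<longlongrightarrow> C * 0) at_top" by (intro tendsto_intros)
      then show "((\<lambda>y. C * (a * y + 1) / (y ^ 2 * sqrt y)) \<longlongrightarrow> 0) at_top" by simp
    qed
    then have "eventually (\<lambda>y. c - \<eta> < c * sqrt (1 - (a * y + 1) / y ^ 4) - C * (a * y + 1) / (y ^ 2 * sqrt y)) at_top"
      by (rule order_tendstoD(1)) (use \<eta> in simp)
    then show ?thesis by eventually_elim simp
  qed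
  have e2: "eventually (\<lambda>y. c * (1 + 1 / A) * sqrt (1 + 1 / (a * y)) + C * (a * y + 1) / (y ^ 2 * sqrt y) \<le> c + \<eta>) at_top"
  proof -
    have "((\<lambda>y. c * (1 + 1 / A) * sqrt (1 + 1 / (a * y)) + C * (a * y + 1) / (y ^ 2 * sqrt y)) \<longlongrightarrow> c * (1 + 1 / A) * sqrt (1 + 0) + 0) at_top"
    proof (intro tendsto_intros)
      have "((\<lambda>y. 1 / a * (1 / y)) \<longlongrightarrow> 1 / a * 0) at_top" by (intro tendsto_intros) real_asymp
      then show "((\<lambda>y. 1 / (a * y)) \<longlongrightarrow> 0) at_top" by simp
      have "((\<lambda>y. (a * y + 1) / (y ^ 2 * sqrt y)) \<longlongrightarrow> 0) at_top" by real_asymp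
      then have "((\<lambda>y. C * ((a * y + 1) / (y ^ 2 * sqrt y))) \<longlongrightarrow> C * 0) at_top" by (intro tendsto_intros)
      then show "((\<lambda>y. C * (a * y + 1) / (y ^ 2 * sqrt y)) \<longlongrightarrow> 0) at_top" by simp
    qed
    \<comment> \<open>Each block sum may overshoot up to A + 1, which adds c / A in total; A > 2 c /
      \<eta> keeps this below \<eta>.\<close>
    moreover have "c * (1 + 1 / A) * sqrt (1 + 0) + 0 < c + \<eta>"
    proof -
      have "c / A < \<eta>" using A1 \<eta> c by (simp add: field_simps)
      then show ?thesis by (simp add: algebra_simps)
    qed
    ultimately have "eventually (\<lambda>y. c * (1 + 1 / A) * sqrt (1 + 1 / (a * y)) + C * (a * y + 1) / (y ^ 2 * sqrt y) < c + \<eta>) at_top"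
      by (rule order_tendstoD(2))
    then show ?thesis by eventually_elim simp
  qed
  have e3: "eventually (\<lambda>y::real. (real l0 + 1) * (a * y + 1) \<le> y ^ 4) at_top" using a by real_asymp
  have e4: "eventually (\<lambda>y. (a * y + 1) * ((A + 1)\<^sup>2 / 2 + ln (2 * sqrt (2 * pi))) \<le> \<gamma> * y) at_top"
  proof -
    define D where "D = (A + 1)\<^sup>2 / 2 + ln (2 * sqrt (2 * pi))"
    have "a * D < \<gamma>" using A \<gamma>' by (simp add: a_def D_def)
    then have "eventually (\<lambda>y. (a * y + 1) * D \<le> \<gamma> * y) at_top" by real_asymp
    then show ?thesis by (simp add: D_def)
  qed
  show ?thesis
    using e1 e2 e3 e4 eventually_gt_at_top[of 1]
  proof eventually_elim
    case (elim y)
    show ?case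
    proof (intro allI impI)
      fix J :: "nat set" assume J: "finite J" "y ^ 4 \<le> real (card J)"
      define m where "m = card J"
      define q where "q = nat \<lceil>a * y\<rceil>"
      define l where "l = m div q"
      have y: "y > 1" by fact
      have ay: "a * y > 0" using a y by simp
      have q: "q > 0" "a * y \<le> real q" "real q \<le> a * y + 1" using ay unfolding q_def by linarith+
      have "y ^ 4 > 0" using y by simp
      then have m: "y ^ 4 \<le> real m" "real m > 0" using J(2) unfolding m_def by linarith+
      have ql: "q * l \<le> m" "m < q * l + q"
        using q(1) by (auto simp: l_def) (metis add.commute dividend_less_times_div mult.commute)
      have "(real l0 + 1) * real q \<le> (real l0 + 1) * (a * y + 1)" using q(3) by (intro mult_left_mono) auto
      also have "\<dots> \<le> real m" using m elim(3) by linarith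
      finally have "real ((l0 + 1) * q) \<le> real m" by (simp add: distrib_right)
      then have "(l0 + 1) * q \<le> m" by (simp only: of_nat_le_iff)
      then have l: "l \<ge> l0 + 1" unfolding l_def using q by (simp add: less_eq_div_iff_mult_less_eq)
      let ?lo = "real q * (sqrt (real l * v) * A) - C * real (m - q * l)"
      let ?hi = "real q * (sqrt (real l * v) * (A + 1)) + C * real (m - q * l)"
      have z: "sqrt (real m * y) > 0" using m y by simp
      have "exp (- \<gamma> * y) \<le> exp (- (real q * ((A + 1)\<^sup>2 / 2 + ln (2 * sqrt (2 * pi)))))"
      proof -
        have "1 \<le> sqrt (2 * pi)" using pi_gt3 by (intro real_le_rsqrt) simp
        then have "0 \<le> ln (2 * sqrt (2 * pi))" by (intro ln_ge_zero) linarith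
        then have "real q * ((A + 1)\<^sup>2 / 2 + ln (2 * sqrt (2 * pi))) \<le> (a * y + 1) * ((A + 1)\<^sup>2 / 2 + ln (2 * sqrt (2 * pi)))"
          using q by (intro mult_right_mono) auto
        then show ?thesis using elim(4) by simp
      qed
      also have "\<dots> = \<rho> ^ q" by (simp only: \<rho>_def exp_of_nat_mult[symmetric] mult_minus_right)
      also have "\<dots> \<le> (iid.prob {\<omega>. (\<Sum>i<l. f (\<omega> i)) / sqrt (real l * v) \<in> {A<..A + 1}}) ^ q"
        using l0[of l] l \<rho> by (intro power_mono) auto
      also have "\<dots> \<le> iid.prob {\<omega>. (\<Sum>k\<in>J. f (\<omega> k)) \<in> {?lo..?hi}}"
        using iid_blocks_prob_ge[of J q l A] J q l v ql by (simp add: m_def)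
      also have "\<dots> \<le> iid.prob {\<omega>. \<bar>(\<Sum>k\<in>J. f (\<omega> k)) / sqrt (real (card J) * y) - c\<bar> \<le> \<eta>}"
      proof (rule iid.finite_measure_mono)
        have "{\<omega>. \<bar>(\<Sum>k\<in>J. f (\<omega> k)) / sqrt (real (card J) * y) - c\<bar> \<le> \<eta>}
          = {\<omega>\<in>space iid. \<bar>(\<Sum>k\<in>J. f (\<omega> k)) / sqrt (real (card J) * y) - c\<bar> \<le> \<eta>}" by simp
        also have "\<dots> \<in> iid.events" by measurable
        finally show "{\<omega>. \<bar>(\<Sum>k\<in>J. f (\<omega> k)) / sqrt (real (card J) * y) - c\<bar> \<le> \<eta>} \<in> iid.events" .
        have sq: "sqrt (real m * y) * c = sqrt (real m * v) * sqrt (a * y) * A"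
        proof -
          have "sqrt (real m * v) * sqrt (a * y) * A = sqrt (real m * v * (a * y)) * sqrt (A\<^sup>2)"
            using A1 by (simp add: real_sqrt_mult)
          also have "\<dots> = sqrt (real m * v * (a * y) * A\<^sup>2)" by (simp only: real_sqrt_mult)
          also have "real m * v * (a * y) * A\<^sup>2 = (real m * y) * c\<^sup>2" using v A1 by (simp add: a_def)
          also have "sqrt \<dots> = sqrt (real m * y) * c" using c by (simp add: real_sqrt_mult)
          finally show ?thesis ..
        qed
        have rest: "C * real (m - q * l) \<le> sqrt (real m * y) * (C * (a * y + 1) / (y ^ 2 * sqrt y))"
        proof -
          have "real (m - q * l) \<le> a * y + 1" using ql q by linarith
          then have "C * real (m - q * l) \<le> C * (a * y + 1)" by (intro mult_left_mono C_nonneg)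
          also have "\<dots> = (y ^ 2 * sqrt y) * (C * (a * y + 1) / (y ^ 2 * sqrt y))" using y by simp
          also have "\<dots> \<le> sqrt (real m * y) * (C * (a * y + 1) / (y ^ 2 * sqrt y))"
          proof (intro mult_right_mono)
            have "y ^ 2 = sqrt (y ^ 4)" 
              using real_sqrt_unique[of "y ^ 2" "y ^ 4"] by (simp flip: power_mult)
            also have "\<dots> \<le> sqrt (real m)" using m by simp
            finally show "y ^ 2 * sqrt y \<le> sqrt (real m * y)" using y by (simp add: real_sqrt_mult mult_right_mono)
          qed (use C_nonneg ay y in auto)
          finally show ?thesis .
        qed
        have main_lo: "sqrt (real m * y) * (c * sqrt (1 - (a * y + 1) / y ^ 4)) \<le> real q * (sqrt (real l * v) * A)"
        proof -
          have "1 - (a * y + 1) / y ^ 4 \<le> 1 - real q / real m"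
          proof -
            have "real q / real m \<le> (a * y + 1) / y ^ 4" using q m y by (intro frac_le) auto
            then show ?thesis by simp
          qed
          also have "1 - real q / real m \<le> real (q * l) / real m"
          proof -
            have "real m - real q \<le> real (q * l)" using ql by linarith
            then have "(real m - real q) / real m \<le> real (q * l) / real m" by (rule divide_right_mono) simp
            then show ?thesis using m by (simp add: diff_divide_distrib)
          qed
          finally have "sqrt (1 - (a * y + 1) / y ^ 4) \<le> sqrt (real (q * l) / real m)" by simp
          then have "sqrt (real m * y) * c * sqrt (1 - (a * y + 1) / y ^ 4) \<le> sqrt (real m * v) * sqrt (a * y) * A * sqrt (real (q * l) / real m)"
            unfolding sq using A1 ay v m by (intro mult_left_mono) auto
          also have "\<dots> = sqrt (real l * v) * sqrt (a * y) * sqrt (real q) * A"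
            using m by (simp add: real_sqrt_mult real_sqrt_divide)
          also have "\<dots> \<le> sqrt (real l * v) * sqrt (real q) * sqrt (real q) * A"
            using q A1 v by (intro mult_right_mono mult_left_mono) auto
          also have "\<dots> = (sqrt (real q) * sqrt (real q)) * (sqrt (real l * v) * A)" by (simp only: mult_ac)
          also have "\<dots> = real q * (sqrt (real l * v) * A)" by simp
          finally show ?thesis by (simp add: mult.assoc)
        qed
        have main_hi: "real q * (sqrt (real l * v) * (A + 1)) \<le> sqrt (real m * y) * (c * (1 + 1 / A) * sqrt (1 + 1 / (a * y)))"
        proof -
          have "sqrt (real q) \<le> sqrt (a * y * (1 + 1 / (a * y)))"
            using q ay a y by (intro real_sqrt_le_mono) (simp add: distrib_left)
          then have q': "sqrt (real q) \<le> sqrt (a * y) * sqrt (1 + 1 / (a * y))" by (simp only: real_sqrt_mult)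
          have "real (q * l) \<le> real m" using ql(1) by (simp only: of_nat_le_iff)
          then have "sqrt (real (q * l)) \<le> sqrt (real m)" by (rule real_sqrt_le_mono)
          then have ql': "sqrt (real q) * sqrt (real l) \<le> sqrt (real m)" by (simp add: real_sqrt_mult)
          have "real q * (sqrt (real l * v) * (A + 1)) = (sqrt (real q) * sqrt (real q)) * (sqrt (real l) * sqrt v * (A + 1))"
            by (simp add: real_sqrt_mult)
          also have "\<dots> = (sqrt (real q) * sqrt (real l)) * sqrt (real q) * (sqrt v * (A + 1))"
            by (simp only: mult_ac)
          also have "\<dots> \<le> sqrt (real m) * (sqrt (a * y) * sqrt (1 + 1 / (a * y))) * (sqrt v * (A + 1))"
            using q' ql' A1 v by (intro mult_right_mono mult_mono) auto
          also have "\<dots> = (sqrt (real m * v) * sqrt (a * y) * A) * ((1 + 1 / A) * sqrt (1 + 1 / (a * y)))"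
          proof -
            have A': "A + 1 = A * (1 + 1 / A)" using A1 by (simp add: distrib_left)
            show ?thesis by (simp only: A' real_sqrt_mult mult_ac)
          qed
          also have "\<dots> = sqrt (real m * y) * (c * (1 + 1 / A) * sqrt (1 + 1 / (a * y)))"
            unfolding sq[symmetric] by (simp add: mult_ac)
          finally show ?thesis .
        qed
        have lo: "sqrt (real m * y) * (c - \<eta>) \<le> ?lo"
        proof -
          have "sqrt (real m * y) * (c - \<eta>) \<le> sqrt (real m * y) *
              (c * sqrt (1 - (a * y + 1) / y ^ 4) - C * (a * y + 1) / (y ^ 2 * sqrt y))"
            by (rule mult_left_mono[OF elim(1) less_imp_le[OF z]])
          also have "\<dots> \<le> ?lo" unfolding right_diff_distrib by (rule diff_mono[OF main_lo rest])
          finally show ?thesis .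
        qed
        have hi: "?hi \<le> sqrt (real m * y) * (c + \<eta>)"
        proof -
          have "?hi \<le> sqrt (real m * y) *
              (c * (1 + 1 / A) * sqrt (1 + 1 / (a * y)) + C * (a * y + 1) / (y ^ 2 * sqrt y))"
            unfolding distrib_left[of "sqrt (real m * y)"] by (rule add_mono[OF main_hi rest])
          also have "\<dots> \<le> sqrt (real m * y) * (c + \<eta>)"
            by (rule mult_left_mono[OF elim(2) less_imp_le[OF z]])
          finally show ?thesis .
        qed
        show "{\<omega>. (\<Sum>k\<in>J. f (\<omega> k)) \<in> {?lo..?hi}} \<subseteq> {\<omega>. \<bar>(\<Sum>k\<in>J. f (\<omega> k)) / sqrt (real (card J) * y) - c\<bar> \<le> \<eta>}"
        proof
          fix \<omega> assume "\<omega> \<in> {\<omega>. (\<Sum>k\<in>J. f (\<omega> k)) \<in> {?lo..?hi}}"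
          then have "sqrt (real m * y) * (c - \<eta>) \<le> (\<Sum>k\<in>J. f (\<omega> k))" "(\<Sum>k\<in>J. f (\<omega> k)) \<le> sqrt (real m * y) * (c + \<eta>)"
            using lo hi by auto
          then have "c - \<eta> \<le> (\<Sum>k\<in>J. f (\<omega> k)) / sqrt (real m * y)" "(\<Sum>k\<in>J. f (\<omega> k)) / sqrt (real m * y) \<le> c + \<eta>"
            using z by (simp_all add: le_divide_eq divide_le_eq mult.commute)
          then show "\<omega> \<in> {\<omega>. \<bar>(\<Sum>k\<in>J. f (\<omega> k)) / sqrt (real (card J) * y) - c\<bar> \<le> \<eta>}"
            by (simp add: m_def[symmetric] abs_le_iff)
        qed
      qed
      finally show "exp (- \<gamma> * y) \<le> iid.prob {\<omega>. \<bar>(\<Sum>k\<in>J. f (\<omega> k)) / sqrt (real (card J) * y) - c\<bar> \<le> \<eta>}" .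
    qed
  qed
qed

end

section \<open>The lower half of the law of the iterated logarithm\<close>

text \<open>The coefficients are binomial probabilities, nonnegative and of sum 1, and the
  frequencies are at most q in modulus.\<close>

lemma cos_power_expand:
  "complex_of_real (cos y ^ q) = (\<Sum>k\<le>q. complex_of_real (real (q choose k) / 2 ^ q) * iexp ((2 * real k - real q) * y))"
proof -
  have "complex_of_real (cos y) = (iexp y + iexp (- y)) / 2"
    using cos_exp_eq[of "complex_of_real y"] by (simp add: cos_of_real)
  then have "complex_of_real (cos y ^ q) = (iexp y + iexp (- y)) ^ q / 2 ^ q"
    by (simp only: of_real_power power_divide)
  also have "\<dots> = (\<Sum>k\<le>q. of_nat (q choose k) * iexp y ^ k * iexp (- y) ^ (q - k)) / 2 ^ q"
    by (simp add: binomial_ring)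
  also have "\<dots> = (\<Sum>k\<le>q. complex_of_real (real (q choose k) / 2 ^ q) * iexp ((2 * real k - real q) * y))"
    unfolding sum_divide_distrib
  proof (intro sum.cong refl)
    fix k assume "k \<in> {..q}"
    then have "iexp y ^ k * iexp (- y) ^ (q - k) = iexp ((2 * real k - real q) * y)"
      by (simp add: exp_of_nat_mult[symmetric] exp_add[symmetric] of_nat_diff algebra_simps)
    then show "of_nat (q choose k) * iexp y ^ k * iexp (- y) ^ (q - k) / 2 ^ q
        = complex_of_real (real (q choose k) / 2 ^ q) * iexp ((2 * real k - real q) * y)"
      by (simp add: mult.assoc)
  qed
  finally show ?thesis .
qed

lemma (in dissociated_system) S_add: "S J (\<lambda>k. a * w1 k + b * w2 k) x = a * S J w1 x + b * S J w2 x"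
  by (simp add: S_def sum.distrib sum_distrib_left algebra_simps)

lemma (in dissociated_system) T_add: "T J (\<lambda>k. a * w1 k + b * w2 k) x = a * T J w1 x + b * T J w2 x"
  by (simp add: T_def sum.distrib sum_distrib_left algebra_simps)

text \<open>The product of the two powers is a combination of characters of the joint sum with
  coefficients of total modulus 1, so the error is no worse than for the worst character. W bounds
  the squared weights of the combinations by (a + b)^2 \<le> 2 a^2 + 2 b^2.\<close>

lemma (in dissociated_system) cos_compare:
  assumes J: "finite J" "J \<subseteq> I" and s: "even s" "s > 0"
    and W: "2 * (real q)\<^sup>2 * ((\<Sum>k\<in>J. (w1 k)\<^sup>2) + (\<Sum>k\<in>J. (w2 k)\<^sup>2)) \<le> W"
  shows "\<bar>(\<integral>x. cos (S J w1 x - a) ^ q * cos (S J w2 x - b) ^ q \<partial>circ)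
      - (\<integral>x. cos (T J w1 x - a) ^ q * cos (T J w2 x - b) ^ q \<partial>iid)\<bar> \<le> 2 * exp (15 * C\<^sup>2 * W - real s)"
proof -
  define r where "r k = 2 * real k - real q" for k
  define c where "c k = real (q choose k) / 2 ^ q" for k
  define d where "d k l = complex_of_real (c k * c l) * iexp (- (r k * a + r l * b))" for k l
  define ww where "ww k l j = r k * w1 j + r l * w2 j" for k l j
  have c1: "(\<Sum>k\<le>q. c k) = 1"
    using choose_row_sum[of q] by (simp add: c_def sum_divide_distrib[symmetric] flip: of_nat_sum)
  have c0: "c k \<ge> 0" for k by (simp add: c_def)
  have expand: "complex_of_real (cos (y1 - a) ^ q * cos (y2 - b) ^ q) = (\<Sum>k\<le>q. \<Sum>l\<le>q. d k l * iexp (r k * y1 + r l * y2))" for y1 y2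
  proof -
    have "complex_of_real (cos (y1 - a) ^ q * cos (y2 - b) ^ q)
      = (\<Sum>k\<le>q. complex_of_real (c k) * iexp (r k * (y1 - a))) * (\<Sum>l\<le>q. complex_of_real (c l) * iexp (r l * (y2 - b)))"
      unfolding of_real_mult cos_power_expand c_def r_def ..
    also have "\<dots> = (\<Sum>k\<le>q. \<Sum>l\<le>q. (complex_of_real (c k) * iexp (r k * (y1 - a))) * (complex_of_real (c l) * iexp (r l * (y2 - b))))"
      by (rule sum_product)
    also have "\<dots> = (\<Sum>k\<le>q. \<Sum>l\<le>q. d k l * iexp (r k * y1 + r l * y2))"
    proof (intro sum.cong refl)
      fix k l
      have "iexp (r k * (y1 - a)) * iexp (r l * (y2 - b)) = iexp (- (r k * a + r l * b)) * iexp (r k * y1 + r l * y2)"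
        by (simp add: exp_add[symmetric] algebra_simps)
      then show "(complex_of_real (c k) * iexp (r k * (y1 - a))) * (complex_of_real (c l) * iexp (r l * (y2 - b)))
          = d k l * iexp (r k * y1 + r l * y2)"
        by (simp add: d_def mult_ac)
    qed
    finally show ?thesis .
  qed
  have iS: "integrable circ (\<lambda>x. iexp (S J w x))" and iT: "integrable iid (\<lambda>x. iexp (T J w x))" for w
    by (rule integrable_S_comp[of iexp] integrable_T_comp[of iexp], intro continuous_intros)+
  have eS: "complex_of_real (\<integral>x. cos (S J w1 x - a) ^ q * cos (S J w2 x - b) ^ q \<partial>circ)
      = (\<Sum>k\<le>q. \<Sum>l\<le>q. d k l * (\<integral>x. iexp (S J (ww k l) x) \<partial>circ))"
  proof -
    have "complex_of_real (\<integral>x. cos (S J w1 x - a) ^ q * cos (S J w2 x - b) ^ q \<partial>circ)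
      = (\<integral>x. (\<Sum>k\<le>q. \<Sum>l\<le>q. d k l * iexp (S J (ww k l) x)) \<partial>circ)"
      unfolding ww_def S_add expand[symmetric] by (simp del: of_real_mult of_real_power)
    then show ?thesis using iS by simp
  qed
  have eT: "complex_of_real (\<integral>x. cos (T J w1 x - a) ^ q * cos (T J w2 x - b) ^ q \<partial>iid)
      = (\<Sum>k\<le>q. \<Sum>l\<le>q. d k l * (\<integral>x. iexp (T J (ww k l) x) \<partial>iid))"
  proof -
    have "complex_of_real (\<integral>x. cos (T J w1 x - a) ^ q * cos (T J w2 x - b) ^ q \<partial>iid)
      = (\<integral>x. (\<Sum>k\<le>q. \<Sum>l\<le>q. d k l * iexp (T J (ww k l) x)) \<partial>iid)"
      unfolding ww_def T_add expand[symmetric] by (simp del: of_real_mult of_real_power)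
    then show ?thesis using iT by simp
  qed
  have diff: "cmod ((\<integral>x. iexp (S J (ww k l) x) \<partial>circ) - (\<integral>x. iexp (T J (ww k l) x) \<partial>iid))
      \<le> 2 * exp (15 * C\<^sup>2 * W - real s)" if kl: "k \<le> q" "l \<le> q" for k l
  proof -
    have r2: "(r k)\<^sup>2 \<le> (real q)\<^sup>2" if "k \<le> q" for k
    proof -
      have "\<bar>r k\<bar> \<le> \<bar>real q\<bar>" using that by (simp add: r_def abs_le_iff)
      then show ?thesis by (rule abs_le_square_iff[THEN iffD1])
    qed
    have "(ww k l j)\<^sup>2 \<le> 2 * (real q)\<^sup>2 * ((w1 j)\<^sup>2 + (w2 j)\<^sup>2)" for j
    proof -
      have "(ww k l j)\<^sup>2 \<le> 2 * (r k * w1 j)\<^sup>2 + 2 * (r l * w2 j)\<^sup>2"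
        using zero_le_power2[of "r k * w1 j - r l * w2 j"] by (simp add: ww_def power2_sum power2_diff)
      also have "\<dots> \<le> 2 * ((real q)\<^sup>2 * (w1 j)\<^sup>2) + 2 * ((real q)\<^sup>2 * (w2 j)\<^sup>2)"
        unfolding power_mult_distrib using r2 kl by (intro add_mono mult_left_mono mult_right_mono) auto
      finally show ?thesis by (simp add: algebra_simps)
    qed
    then have "(\<Sum>j\<in>J. (ww k l j)\<^sup>2) \<le> (\<Sum>j\<in>J. 2 * (real q)\<^sup>2 * ((w1 j)\<^sup>2 + (w2 j)\<^sup>2))" by (rule sum_mono)
    also have "\<dots> \<le> W" using W by (simp add: sum.distrib sum_distrib_left[symmetric])
    finally have "15 * C\<^sup>2 * (\<Sum>j\<in>J. (ww k l j)\<^sup>2) \<le> 15 * C\<^sup>2 * W" by (intro mult_left_mono) auto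
    then have "2 * exp (15 * C\<^sup>2 * (\<Sum>j\<in>J. (ww k l j)\<^sup>2) - real s) \<le> 2 * exp (15 * C\<^sup>2 * W - real s)" by simp
    then show ?thesis using char_diff_le[OF J s, of "ww k l"] by linarith
  qed
  let ?E = "2 * exp (15 * C\<^sup>2 * W - real s)"
  have "\<bar>(\<integral>x. cos (S J w1 x - a) ^ q * cos (S J w2 x - b) ^ q \<partial>circ)
      - (\<integral>x. cos (T J w1 x - a) ^ q * cos (T J w2 x - b) ^ q \<partial>iid)\<bar>
    = cmod ((\<Sum>k\<le>q. \<Sum>l\<le>q. d k l * ((\<integral>x. iexp (S J (ww k l) x) \<partial>circ) - (\<integral>x. iexp (T J (ww k l) x) \<partial>iid))))"
  proof -
    have "cmod (complex_of_real u - complex_of_real v) = \<bar>u - v\<bar>" for u v :: real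
      by (metis norm_of_real of_real_diff)
    then show ?thesis by (simp add: eS[symmetric] eT[symmetric] right_diff_distrib sum_subtractf del: of_real_diff)
  qed
  also have "\<dots> \<le> (\<Sum>k\<le>q. \<Sum>l\<le>q. c k * c l * ?E)"
  proof (intro sum_norm_le)
    fix k l assume "k \<in> {..q}" "l \<in> {..q}"
    then have "cmod ((\<integral>x. iexp (S J (ww k l) x) \<partial>circ) - (\<integral>x. iexp (T J (ww k l) x) \<partial>iid)) \<le> ?E"
      by (intro diff) auto
    moreover have "cmod (d k l) = c k * c l" using c0 by (simp add: d_def norm_mult)
    ultimately show "cmod (d k l * ((\<integral>x. iexp (S J (ww k l) x) \<partial>circ) - (\<integral>x. iexp (T J (ww k l) x) \<partial>iid))) \<le> c k * c l * ?E"
      using c0 by (simp add: norm_mult mult_left_mono)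
  qed
  also have "\<dots> = (\<Sum>k\<le>q. c k) * (\<Sum>l\<le>q. c l) * ?E"
    unfolding sum_product by (simp only: sum_distrib_right)
  finally show ?thesis by (simp add: c1)
qed

text \<open>Chebyshev's inequality about \<mu>. Off the diagonal the products e i e j recombine to
  \<mu>^2; on it g^2 \<le> g because the values lie in [0, 1], so the diagonal adds only \<mu> plus
  errors.\<close>

lemma (in prob_space) second_moment_le:
  fixes g :: "'i \<Rightarrow> 'a \<Rightarrow> real"
  assumes A: "finite A" "real (card A) \<le> m" "m \<ge> 1"
    and g[measurable]: "\<And>i. i \<in> A \<Longrightarrow> g i \<in> borel_measurable M" and g01: "\<And>i x. 0 \<le> g i x" "\<And>i x. g i x \<le> 1"
    and e: "\<And>i. i \<in> A \<Longrightarrow> 0 \<le> e i" "\<And>i. i \<in> A \<Longrightarrow> e i \<le> 1"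
    and r1: "\<And>i. i \<in> A \<Longrightarrow> \<bar>expectation (g i) - e i\<bar> \<le> r"
    and r2: "\<And>i j. i \<in> A \<Longrightarrow> j \<in> A \<Longrightarrow> i \<noteq> j \<Longrightarrow> expectation (\<lambda>x. g i x * g j x) \<le> e i * e j + r"
    and \<mu>: "\<mu> = (\<Sum>i\<in>A. e i)" "\<mu> > 0" and sp: "space M = UNIV"
  shows "prob {x. (\<Sum>i\<in>A. g i x) \<le> \<mu> / 2} \<le> 4 * (\<mu> + 4 * m\<^sup>2 * r) / \<mu>\<^sup>2"
proof -
  let ?Z = "\<lambda>x. \<Sum>i\<in>A. g i x"
  have r0: "r \<ge> 0"
  proof -
    have "A \<noteq> {}" using \<mu> by auto
    then show ?thesis using r1 by (force intro: order_trans[OF abs_ge_zero])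
  qed
  have gg: "\<bar>g i x * g j x\<bar> \<le> 1" for i j x
    using g01[of i x] g01[of j x] by (simp add: abs_mult mult_le_one)
  have i1: "integrable M (g i)" if "i \<in> A" for i
    by (rule integrable_const_bound[of _ 1]) (use g01 that in auto)
  have i2: "integrable M (\<lambda>x. g i x * g j x)" if "i \<in> A" "j \<in> A" for i j
    by (rule integrable_const_bound[of _ 1]) (use gg that in auto)
  have m: "real (card A) * real (card A) \<le> m\<^sup>2" unfolding power2_eq_square using A by (intro mult_mono) auto
  have \<mu>m: "\<mu> \<le> m" using sum_mono[of A e "\<lambda>_. 1"] e A \<mu> by simp
  have mm: "m \<le> m\<^sup>2" using A(3) by (simp add: power2_eq_square)
  have EZ: "expectation ?Z = (\<Sum>i\<in>A. expectation (g i))" using i1 by simp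
  have "\<mu> - m * r \<le> expectation ?Z"
  proof -
    have "(\<Sum>i\<in>A. e i - r) \<le> (\<Sum>i\<in>A. expectation (g i))" using r1 by (intro sum_mono) (fastforce simp: abs_le_iff)
    moreover have "real (card A) * r \<le> m * r" using A r0 by (intro mult_right_mono) auto
    ultimately show ?thesis unfolding EZ \<mu> by (simp add: sum_subtractf)
  qed
  then have "2 * \<mu> * (\<mu> - m * r) \<le> 2 * \<mu> * expectation ?Z" using \<mu> by (intro mult_left_mono) auto
  moreover have "2 * \<mu> * (m * r) \<le> 2 * m\<^sup>2 * r"
  proof -
    have "\<mu> * (m * r) \<le> m * (m * r)" using \<mu>m A r0 by (intro mult_right_mono) auto
    then show ?thesis by (simp add: power2_eq_square)
  qed
  ultimately have E1: "2 * \<mu>\<^sup>2 - 2 * m\<^sup>2 * r \<le> 2 * \<mu> * expectation ?Z"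
    by (simp add: right_diff_distrib power2_eq_square)
  have E2: "expectation (\<lambda>x. (?Z x)\<^sup>2) \<le> \<mu> + \<mu>\<^sup>2 + 2 * m\<^sup>2 * r"
  proof -
    have "expectation (\<lambda>x. (?Z x)\<^sup>2) = (\<Sum>i\<in>A. \<Sum>j\<in>A. expectation (\<lambda>x. g i x * g j x))"
      unfolding power2_eq_square sum_product using i2 by simp
    also have "\<dots> \<le> (\<Sum>i\<in>A. \<Sum>j\<in>A. e i * e j + r + (if i = j then e i + r else 0))"
    proof (intro sum_mono)
      fix i j assume ij: "i \<in> A" "j \<in> A"
      show "expectation (\<lambda>x. g i x * g j x) \<le> e i * e j + r + (if i = j then e i + r else 0)"
      proof (cases "i = j")
        case True
        have "expectation (\<lambda>x. g i x * g i x) \<le> expectation (g i)"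
          using i1 i2 ij g01 by (intro integral_mono) (auto simp: mult_left_le)
        moreover have "expectation (g i) \<le> e i + r" using r1[OF ij(1)] by (simp add: abs_le_iff)
        moreover have "0 \<le> e i * e i" using e ij by simp
        ultimately show ?thesis unfolding True[symmetric] if_P[OF refl] using r0 by linarith
      next
        case False
        then show ?thesis using r2[OF ij] by simp
      qed
    qed
    also have "\<dots> = \<mu>\<^sup>2 + real (card A) * real (card A) * r + (\<mu> + real (card A) * r)"
      using A by (simp add: sum.distrib \<mu> power2_eq_square sum_product)
    also have "\<dots> \<le> \<mu>\<^sup>2 + m\<^sup>2 * r + (\<mu> + m\<^sup>2 * r)"
      using m mm A r0 by (intro add_mono mult_right_mono order_refl) auto
    finally show ?thesis by (simp add: algebra_simps)
  qed
  have iZ: "integrable M ?Z" using i1 by simp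
  have iZ2: "integrable M (\<lambda>x. (?Z x)\<^sup>2)" unfolding power2_eq_square sum_product using i2 by simp
  have V: "expectation (\<lambda>x. (?Z x - \<mu>)\<^sup>2) \<le> \<mu> + 4 * m\<^sup>2 * r"
  proof -
    have "expectation (\<lambda>x. (?Z x - \<mu>)\<^sup>2) = expectation (\<lambda>x. (?Z x)\<^sup>2 - (2 * \<mu>) * ?Z x + \<mu>\<^sup>2)"
      by (intro Bochner_Integration.integral_cong refl) (simp add: power2_diff)
    also have "\<dots> = expectation (\<lambda>x. (?Z x)\<^sup>2) - (2 * \<mu>) * expectation ?Z + \<mu>\<^sup>2"
      using iZ iZ2 by (simp add: prob_space)
    finally show ?thesis using E1 E2 by linarith
  qed
  have mZ: "(\<lambda>x. (?Z x - \<mu>)\<^sup>2) \<in> borel_measurable M" by measurable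
  have iV: "integrable M (\<lambda>x. (?Z x - \<mu>)\<^sup>2)"
    using iZ iZ2 by (simp add: power2_diff)
  have "prob {x. ?Z x \<le> \<mu> / 2} \<le> prob {x. (?Z x - \<mu>)\<^sup>2 \<ge> (\<mu> / 2)\<^sup>2}"
  proof (rule finite_measure_mono)
    show "{x. ?Z x \<le> \<mu> / 2} \<subseteq> {x. (?Z x - \<mu>)\<^sup>2 \<ge> (\<mu> / 2)\<^sup>2}"
    proof safe
      fix x assume "?Z x \<le> \<mu> / 2"
      then have "\<bar>\<mu> / 2\<bar> \<le> \<bar>?Z x - \<mu>\<bar>" using \<mu>(2) by linarith
      then show "(\<mu> / 2)\<^sup>2 \<le> (?Z x - \<mu>)\<^sup>2" by (rule abs_le_square_iff[THEN iffD1])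
    qed
    have "{x. (?Z x - \<mu>)\<^sup>2 \<ge> (\<mu> / 2)\<^sup>2} = {x\<in>space M. (?Z x - \<mu>)\<^sup>2 \<ge> (\<mu> / 2)\<^sup>2}" by (simp add: sp)
    also have "\<dots> \<in> sets M" using mZ by measurable
    finally show "{x. (?Z x - \<mu>)\<^sup>2 \<ge> (\<mu> / 2)\<^sup>2} \<in> sets M" .
  qed
  also have "\<dots> \<le> expectation (\<lambda>x. (?Z x - \<mu>)\<^sup>2) / (\<mu> / 2)\<^sup>2"
    using iV \<mu> sp by (intro markov_le) auto
  also have "\<dots> \<le> (\<mu> + 4 * m\<^sup>2 * r) / (\<mu> / 2)\<^sup>2" using V by (intro divide_right_mono) auto
  finally show ?thesis by (simp add: power_divide mult.commute)
qed

lemma iid_blocks_product: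
  fixes g G1 G2 :: "real \<Rightarrow> real"
  assumes [measurable]: "g \<in> borel_measurable borel" "G1 \<in> borel_measurable borel" "G2 \<in> borel_measurable borel"
    and b: "\<And>y. \<bar>G1 y\<bar> \<le> 1" "\<And>y. \<bar>G2 y\<bar> \<le> 1" and disj: "K1 \<inter> K2 = {}"
  shows "(\<integral>\<omega>. G1 (\<Sum>k\<in>K1. g (\<omega> k)) * G2 (\<Sum>k\<in>K2. g (\<omega> k)) \<partial>iid)
    = (\<integral>\<omega>. G1 (\<Sum>k\<in>K1. g (\<omega> k)) \<partial>iid) * (\<integral>\<omega>. G2 (\<Sum>k\<in>K2. g (\<omega> k)) \<partial>iid)"
proof -
  \<comment> \<open>Indexing the two sets by \<open>bool\<close> makes this an instance of
    independence of disjoint blocks.\<close>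
  define K where "K b = (if b then K1 else K2)" for b
  define G where "G b = (if b then G1 else G2)" for b
  have Gb: "\<bar>G b y\<bar> \<le> 1" for b y using b by (simp add: G_def)
  have [measurable]: "G b \<in> borel_measurable borel" for b unfolding G_def by simp
  have m: "(\<lambda>\<omega>. g (\<omega> k)) \<in> borel_measurable iid" for k by (rule measurable_iid_comp) measurable
  then have m2: "(\<lambda>\<omega>. G b (\<Sum>k\<in>K b. g (\<omega> k))) \<in> borel_measurable iid" for b
    by (intro measurable_compose[OF borel_measurable_sum]) auto
  have "iid.indep_vars (\<lambda>_. borel) (\<lambda>b \<omega>. \<Sum>k\<in>K b. g (\<omega> k)) UNIV"
    using disj by (intro indep_vars_iid_blocks) (auto simp: disjoint_family_on_def K_def)
  then have "iid.indep_vars (\<lambda>_. borel) (\<lambda>b \<omega>. G b (\<Sum>k\<in>K b. g (\<omega> k))) UNIV"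
    by (rule iid.indep_vars_compose2) measurable
  then have "(\<integral>\<omega>. (\<Prod>b\<in>UNIV. G b (\<Sum>k\<in>K b. g (\<omega> k))) \<partial>iid) = (\<Prod>b\<in>UNIV. \<integral>\<omega>. G b (\<Sum>k\<in>K b. g (\<omega> k)) \<partial>iid)"
    by (intro iid.indep_vars_lebesgue_integral iid.integrable_const_bound[of _ 1]) (use Gb m2 in auto)
  then show ?thesis by (simp add: UNIV_bool K_def G_def mult.commute)
qed

text \<open>Gaussian bounds on both sides, so that a high power of the cosine acts as a Gaussian
  bump of width about 1 / sqrt q. The lower one is the chain exp (-x^2) \<le> 1 - x^2 + x^4 / 2
  \<le> 1 - x^2 / 2 \<le> cos x.\<close>

lemma cos_bounds:
  assumes "\<bar>x\<bar> \<le> (1::real)"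
  shows "exp (- x\<^sup>2) \<le> cos x" "cos x \<le> exp (- (x\<^sup>2 / 3))"
proof -
  have x2: "0 \<le> x\<^sup>2" "x\<^sup>2 \<le> 1" using assms abs_le_square_iff[of x 1] by auto
  have bound: "\<bar>cos x - (1 - x\<^sup>2 / 2)\<bar> \<le> x ^ 4 / 24"
  proof -
    have "\<bar>cos x - (\<Sum>m<4. cos_coeff m * x ^ m)\<bar> \<le> inverse (fact 4) * \<bar>x\<bar> ^ 4"
      using Maclaurin_cos_expansion[of x 4]
    proof
      fix t assume t: "\<bar>t\<bar> \<le> \<bar>x\<bar> \<and> cos x = (\<Sum>m<4. cos_coeff m * x ^ m) + cos (t + 1 / 2 * real 4 * pi) / fact 4 * x ^ 4"
      then have "\<bar>cos x - (\<Sum>m<4. cos_coeff m * x ^ m)\<bar> = \<bar>cos (t + 1 / 2 * real 4 * pi)\<bar> / fact 4 * \<bar>x\<bar> ^ 4"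
        by (simp add: abs_mult power_abs)
      also have "\<dots> \<le> 1 / fact 4 * \<bar>x\<bar> ^ 4" by (intro mult_right_mono divide_right_mono) auto
      finally show ?thesis by (simp add: divide_inverse)
    qed
    moreover have "(\<Sum>m<4. cos_coeff m * x ^ m) = 1 - x\<^sup>2 / 2"
      by (simp add: lessThan_nat_numeral cos_coeff_def)
    moreover have "inverse (fact 4) * \<bar>x\<bar> ^ 4 = x ^ 4 / 24" by (simp add: fact_numeral power_even_abs)
    ultimately show ?thesis by (simp only:)
  qed
  have x4: "x ^ 4 \<le> x\<^sup>2"
  proof -
    have "x ^ 4 = x\<^sup>2 * x\<^sup>2" by (simp flip: power_add)
    also have "\<dots> \<le> x\<^sup>2 * 1" using x2 by (intro mult_left_mono) auto
    finally show ?thesis by simp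
  qed
  have "cos x \<le> 1 - x\<^sup>2 / 3" using abs_le_D1[OF bound] x4 x2 by linarith
  also have "\<dots> \<le> exp (- (x\<^sup>2 / 3))" using exp_ge_add_one_self[of "- (x\<^sup>2 / 3)"] by simp
  finally show "cos x \<le> exp (- (x\<^sup>2 / 3))" .
  have "exp (- x\<^sup>2) \<le> 1 + (- x\<^sup>2) + (- x\<^sup>2)\<^sup>2 / 2"
  proof -
    obtain t where t: "\<bar>t\<bar> \<le> \<bar>- x\<^sup>2\<bar>" "exp (- x\<^sup>2) = (\<Sum>m<3. (- x\<^sup>2) ^ m / fact m) + exp t / fact 3 * (- x\<^sup>2) ^ 3"
      using Maclaurin_exp_le[of "- x\<^sup>2" 3] by blast
    moreover have "(- x\<^sup>2) ^ 3 = - ((x\<^sup>2) ^ 3)" by simp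
    then have "exp t / fact 3 * (- x\<^sup>2) ^ 3 \<le> 0" using x2 by (simp add: mult_nonneg_nonneg)
    moreover have "(\<Sum>m<3. (- x\<^sup>2) ^ m / fact m) = 1 + (- x\<^sup>2) + (- x\<^sup>2)\<^sup>2 / 2"
      by (simp add: eval_nat_numeral lessThan_Suc)
    ultimately show ?thesis by linarith
  qed
  also have "(- x\<^sup>2)\<^sup>2 = x ^ 4" by (simp flip: power_mult)
  also have "1 + - x\<^sup>2 + x ^ 4 / 2 \<le> 1 - x\<^sup>2 / 2" using x4 by simp
  also have "\<dots> \<le> cos x"
  proof -
    have "(sin (x / 2))\<^sup>2 \<le> (x / 2)\<^sup>2" using abs_sin_x_le_abs_x[of "x / 2"] by (rule abs_le_square_iff[THEN iffD1])
    then show ?thesis using cos_double_sin[of "x / 2"] by (simp add: power_divide)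
  qed
  finally show "exp (- x\<^sup>2) \<le> cos x" .
qed

lemma (in dissociated_system) S_single:
  assumes "K \<subseteq> J" "finite J"
  shows "S J (\<lambda>k. if k \<in> K then r else 0) x = r * S K (\<lambda>_. 1) x"
proof -
  have "S J (\<lambda>k. if k \<in> K then r else 0) x = (\<Sum>k\<in>K. (if k \<in> K then r else 0) * p (real (n k) * x))"
    unfolding S_def using assms by (intro sum.mono_neutral_right) auto
  then show ?thesis by (simp add: S_def sum_distrib_left)
qed

lemma (in dissociated_system) T_single:
  assumes "K \<subseteq> J" "finite J"
  shows "T J (\<lambda>k. if k \<in> K then r else 0) x = r * T K (\<lambda>_. 1) x"
proof -
  have "T J (\<lambda>k. if k \<in> K then r else 0) x = (\<Sum>k\<in>K. (if k \<in> K then r else 0) * p (x k))"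
    unfolding T_def using assms by (intro sum.mono_neutral_right) auto
  then show ?thesis by (simp add: T_def sum_distrib_left)
qed

lemma sum_square_single:
  fixes r :: real
  assumes "K \<subseteq> J" "finite J"
  shows "(\<Sum>k\<in>J. (if k \<in> K then r else 0)\<^sup>2) = real (card K) * r\<^sup>2"
proof -
  have "(\<Sum>k\<in>J. (if k \<in> K then r else 0)\<^sup>2) = (\<Sum>k\<in>K. (if k \<in> K then r else 0)\<^sup>2)"
    using assms by (intro sum.mono_neutral_right) auto
  then show ?thesis by simp
qed

text \<open>
  Bumps \<open>cos\<^sup>q\<close> of two block sums are combinations of characters of frequency at most \<open>q\<close>, hence
  have nearly the same joint mean as in the independent model, where they factorise.
\<close>

lemma (in dissociated_system)
  assumes K: "finite K" "K \<subseteq> I" and K': "finite K'" "K' \<subseteq> I" and s: "even s" "s > 0"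
    and r: "real (card K) * r\<^sup>2 \<le> \<tau>" "real (card K') * r'\<^sup>2 \<le> \<tau>"
  shows bump_single: "\<bar>(\<integral>x. cos (r * S K (\<lambda>_. 1) x - a) ^ q \<partial>circ) - (\<integral>x. cos (r * T K (\<lambda>_. 1) x - a) ^ q \<partial>iid)\<bar>
      \<le> 2 * exp (15 * C\<^sup>2 * (4 * (real q)\<^sup>2 * \<tau>) - real s)"
    and bump_pair: "K \<inter> K' = {} \<Longrightarrow>
      (\<integral>x. cos (r * S K (\<lambda>_. 1) x - a) ^ q * cos (r' * S K' (\<lambda>_. 1) x - a) ^ q \<partial>circ)
      \<le> (\<integral>x. cos (r * T K (\<lambda>_. 1) x - a) ^ q \<partial>iid) * (\<integral>x. cos (r' * T K' (\<lambda>_. 1) x - a) ^ q \<partial>iid)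
        + 2 * exp (15 * C\<^sup>2 * (4 * (real q)\<^sup>2 * \<tau>) - real s)"
proof -
  have \<tau>: "\<tau> \<ge> 0" by (rule order_trans[OF _ r(1)]) simp
  show "\<bar>(\<integral>x. cos (r * S K (\<lambda>_. 1) x - a) ^ q \<partial>circ) - (\<integral>x. cos (r * T K (\<lambda>_. 1) x - a) ^ q \<partial>iid)\<bar>
      \<le> 2 * exp (15 * C\<^sup>2 * (4 * (real q)\<^sup>2 * \<tau>) - real s)"
  proof -
    have "2 * (real q)\<^sup>2 * ((\<Sum>k\<in>K. (if k \<in> K then r else 0)\<^sup>2) + (\<Sum>k\<in>K. (if k \<in> {} then r else 0)\<^sup>2)) \<le> 4 * (real q)\<^sup>2 * \<tau>"
    proof -
      have "2 * (real q)\<^sup>2 * (real (card K) * r\<^sup>2) \<le> 2 * (real q)\<^sup>2 * (2 * \<tau>)" using r \<tau> by (intro mult_left_mono) auto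
      then show ?thesis by simp
    qed
    from cos_compare[OF K s this, of a 0] show ?thesis
      using K by (simp only: S_single[OF subset_refl K(1)] S_single[OF empty_subsetI K(1)] T_single[OF subset_refl K(1)] T_single[OF empty_subsetI K(1)])
        (simp add: S_def T_def)
  qed
  assume disj: "K \<inter> K' = {}"
  let ?J = "K \<union> K'"
  have J: "finite ?J" "?J \<subseteq> I" "K \<subseteq> ?J" "K' \<subseteq> ?J" using K K' by auto
  have W: "2 * (real q)\<^sup>2 * ((\<Sum>k\<in>?J. (if k \<in> K then r else 0)\<^sup>2) + (\<Sum>k\<in>?J. (if k \<in> K' then r' else 0)\<^sup>2)) \<le> 4 * (real q)\<^sup>2 * \<tau>"
  proof -
    have "2 * (real q)\<^sup>2 * (real (card K) * r\<^sup>2 + real (card K') * r'\<^sup>2) \<le> 2 * (real q)\<^sup>2 * (\<tau> + \<tau>)"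
      using r by (intro mult_left_mono add_mono) auto
    then show ?thesis using J by (simp add: sum_square_single)
  qed
  have "(\<integral>x. cos (r * S K (\<lambda>_. 1) x - a) ^ q * cos (r' * S K' (\<lambda>_. 1) x - a) ^ q \<partial>circ)
     \<le> (\<integral>x. cos (r * T K (\<lambda>_. 1) x - a) ^ q * cos (r' * T K' (\<lambda>_. 1) x - a) ^ q \<partial>iid)
        + 2 * exp (15 * C\<^sup>2 * (4 * (real q)\<^sup>2 * \<tau>) - real s)"
    using abs_le_D1[OF cos_compare[OF J(1,2) s W, of a a]]
    unfolding S_single[OF J(3,1)] S_single[OF J(4,1)] T_single[OF J(3,1)] T_single[OF J(4,1)] by linarith
  also have "(\<integral>x. cos (r * T K (\<lambda>_. 1) x - a) ^ q * cos (r' * T K' (\<lambda>_. 1) x - a) ^ q \<partial>iid)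
    = (\<integral>x. cos (r * T K (\<lambda>_. 1) x - a) ^ q \<partial>iid) * (\<integral>x. cos (r' * T K' (\<lambda>_. 1) x - a) ^ q \<partial>iid)"
  proof -
    have "\<bar>cos y ^ q\<bar> \<le> 1" for y :: real by (simp add: power_abs power_le_one)
    then show ?thesis
      using iid_blocks_product[of p "\<lambda>y. cos (r * y - a) ^ q" "\<lambda>y. cos (r' * y - a) ^ q" K K'] disj
      by (simp add: T_def)
  qed
  finally show "(\<integral>x. cos (r * S K (\<lambda>_. 1) x - a) ^ q * cos (r' * S K' (\<lambda>_. 1) x - a) ^ q \<partial>circ)
      \<le> (\<integral>x. cos (r * T K (\<lambda>_. 1) x - a) ^ q \<partial>iid) * (\<integral>x. cos (r' * T K' (\<lambda>_. 1) x - a) ^ q \<partial>iid)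
        + 2 * exp (15 * C\<^sup>2 * (4 * (real q)\<^sup>2 * \<tau>) - real s)" .
qed

section \<open>Large block sums by the second moment method\<close>

context weakly_lacunary_lil
begin

definition block :: "nat \<Rightarrow> nat \<Rightarrow> nat set" where
  "block h i = {2 ^ (h * i)<..2 ^ (h * (i + 1))}"

definition block_sum :: "nat \<Rightarrow> nat \<Rightarrow> real \<Rightarrow> real" where
  "block_sum h i x = (\<Sum>k\<in>block h i. f (real (n k) * x))"

text \<open>The logarithm is that of J rather than of i, so all blocks with J \<le> i < 2 J share
  one level.\<close>

definition block_norm :: "nat \<Rightarrow> nat \<Rightarrow> nat \<Rightarrow> real" where
  "block_norm h J i = sqrt (real (card (block h i)) * ln (real J))"

lemma block_sum_measurable [measurable]: "block_sum h i \<in> borel_measurable borel"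
  unfolding block_sum_def by measurable

lemma finite_block: "finite (block h i)" by (simp add: block_def)

lemma card_block: "card (block h i) = 2 ^ (h * (i + 1)) - 2 ^ (h * i)"
  by (simp add: block_def)

lemma card_block_ge:
  assumes "h \<ge> 1" shows "card (block h i) \<ge> 2 ^ (h * i)"
proof -
  have "(2::nat) ^ (h * i) * 2 ^ 1 \<le> 2 ^ (h * i) * 2 ^ h" using assms by (intro mult_left_mono power_increasing) auto
  then show ?thesis by (simp add: card_block power_add add.commute mult.commute[of "2 ^ h"])
qed

lemma block_disjoint: "i \<noteq> j \<Longrightarrow> block h i \<inter> block h j = {}"
proof -
  have *: "block h i \<inter> block h j = {}" if "i < j" for i j
  proof -
    have "(2::nat) ^ (h * (i + 1)) \<le> 2 ^ (h * j)" using that by (intro power_increasing mult_left_mono) auto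
    then show ?thesis by (auto simp: block_def)
  qed
  assume "i \<noteq> j"
  then show ?thesis using *[of i j] *[of j i] by (auto simp: neq_iff)
qed

lemma block_norm_ge:
  assumes h: "h \<ge> 1" and i: "J \<le> i" and J: "J \<ge> 1"
  shows "sqrt (2 ^ J * ln (real J)) \<le> block_norm h J i"
proof -
  have "1 * J \<le> h * i" using h i by (intro mult_mono) auto
  then have "(2::nat) ^ J \<le> 2 ^ (h * i)" by (intro power_increasing) auto
  then have "2 ^ J \<le> card (block h i)" using card_block_ge[OF h, of i] by linarith
  then have "2 ^ J \<le> real (card (block h i))" by (metis of_nat_le_iff of_nat_numeral of_nat_power)
  then show ?thesis unfolding block_norm_def using J by (intro real_sqrt_le_mono mult_right_mono) auto
qed

text \<open>As c^2 < 2 v, a normalised block sum is near c with probability at least J^(-\<gamma>)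
  for some \<gamma> < 1, so the J bumps centred at c have a total mean growing like a power of J. If
  no block sum is large, every bump is at most J^(-2) off small exceptional sets and their total is
  far below its mean.\<close>

lemma prob_no_large_block_tendsto_0:
  assumes h: "h \<ge> 1" and c: "0 < c" "c\<^sup>2 < 2 * v" and \<eta>: "0 < \<eta>"
  shows "(\<lambda>J. circ.prob {x. \<forall>i\<in>{J..<2 * J}. block_sum h i x \<le> (c - 2 * \<eta>) * block_norm h J i}) \<longlonglongrightarrow> 0"
proof -
  define \<gamma> where "\<gamma> = (c\<^sup>2 / (2 * v) + 1) / 2"
  have "c\<^sup>2 / (2 * v) < 1" using c v_pos by simp
  then have \<gamma>: "c\<^sup>2 / (2 * v) < \<gamma>" "\<gamma> < 1" by (auto simp: \<gamma>_def)
  define \<zeta> where "\<zeta> = 1 - \<gamma>"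
  have \<zeta>: "\<zeta> > 0" using \<gamma> by (simp add: \<zeta>_def)
  \<comment> \<open>The sub-Gaussian tail beyond H is exp ((2 C^2 - H) y) = J^(-3) up to a constant,
    small enough for a union over J blocks.\<close>
  define H where "H = 2 * C\<^sup>2 + 3"
  have H: "H \<ge> 3" by (simp add: H_def)
  \<comment> \<open>For |u| \<le> H the argument (u - c) / \<beta> stays in [-1, 1], within one hump
    of the cosine.\<close>
  define \<beta> where "\<beta> = H + c"
  have \<beta>: "\<beta> > 0" "\<beta> \<ge> 1" using H c by (auto simp: \<beta>_def)
  \<comment> \<open>With q \<ge> 2 K1 ln J the bump falls to exp (- q \<eta>^2 / (3 \<beta>^2))
    \<le> J^(-2) at distance \<eta> from c.\<close>
  define K1 where "K1 = 3 * \<beta>\<^sup>2 / \<eta>\<^sup>2"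
  have K1: "K1 > 0" using \<beta> \<eta> by (simp add: K1_def)
  \<comment> \<open>Conversely, q \<le> 4 K1 ln J keeps the bump above J^(-\<zeta> / 2) within
    \<eta>' of c.\<close>
  define \<eta>' where "\<eta>' = min (\<beta> - c) (\<beta> * sqrt (\<zeta> / (8 * K1)))"
  have \<eta>': "\<eta>' > 0" "\<eta>' \<le> \<beta> - c" "\<eta>' \<le> \<beta> * sqrt (\<zeta> / (8 * K1))"
    using \<beta> \<zeta> K1 H by (auto simp: \<eta>'_def \<beta>_def)
  \<comment> \<open>The first term outweighs the exponent of the character comparison, 960 C^2 K1^2
    / \<beta>^2 times ln J, the second serves the tail bound at level H ln J, and the last leaves an
    error of order J^(-4).\<close>
  define K where "K = 480 * C\<^sup>2 * K1\<^sup>2 / \<beta>\<^sup>2 + 3 * H + 2"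
  have K: "K > 0" using \<beta> H by (auto simp: K_def intro!: add_nonneg_pos)
  \<comment> \<open>All blocks lie below 2^(2 h J); with this L the L1 error of so many terms is
    still of order 4^(-J).\<close>
  define L where "L = 16 * (h + 1)"
  define r where "r J = 2 * real J powr (- 4)" for J :: nat
  define E where "E J = 2 ^ (14 * (h + 1)) * V * (1 / 4) ^ J" for J :: nat
  define bd where "bd J = (8 * real J powr (- \<zeta> / 2) + 128 * real J powr (- \<zeta>)) + 4 * real J powr (- 2) + E J" for J :: nat
  have bd_lim: "bd \<longlonglongrightarrow> 0"
  proof -
    have "(\<lambda>J. 8 * real J powr (- \<zeta> / 2)) \<longlonglongrightarrow> 0" "(\<lambda>J. 128 * real J powr (- \<zeta>)) \<longlonglongrightarrow> 0" "(\<lambda>J. 4 * real J powr (- 2)) \<longlonglongrightarrow> 0"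
      using \<zeta> by real_asymp+
    moreover have "(\<lambda>J. 2 ^ (14 * (h + 1)) * V * (1 / 4) ^ J) \<longlonglongrightarrow> 2 ^ (14 * (h + 1)) * V * 0"
      by (intro tendsto_mult_left LIMSEQ_power_zero) simp
    ultimately have "(\<lambda>J. (8 * real J powr (- \<zeta> / 2) + 128 * real J powr (- \<zeta>)) + 4 * real J powr (- 2) + 2 ^ (14 * (h + 1)) * V * (1 / 4) ^ J)
        \<longlonglongrightarrow> (0 + 0) + 0 + 2 ^ (14 * (h + 1)) * V * 0"
      by (intro tendsto_add)
    then show ?thesis by (simp add: bd_def[abs_def] E_def)
  qed
  have "eventually (\<lambda>J. circ.prob {x. \<forall>i\<in>{J..<2 * J}. block_sum h i x \<le> (c - 2 * \<eta>) * block_norm h J i} \<le> bd J) sequentially"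
  proof -
    have "eventually (\<lambda>J. \<exists>B p. card B \<le> 2 ^ (J div 8) \<and>
       approx_system n (moment_order K J) ((2 ^ (J div 8)) ^ (2 * L)) B p C f (V / (2 ^ (J div 8)) ^ L)) sequentially"
      by (rule dyadic_scale_ex) (use K in auto)
    moreover have "eventually (\<lambda>J. \<forall>A. finite A \<longrightarrow> ln (real J) ^ 4 \<le> real (card A) \<longrightarrow>
      iid.prob {\<omega>. \<bar>(\<Sum>k\<in>A. f (\<omega> k)) / sqrt (real (card A) * ln (real J)) - c\<bar> \<le> \<eta>' / 2} \<ge> exp (- \<gamma> * ln (real J))) sequentially"
    proof -
      have lim: "filterlim (\<lambda>J. ln (real J)) at_top sequentially" by real_asymp
      have "0 < \<eta>' / 2" using \<eta>'(1) by simp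
      from eventually_compose_filterlim[OF moderate_deviation_ge[OF v_pos c(1) this \<gamma>(1)] lim] show ?thesis .
    qed
    moreover have "eventually (\<lambda>J. ln (real J) ^ 4 \<le> 2 ^ J) sequentially" by real_asymp
    moreover have "eventually (\<lambda>J. 1 + C * 2 powr (real J / 8) \<le> min \<eta> (\<eta>' / 2) * sqrt (2 ^ J * ln (real J))) sequentially"
    proof -
      have "((\<lambda>J. (1 + C * 2 powr (real J / 8)) / sqrt (2 ^ J * ln (real J))) \<longlongrightarrow> 0) sequentially"
        by real_asymp
      moreover have "0 < min \<eta> (\<eta>' / 2)" using \<eta> \<eta>' by simp
      ultimately have "eventually (\<lambda>J. (1 + C * 2 powr (real J / 8)) / sqrt (2 ^ J * ln (real J)) < min \<eta> (\<eta>' / 2)) sequentially"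
        by (rule order_tendstoD(2))
      moreover have "eventually (\<lambda>j. ln (real j) > 0) sequentially" by real_asymp
      ultimately show ?thesis by eventually_elim (simp add: divide_less_eq del: min_less_iff_conj)
    qed
    moreover have "eventually (\<lambda>J. E J \<le> real J powr (- \<gamma>) / 2) sequentially"
      unfolding E_def using V_nonneg by real_asymp
    moreover have "eventually (\<lambda>J. 4 * (real J * real J powr (- 2)) < real J powr (\<zeta> / 2)) sequentially"
      using \<zeta> by real_asymp
    moreover have "eventually (\<lambda>J. K1 * ln (real J) \<ge> 1) sequentially" using K1 by real_asymp
    moreover have "eventually (\<lambda>J. ln (real J) \<ge> 1) sequentially" by real_asymp
    moreover have "eventually (\<lambda>J. J \<ge> 64) sequentially" by (rule eventually_ge_at_top)
    ultimately show ?thesis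
    proof eventually_elim
      case (elim J)
      obtain B p where B: "card B \<le> 2 ^ (J div 8)" and
        ap: "approx_system n (moment_order K J) ((2 ^ (J div 8)) ^ (2 * L)) B p C f (V / (2 ^ (J div 8)) ^ L)"
        using elim(1) by blast
      define \<delta> where "\<delta> = V / (2 ^ (J div 8)) ^ L"
      interpret A: approx_system n "moment_order K J" "(2 ^ (J div 8)) ^ (2 * L)" B p C f \<delta>
        using ap unfolding \<delta>_def .
      define y where "y = ln (real J)"
      have y: "y \<ge> 1" using elim(8) by (simp add: y_def)
      have J64: "J \<ge> 64" by fact
      have Jp: "exp (t * y) = real J powr t" for t using J64 by (simp add: y_def powr_def)
      define W where "W = {1..(2::nat) ^ (2 * h * J)}"
      \<comment> \<open>An even power keeps the bump nonnegative.\<close>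
      define q where "q = 2 * nat \<lceil>K1 * y\<rceil>"
      have q: "real q \<ge> 2 * (K1 * y)" "real q \<le> 4 * (K1 * y)" "even q"
        using elim(7) unfolding q_def y_def by (linarith | simp)+
      define m where "m i = real (card (block h i))" for i
      define z where "z i = block_norm h J i" for i
      have z_eq: "z i = sqrt (m i * y)" for i by (simp add: z_def block_norm_def m_def y_def)
      have m_ge: "m i \<ge> 2 ^ J" if "J \<le> i" for i
      proof -
        have "1 * J \<le> h * i" using h that by (intro mult_mono) auto
        then have "(2::nat) ^ J \<le> 2 ^ (h * i)" by (intro power_increasing) auto
        then have "2 ^ J \<le> card (block h i)" using card_block_ge[OF h, of i] by linarith
        then show ?thesis unfolding m_def by (metis of_nat_le_iff of_nat_numeral of_nat_power)
      qed
      have m0: "m i > 0" if "J \<le> i" for i using m_ge[OF that] by (rule less_le_trans[rotated]) simp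
      have z0: "z i > 0" if "J \<le> i" for i using m0[OF that] y by (simp add: z_eq)
      have z2: "(z i)\<^sup>2 = m i * y" for i using y by (simp add: z_eq m_def)
      have z_small: "1 + C * 2 powr (real J / 8) \<le> min \<eta> (\<eta>' / 2) * z i" if "J \<le> i" for i
      proof -
        have "0 \<le> min \<eta> (\<eta>' / 2)" using \<eta> \<eta>' by simp
        then have "min \<eta> (\<eta>' / 2) * sqrt (2 ^ J * ln (real J)) \<le> min \<eta> (\<eta>' / 2) * z i"
          unfolding z_def using J64 by (intro mult_left_mono block_norm_ge h that) auto
        then show ?thesis using elim(4) by linarith
      qed
      define Kb where "Kb i = block h i - B" for i
      have blkW: "block h i \<subseteq> W" if "i < 2 * J" for i
      proof -
        have "h * (i + 1) \<le> h * (2 * J)" using that by (intro mult_left_mono) auto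
        then have "(2::nat) ^ (h * (i + 1)) \<le> 2 ^ (2 * h * J)" by (intro power_increasing) (auto simp: mult_ac)
        then show ?thesis unfolding block_def W_def
          by (intro subsetI) (simp only: greaterThanAtMost_iff atLeastAtMost_iff, linarith)
      qed
      have blk1: "block h i \<subseteq> {1..}" for i by (auto simp: block_def)
      have Kb: "finite (Kb i)" "Kb i \<subseteq> {1..} - B" "real (card (Kb i)) \<le> m i" for i
        using blk1[of i] card_mono[of "block h i" "Kb i"] by (auto simp: Kb_def finite_block m_def)
      have Kdisj: "Kb i \<inter> Kb j = {}" if "i \<noteq> j" for i j using block_disjoint[OF that, of h] by (auto simp: Kb_def)
      have d8: "real (J div 8) \<le> real J / 8" by linarith
      have cardB: "real (card (block h i \<inter> B)) \<le> 2 powr (real J / 8)" for i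
      proof -
        have "card (block h i \<inter> B) \<le> 2 ^ (J div 8)"
          using card_mono[OF A.finite_B, of "block h i \<inter> B"] B by auto
        then have "real (card (block h i \<inter> B)) \<le> 2 ^ (J div 8)" by (metis of_nat_le_iff of_nat_numeral of_nat_power)
        also have "\<dots> = 2 powr (real (J div 8))" by (simp add: powr_realpow)
        also have "\<dots> \<le> 2 powr (real J / 8)" using d8 by (intro powr_mono) auto
        finally show ?thesis .
      qed
      have \<delta>E: "real (card W) * \<delta> \<le> E J"
      proof -
        have "2 * h * J + 2 * J \<le> (J div 8) * L + 14 * (h + 1)"
        proof -
          have "J \<le> (J div 8) * 8 + 7" by linarith
          then have "2 * (h + 1) * J \<le> 2 * (h + 1) * ((J div 8) * 8 + 7)" by (intro mult_left_mono) auto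
          then show ?thesis by (simp add: L_def algebra_simps)
        qed
        then have "(2::real) ^ (2 * h * J + 2 * J) \<le> 2 ^ ((J div 8) * L + 14 * (h + 1))" by (intro power_increasing) auto
        then have "(2::real) ^ (2 * h * J) * 4 ^ J \<le> (2 ^ (J div 8)) ^ L * 2 ^ (14 * (h + 1))"
          by (simp add: power_add power_mult)
        then have "(2::real) ^ (2 * h * J) / (2 ^ (J div 8)) ^ L \<le> 2 ^ (14 * (h + 1)) / 4 ^ J"
          by (simp add: field_simps)
        then have "V * ((2::real) ^ (2 * h * J) / (2 ^ (J div 8)) ^ L) \<le> V * (2 ^ (14 * (h + 1)) / 4 ^ J)"
          using V_nonneg by (rule mult_left_mono)
        then show ?thesis by (simp add: W_def \<delta>_def E_def power_one_over mult_ac)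
      qed
      define u where "u i x = (1 / z i) * A.S (Kb i) (\<lambda>_. 1) x" for i x
      define g where "g i x = cos ((u i x - c) / \<beta>) ^ q" for i x
      define u' where "u' i \<omega> = (1 / z i) * A.T (Kb i) (\<lambda>_. 1) \<omega>" for i \<omega>
      define e where "e i = (\<integral>\<omega>. cos ((u' i \<omega> - c) / \<beta>) ^ q \<partial>iid)" for i
      have um[measurable]: "u i \<in> borel_measurable borel" "u' i \<in> borel_measurable iid" for i
        unfolding u_def u'_def by measurable
      have cosq: "0 \<le> cos t ^ q" "cos t ^ q \<le> 1" for t :: real
      proof -
        show "0 \<le> cos t ^ q" using q(3) by (rule zero_le_even_power)
        have "\<bar>cos t ^ q\<bar> \<le> 1" by (simp add: power_abs power_le_one)
        then show "cos t ^ q \<le> 1" by simp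
      qed
      \<comment> \<open>Squared weights of order 1 / y meet q^2 of order y^2, so the exponent in the
        comparison is of order y, just like the moment order.\<close>
      have \<tau>: "real (card (Kb i)) * (1 / (\<beta> * z i))\<^sup>2 \<le> 1 / (\<beta>\<^sup>2 * y)" if "J \<le> i" for i
      proof -
        have "real (card (Kb i)) * (1 / (\<beta> * z i))\<^sup>2 \<le> m i * (1 / (\<beta> * z i))\<^sup>2" using Kb by (intro mult_right_mono) auto
        also have "\<dots> = 1 / (\<beta>\<^sup>2 * y)" using m0[OF that] y \<beta> by (simp add: power_divide power_mult_distrib z2)
        finally show ?thesis .
      qed
      have err: "2 * exp (15 * C\<^sup>2 * (4 * (real q)\<^sup>2 * (1 / (\<beta>\<^sup>2 * y))) - real (moment_order K J)) \<le> r J"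
      proof -
        have "(real q)\<^sup>2 \<le> (4 * (K1 * y))\<^sup>2" using q by (intro power_mono) auto
        then have "15 * C\<^sup>2 * (4 * (real q)\<^sup>2 * (1 / (\<beta>\<^sup>2 * y))) \<le> 15 * C\<^sup>2 * (4 * (4 * (K1 * y))\<^sup>2 * (1 / (\<beta>\<^sup>2 * y)))"
          using y by (intro mult_left_mono mult_right_mono) auto
        also have "\<dots> = 960 * C\<^sup>2 * K1\<^sup>2 / \<beta>\<^sup>2 * y" using y \<beta> by (simp add: power2_eq_square)
        also have "\<dots> \<le> 2 * (K * y) - 4 * y" using y H by (simp add: K_def algebra_simps)
        finally have "15 * C\<^sup>2 * (4 * (real q)\<^sup>2 * (1 / (\<beta>\<^sup>2 * y))) - real (moment_order K J) \<le> (- 4) * y"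
          using moment_order_ge[of K J] unfolding y_def[symmetric] by linarith
        then have "exp (15 * C\<^sup>2 * (4 * (real q)\<^sup>2 * (1 / (\<beta>\<^sup>2 * y))) - real (moment_order K J)) \<le> exp ((- 4) * y)" by simp
        then show ?thesis unfolding r_def Jp[symmetric] by simp
      qed
      have momK: "even (moment_order K J)" "moment_order K J > 0"
      proof -
        have "0 < K * y" using K y by simp
        then show "moment_order K J > 0" using moment_order_ge[of K J] unfolding y_def[symmetric] by linarith
      qed (rule moment_order_even)
      have arg: "(1 / (\<beta> * z i)) * t - c / \<beta> = ((1 / z i) * t - c) / \<beta>" for t i
        by (simp add: diff_divide_distrib mult.commute)
      have r1: "\<bar>circ.expectation (g i) - e i\<bar> \<le> r J" if "J \<le> i" for i
        using order_trans[OF A.bump_single[where a = "c / \<beta>" and q = q, OF Kb(1,2) Kb(1,2) momK \<tau>[OF that] \<tau>[OF that]] err]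
        unfolding arg g_def e_def u_def u'_def by simp
      have r2: "circ.expectation (\<lambda>x. g i x * g j x) \<le> e i * e j + r J" if "J \<le> i" "J \<le> j" "i \<noteq> j" for i j
        using order_trans[OF A.bump_pair[where a = "c / \<beta>" and q = q, OF Kb(1,2) Kb(1,2) momK \<tau>[OF that(1)] \<tau>[OF that(2)] Kdisj[OF that(3)]] add_left_mono[OF err]]
        unfolding arg g_def e_def u_def u'_def by simp
      have e01: "0 \<le> e i" "e i \<le> 1" for i
      proof -
        show "0 \<le> e i" unfolding e_def by (rule integral_nonneg_AE) (simp add: cosq)
        have "e i \<le> (\<integral>\<omega>. 1 \<partial>iid)" unfolding e_def
          using cosq by (intro integral_mono iid.integrable_const_bound[of _ 1]) auto
        then show "e i \<le> 1" by (simp add: iid.prob_space[simplified])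
      qed
      \<comment> \<open>The deviation bound concerns f, the bump is built from p. Their normalised
        sums differ by at most \<eta>' / 2 unless the L1 error is large, an event of probability at
        most E J.\<close>
      have e_ge: "e i \<ge> real J powr (- \<gamma> - \<zeta> / 2) / 2" if i: "J \<le> i" "i < 2 * J" for i
      proof -
        define A1 where "A1 = {\<omega>. \<bar>(\<Sum>k\<in>block h i. f (\<omega> k)) / sqrt (real (card (block h i)) * ln (real J)) - c\<bar> \<le> \<eta>' / 2}"
        define A2 where "A2 = {\<omega>. A.R' W (\<lambda>_. 1) \<omega> \<ge> 1}"
        define A3 where "A3 = {\<omega>. \<bar>u' i \<omega> - c\<bar> \<le> \<eta>'}"
        have sets: "A1 \<in> iid.events" "A2 \<in> iid.events" "A3 \<in> iid.events"
        proof -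
          have "A1 = {\<omega>\<in>space iid. \<bar>(\<Sum>k\<in>block h i. f (\<omega> k)) / sqrt (real (card (block h i)) * ln (real J)) - c\<bar> \<le> \<eta>' / 2}"
            by (simp add: A1_def)
          also have "\<dots> \<in> iid.events" by measurable
          finally show "A1 \<in> iid.events" .
          have "A2 = {\<omega>\<in>space iid. A.R' W (\<lambda>_. 1) \<omega> \<ge> 1}" by (simp add: A2_def)
          also have "\<dots> \<in> iid.events" by measurable
          finally show "A2 \<in> iid.events" .
          have "A3 = {\<omega>\<in>space iid. \<bar>u' i \<omega> - c\<bar> \<le> \<eta>'}" by (simp add: A3_def)
          also have "\<dots> \<in> iid.events" by measurable
          finally show "A3 \<in> iid.events" .
        qed
        have "real J powr (- \<gamma>) \<le> iid.prob A1"
        proof -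
          have "ln (real J) ^ 4 \<le> real (card (block h i))" 
            using order_trans[OF elim(3) m_ge[OF i(1)]] unfolding m_def .
          then have "exp (- \<gamma> * ln (real J)) \<le> iid.prob A1" using elim(2) finite_block unfolding A1_def by blast
          then show ?thesis using Jp[of "- \<gamma>"] by (simp add: y_def)
        qed
        also have "iid.prob A1 \<le> iid.prob (A3 \<union> A2)"
        proof (rule iid.finite_measure_mono)
          show "A1 \<subseteq> A3 \<union> A2"
          proof
            fix \<omega> assume "\<omega> \<in> A1"
            then have w1: "\<bar>(\<Sum>k\<in>block h i. f (\<omega> k)) / z i - c\<bar> \<le> \<eta>' / 2" by (simp add: A1_def z_def block_norm_def)
            show "\<omega> \<in> A3 \<union> A2"
            proof (cases "\<omega> \<in> A2")
              case False
              have "A.R' (block h i) (\<lambda>_. 1) \<omega> \<le> A.R' W (\<lambda>_. 1) \<omega>"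
                unfolding A.R'_def using blkW[OF i(2)] by (intro sum_mono2) (auto simp: W_def)
              then have "A.R' (block h i) (\<lambda>_. 1) \<omega> \<le> 1" using False by (simp add: A2_def)
              moreover have "C * real (card (block h i \<inter> B)) \<le> C * 2 powr (real J / 8)" by (intro mult_left_mono cardB C_nonneg)
              moreover have "\<bar>(\<Sum>k\<in>block h i. f (\<omega> k)) - A.T (Kb i) (\<lambda>_. 1) \<omega>\<bar> \<le> A.R' (block h i) (\<lambda>_. 1) \<omega> + C * real (card (block h i \<inter> B))"
                using A.T_approx[OF finite_block, of "\<lambda>_. 1" \<omega> h i] by (simp add: Kb_def)
              ultimately have "\<bar>(\<Sum>k\<in>block h i. f (\<omega> k)) - A.T (Kb i) (\<lambda>_. 1) \<omega>\<bar> \<le> min \<eta> (\<eta>' / 2) * z i"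
                using z_small[OF i(1)] by linarith
              also have "\<dots> \<le> (\<eta>' / 2) * z i" using z0[OF i(1)] by (intro mult_right_mono) auto
              finally have "\<bar>(\<Sum>k\<in>block h i. f (\<omega> k)) - A.T (Kb i) (\<lambda>_. 1) \<omega>\<bar> / z i \<le> \<eta>' / 2"
                using z0[OF i(1)] by (simp add: divide_le_eq)
              moreover have "\<bar>(\<Sum>k\<in>block h i. f (\<omega> k)) - A.T (Kb i) (\<lambda>_. 1) \<omega>\<bar> / z i = \<bar>(\<Sum>k\<in>block h i. f (\<omega> k)) / z i - u' i \<omega>\<bar>"
                using z0[OF i(1)] by (simp add: u'_def diff_divide_distrib[symmetric])
              ultimately have "\<bar>u' i \<omega> - c\<bar> \<le> \<eta>'" using w1 by linarith
              then show ?thesis by (simp add: A3_def)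
            qed simp
          qed
        qed (use sets in auto)
        also have "\<dots> \<le> iid.prob A3 + iid.prob A2" using sets by (intro measure_Un_le)
        also have "iid.prob A2 \<le> E J"
        proof -
          have "iid.prob A2 \<le> (\<integral>\<omega>. A.R' W (\<lambda>_. 1) \<omega> \<partial>iid) / 1"
            unfolding A2_def by (intro iid.markov_le A.R'_integrable) (auto simp: A.R'_def sum_nonneg)
          also have "\<dots> \<le> real (card W) * \<delta>" using A.R'_le[of W "\<lambda>_. 1"] by simp
          finally show ?thesis using \<delta>E by linarith
        qed
        finally have PA3: "real J powr (- \<gamma>) / 2 \<le> iid.prob A3" using elim(5) by linarith
        have low: "real J powr (- \<zeta> / 2) * indicator A3 \<omega> \<le> cos ((u' i \<omega> - c) / \<beta>) ^ q" for \<omega>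
        proof (cases "\<omega> \<in> A3")
          case True
          define t where "t = (u' i \<omega> - c) / \<beta>"
          have "\<bar>t\<bar> \<le> \<eta>' / \<beta>" using True \<beta> by (simp add: t_def A3_def divide_right_mono)
          moreover have "\<eta>' / \<beta> \<le> 1" "\<eta>' / \<beta> \<le> sqrt (\<zeta> / (8 * K1))" using \<eta>' \<beta> c by (simp_all add: divide_le_eq mult.commute)
          ultimately have t: "\<bar>t\<bar> \<le> 1" "\<bar>t\<bar> \<le> sqrt (\<zeta> / (8 * K1))" by linarith+
          have "t\<^sup>2 \<le> \<zeta> / (8 * K1)" using power_mono[OF t(2), of 2] \<zeta> K1 by simp
          then have "real q * t\<^sup>2 \<le> 4 * (K1 * y) * (\<zeta> / (8 * K1))" using q K1 y by (intro mult_mono) auto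
          also have "\<dots> = \<zeta> / 2 * y" using K1 by simp
          finally have "exp ((- \<zeta> / 2) * y) \<le> exp (real q * (- t\<^sup>2))" by simp
          also have "\<dots> = exp (- t\<^sup>2) ^ q" by (rule exp_of_nat_mult)
          also have "\<dots> \<le> cos t ^ q" using cos_bounds(1)[OF t(1)] by (intro power_mono) auto
          finally show ?thesis using True Jp[of "- \<zeta> / 2"] by (simp add: t_def)
        next
          case False
          then show ?thesis using cosq by simp
        qed
        have "real J powr (- \<zeta> / 2) * iid.prob A3 = (\<integral>\<omega>. real J powr (- \<zeta> / 2) * indicator A3 \<omega> \<partial>iid)"
          using sets by simp
        also have "\<dots> \<le> e i"
          unfolding e_def using low cosq sets
          by (intro integral_mono integrable_mult_right iid.integrable_const_bound[of _ 1]) auto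
        finally have "real J powr (- \<zeta> / 2) * (real J powr (- \<gamma>) / 2) \<le> e i"
          using mult_left_mono[OF PA3, of "real J powr (- \<zeta> / 2)"] by simp
        then show ?thesis by (simp add: powr_add[symmetric] add.commute)
      qed
      \<comment> \<open>J terms of size J^(-\<gamma> - \<zeta> / 2) with \<gamma> = 1 - \<zeta> give
        J^(\<zeta> / 2).\<close>
      define \<mu> where "\<mu> = (\<Sum>i\<in>{J..<2 * J}. e i)"
      have \<mu>_ge: "\<mu> \<ge> real J powr (\<zeta> / 2) / 2"
      proof -
        have "real J * (real J powr (- \<gamma> - \<zeta> / 2) / 2) \<le> \<mu>"
          unfolding \<mu>_def using sum_mono[of "{J..<2 * J}" "\<lambda>_. real J powr (- \<gamma> - \<zeta> / 2) / 2" e] e_ge by simp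
        moreover have "real J * real J powr (- \<gamma> - \<zeta> / 2) = real J powr (\<zeta> / 2)"
          using J64 powr_mult_base[of "real J" "- \<gamma> - \<zeta> / 2"] by (simp add: \<zeta>_def field_simps)
        ultimately show ?thesis by simp
      qed
      have "0 < real J powr (\<zeta> / 2)" using J64 by simp
      then have \<mu>0: "\<mu> > 0" using \<mu>_ge by linarith
      define A1 where "A1 = {x. (\<Sum>i\<in>{J..<2 * J}. g i x) \<le> \<mu> / 2}"
      define A2 where "A2 i = {x. \<bar>A.S (Kb i) (\<lambda>_. 1 / sqrt (m i) * sqrt y) x\<bar> \<ge> H * y}" for i
      define A3 where "A3 = {x. A.R W (\<lambda>_. 1) x \<ge> 1}"
      have g_meas[measurable]: "g i \<in> borel_measurable borel" for i unfolding g_def by measurable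
      have g01: "0 \<le> g i x" "g i x \<le> 1" for i x by (simp_all add: g_def cosq)
      have sets: "A1 \<in> sets circ" "\<And>i. A2 i \<in> sets circ" "A3 \<in> sets circ"
        unfolding A1_def A2_def A3_def by measurable
      have P1: "circ.prob A1 \<le> 8 * real J powr (- \<zeta> / 2) + 128 * real J powr (- \<zeta>)"
      proof -
        have "circ.prob A1 \<le> 4 * (\<mu> + 4 * (real J)\<^sup>2 * r J) / \<mu>\<^sup>2"
          unfolding A1_def by (rule circ.second_moment_le[where e = e]) (use g01 J64 e01 r1 r2 \<mu>0 in \<open>auto simp: \<mu>_def\<close>)
        also have "\<dots> \<le> 4 * (\<mu> + 8) / \<mu>\<^sup>2"
        proof -
          have "(real J)\<^sup>2 * r J \<le> 2"
          proof -
            have "(real J)\<^sup>2 * real J powr (- 4) = real J powr (- 2)"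
              using J64 by (simp add: powr_add[symmetric] flip: powr_numeral)
            also have "\<dots> \<le> real J powr 0" using J64 by (intro powr_mono) auto
            finally show ?thesis using J64 by (simp add: r_def)
          qed
          then show ?thesis by (intro divide_right_mono mult_left_mono add_left_mono) (auto simp: mult.commute)
        qed
        also have "\<dots> = 4 * (1 / \<mu>) + 32 * (1 / \<mu>)\<^sup>2" using \<mu>0 by (simp add: power2_eq_square field_simps)
        also have "\<dots> \<le> 4 * (2 * real J powr (- \<zeta> / 2)) + 32 * (2 * real J powr (- \<zeta> / 2))\<^sup>2"
        proof -
          have "1 / \<mu> \<le> 1 / (real J powr (\<zeta> / 2) / 2)" 
            using \<mu>_ge J64 \<mu>0 by (intro divide_left_mono mult_pos_pos) auto
          also have "\<dots> = 2 * real J powr (- \<zeta> / 2)"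
          proof -
            have "real J powr (- \<zeta> / 2) = 1 / real J powr (\<zeta> / 2)"
              using powr_minus_divide[of "real J" "\<zeta> / 2"] by (simp only: minus_divide_left)
            then show ?thesis by simp
          qed
          finally have "1 / \<mu> \<le> 2 * real J powr (- \<zeta> / 2)" .
          then show ?thesis using \<mu>0 by (intro add_mono mult_left_mono power_mono) auto
        qed
        also have "(2 * real J powr (- \<zeta> / 2))\<^sup>2 = 4 * real J powr (- \<zeta>)"
          by (simp add: power2_eq_square powr_add[symmetric])
        finally show ?thesis by simp
      qed
      have P2: "circ.prob (A2 i) \<le> 4 * real J powr (- 3)" if i: "J \<le> i" for i
      proof -
        have "circ.prob (A2 i) \<le> 4 * exp (2 * C\<^sup>2 * (\<Sum>k\<in>Kb i. (1 / sqrt (m i) * sqrt y)\<^sup>2)) * exp (- (H * y))"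
          unfolding A2_def
        proof (rule A.tail_le[OF Kb(1,2) _ _ A.cosh_bound_le[OF Kb(1)]])
          show "0 \<le> H * y" using H y by simp
          have "3 * (H * y) + 1 \<le> 2 * (K * y)"
          proof -
            have "0 \<le> 480 * C\<^sup>2 * K1\<^sup>2 / \<beta>\<^sup>2" by simp
            then have "3 * H + 2 \<le> K" by (simp add: K_def)
            then have "(3 * H + 2) * y \<le> K * y" using y by (intro mult_right_mono) auto
            moreover have "0 \<le> K * y" using K y by simp
            ultimately show ?thesis using y by (simp add: distrib_right)
          qed
          then show "3 * (H * y) + 1 \<le> real (moment_order K J)" using moment_order_ge[of K J] unfolding y_def[symmetric] by linarith
        qed
        also have "\<dots> \<le> 4 * exp (2 * C\<^sup>2 * y) * exp (- (H * y))"
        proof -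
          have "(\<Sum>k\<in>Kb i. (1 / sqrt (m i) * sqrt y)\<^sup>2) = real (card (Kb i)) * (y / m i)"
            using m0[OF i] y by (simp add: power_mult_distrib power_divide)
          also have "\<dots> \<le> m i * (y / m i)" using Kb m0[OF i] y by (intro mult_right_mono) auto
          also have "\<dots> = y" using m0[OF i] by simp
          finally have "2 * C\<^sup>2 * (\<Sum>k\<in>Kb i. (1 / sqrt (m i) * sqrt y)\<^sup>2) \<le> 2 * C\<^sup>2 * y" by (intro mult_left_mono) auto
          then show ?thesis by simp
        qed
        also have "\<dots> = 4 * exp ((- 3) * y)" by (simp add: H_def exp_add[symmetric] algebra_simps)
        finally show ?thesis unfolding Jp .
      qed
      have P3: "circ.prob A3 \<le> E J"
      proof -
        have "circ.prob A3 \<le> (\<integral>x. A.R W (\<lambda>_. 1) x \<partial>circ) / 1"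
          unfolding A3_def by (intro circ.markov_le A.R_integrable) (auto simp: A.R_def sum_nonneg)
        also have "\<dots> \<le> real (card W) * \<delta>" using A.R_le[of W "\<lambda>_. 1"] by (simp add: W_def)
        finally show ?thesis using \<delta>E by linarith
      qed
      have "{x. \<forall>i\<in>{J..<2 * J}. block_sum h i x \<le> (c - 2 * \<eta>) * block_norm h J i} \<subseteq> A1 \<union> (\<Union>i\<in>{J..<2 * J}. A2 i) \<union> A3" (is "?L \<subseteq> ?R")
      proof (rule ccontr)
        assume "\<not> ?L \<subseteq> ?R"
        then obtain x where xL: "x \<in> ?L" and nR: "x \<notin> ?R" by blast
        \<comment> \<open>Here u is at most c - \<eta> and at most H in modulus, so the argument of
          the cosine stays in [-1, 1] and away from 0.\<close>
        have g_le: "g i x \<le> real J powr (- 2)" if i: "i \<in> {J..<2 * J}" for i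
        proof -
          have Ji: "J \<le> i" "i < 2 * J" using i by auto
          have zi: "z i > 0" using z0[OF Ji(1)] .
          have "A.R (block h i) (\<lambda>_. 1) x \<le> A.R W (\<lambda>_. 1) x"
            unfolding A.R_def using blkW[OF Ji(2)] by (intro sum_mono2) (auto simp: W_def)
          moreover have "A.R W (\<lambda>_. 1) x < 1" using nR by (simp add: A3_def not_le)
          moreover have "C * real (card (block h i \<inter> B)) \<le> C * 2 powr (real J / 8)" by (intro mult_left_mono cardB C_nonneg)
          moreover have "\<bar>block_sum h i x - A.S (Kb i) (\<lambda>_. 1) x\<bar> \<le> A.R (block h i) (\<lambda>_. 1) x + C * real (card (block h i \<inter> B))"
            using A.S_approx[OF finite_block, of "\<lambda>_. 1" x h i] by (simp add: Kb_def block_sum_def)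
          ultimately have "\<bar>block_sum h i x - A.S (Kb i) (\<lambda>_. 1) x\<bar> \<le> min \<eta> (\<eta>' / 2) * z i"
            using z_small[OF Ji(1)] by linarith
          also have "\<dots> \<le> \<eta> * z i" using zi by (intro mult_right_mono) auto
          finally have "A.S (Kb i) (\<lambda>_. 1) x \<le> block_sum h i x + \<eta> * z i" by (simp add: abs_le_iff)
          also have "block_sum h i x \<le> (c - 2 * \<eta>) * z i" using xL i by (auto simp: z_def)
          finally have "A.S (Kb i) (\<lambda>_. 1) x \<le> (c - \<eta>) * z i" by (simp add: algebra_simps)
          then have u1: "u i x \<le> c - \<eta>" using zi by (simp add: u_def divide_le_eq)
          have u2: "\<bar>u i x\<bar> \<le> H"
          proof -
            have "x \<notin> A2 i" using nR i by blast
            then have "\<bar>A.S (Kb i) (\<lambda>_. 1 / sqrt (m i) * sqrt y) x\<bar> \<le> H * y" by (simp add: A2_def not_le)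
            also have "A.S (Kb i) (\<lambda>_. 1 / sqrt (m i) * sqrt y) x = (sqrt y * sqrt y) * u i x"
              unfolding A.S_scale[of _ "1 / sqrt (m i) * sqrt y"] u_def z_eq using m0[OF Ji(1)] y by (simp add: real_sqrt_mult field_simps)
            also have "\<dots> = y * u i x" using y by simp
            finally have "y * \<bar>u i x\<bar> \<le> y * H" using y by (simp add: abs_mult mult.commute)
            then show ?thesis using y by simp
          qed
          define t where "t = (u i x - c) / \<beta>"
          have t1: "\<bar>t\<bar> \<le> 1"
          proof -
            have "\<bar>u i x - c\<bar> \<le> \<beta>" using u2 c by (simp add: \<beta>_def abs_le_iff)
            then show ?thesis using \<beta> by (simp add: t_def)
          qed
          have "\<eta> / \<beta> \<le> \<bar>t\<bar>"
          proof -
            have "\<eta> \<le> \<bar>u i x - c\<bar>" using u1 by linarith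
            then show ?thesis using \<beta> by (simp add: t_def divide_right_mono)
          qed
          then have "(\<eta> / \<beta>)\<^sup>2 \<le> \<bar>t\<bar>\<^sup>2" using \<eta> \<beta> by (intro power_mono) auto
          then have t2: "\<eta>\<^sup>2 / \<beta>\<^sup>2 \<le> t\<^sup>2" by (simp add: power_divide)
          have cz: "0 \<le> cos t" using cos_bounds(1)[OF t1] by (rule order_trans[rotated]) simp
          have "g i x = cos t ^ q" by (simp add: g_def t_def)
          also have "\<dots> \<le> exp (- (t\<^sup>2 / 3)) ^ q" using cos_bounds(2)[OF t1] cz by (intro power_mono)
          also have "\<dots> = exp (real q * (- (t\<^sup>2 / 3)))" by (rule exp_of_nat_mult[symmetric])
          also have "\<dots> \<le> exp ((- 2) * y)"
          proof -
            have "2 * y = 2 * (K1 * y) * (\<eta>\<^sup>2 / \<beta>\<^sup>2 / 3)" using \<eta> \<beta> by (simp add: K1_def)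
            also have "\<dots> \<le> real q * (t\<^sup>2 / 3)" using q(1) t2 K1 y by (intro mult_mono) auto
            finally show ?thesis by simp
          qed
          finally show ?thesis unfolding Jp .
        qed
        have "(\<Sum>i\<in>{J..<2 * J}. g i x) \<le> real J * real J powr (- 2)"
          using sum_mono[of "{J..<2 * J}" "\<lambda>i. g i x" "\<lambda>_. real J powr (- 2)"] g_le by simp
        also have "\<dots> < \<mu> / 2" using elim(6) \<mu>_ge by linarith
        finally have "x \<in> A1" by (simp add: A1_def)
        then show False using nR by blast
      qed
      then have "circ.prob ?L \<le> circ.prob ?R" using sets by (intro circ.finite_measure_mono) auto
      also have "\<dots> \<le> circ.prob A1 + circ.prob (\<Union>i\<in>{J..<2 * J}. A2 i) + circ.prob A3"
        using sets by (intro order_trans[OF measure_Un_le] add_right_mono measure_Un_le) auto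
      also have "circ.prob (\<Union>i\<in>{J..<2 * J}. A2 i) \<le> (\<Sum>i\<in>{J..<2 * J}. circ.prob (A2 i))"
        using sets by (intro measure_UNION_le) auto
      also have "\<dots> \<le> (\<Sum>i\<in>{J..<2 * J}. 4 * real J powr (- 3))" by (intro sum_mono P2) auto
      also have "\<dots> = 4 * (real J * real J powr (- 3))" by simp
      also have "real J * real J powr (- 3) = real J powr (- 2)" using J64 powr_mult_base[of "real J" "- 3"] by simp
      finally show ?case using P1 P3 by (simp add: bd_def)
    qed
  qed
  then show ?thesis
    by (intro tendsto_sandwich[OF _ _ tendsto_const bd_lim]) auto
qed

end

section \<open>From block sums to the upper limit\<close>

context weakly_lacunary_lil
begin

text \<open>The event that all blocks from i0 on fail lies in the exceptional event of every large
  window J \<le> i < 2 J, whose probability tends to zero. This takes the place of the second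
  Borel-Cantelli lemma. In the window i / 2 < J, hence the logarithm of i / 2.\<close>

lemma lower_AE:
  assumes h: "h \<ge> 1" and c: "0 < c" "c\<^sup>2 < 2 * v" and \<eta>: "0 < \<eta>" "2 * \<eta> \<le> c"
  shows "AE x in circ. \<forall>i0. \<exists>i\<ge>i0. block_sum h i x > (c - 2 * \<eta>) * sqrt (real (card (block h i)) * ln (real i / 2))"
proof (subst AE_all_countable, intro allI)
  fix i0
  define G where "G J = {x. \<forall>i\<in>{J..<2 * J}. block_sum h i x \<le> (c - 2 * \<eta>) * block_norm h J i}" for J
  define N where "N = {x. \<forall>i\<ge>i0. block_sum h i x \<le> (c - 2 * \<eta>) * sqrt (real (card (block h i)) * ln (real i / 2))}"
  have N_sets: "N \<in> sets circ"
  proof -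
    have "N = (\<Inter>i\<in>{i0..}. {x. block_sum h i x \<le> (c - 2 * \<eta>) * sqrt (real (card (block h i)) * ln (real i / 2))})"
      by (auto simp: N_def)
    also have "\<dots> \<in> sets circ" by (intro sets.countable_INT') auto
    finally show ?thesis .
  qed
  have G_sets: "G J \<in> sets circ" for J
  proof -
    have "G J = {x\<in>space circ. \<forall>i\<in>{J..<2 * J}. block_sum h i x \<le> (c - 2 * \<eta>) * block_norm h J i}" by (simp add: G_def)
    also have "\<dots> \<in> sets circ" by measurable
    finally show ?thesis .
  qed
  have "eventually (\<lambda>J. circ.prob N \<le> circ.prob (G J)) sequentially"
    using eventually_ge_at_top[of "max i0 2"]
  proof eventually_elim
    case (elim J)
    have "N \<subseteq> G J"
    proof
      fix x assume x: "x \<in> N"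
      show "x \<in> G J" unfolding G_def
      proof (intro CollectI ballI)
        fix i assume i: "i \<in> {J..<2 * J}"
        then have "block_sum h i x \<le> (c - 2 * \<eta>) * sqrt (real (card (block h i)) * ln (real i / 2))" using x elim by (auto simp: N_def)
        also have "\<dots> \<le> (c - 2 * \<eta>) * block_norm h J i"
          unfolding block_norm_def using i elim \<eta> by (intro mult_left_mono real_sqrt_le_mono ln_mono) auto
        finally show "block_sum h i x \<le> (c - 2 * \<eta>) * block_norm h J i" .
      qed
    qed
    then show ?case using G_sets by (intro circ.finite_measure_mono)
  qed
  then have "circ.prob N \<le> 0"
    by (rule tendsto_lowerbound[OF prob_no_large_block_tendsto_0[OF h c \<eta>(1), folded G_def]]) simp
  then have "circ.prob N = 0" by (simp add: measure_le_0_iff)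
  then have "AE x in circ. x \<notin> N"
    using N_sets by (subst AE_iff_measurable[of N]) (auto simp: circ.emeasure_eq_measure)
  then show "AE x in circ. \<exists>i\<ge>i0. block_sum h i x > (c - 2 * \<eta>) * sqrt (real (card (block h i)) * ln (real i / 2))"
    by eventually_elim (auto simp: N_def not_le)
qed

definition lil_norm :: "nat \<Rightarrow> real" where "lil_norm N = sqrt (2 * real N * ln (ln (real N)))"

lemma lil_norm_pos: "eventually (\<lambda>N. lil_norm N > 0) sequentially"
  unfolding lil_norm_def by real_asymp

text \<open>
  At the ends \<open>N = 2\<^bsup>h (i + 1)\<^esup>\<close> of exceptionally large blocks, the sum before the block is at most
  \<open>2\<^bsup>- h / 2\<^esup>\<close> times the normalisation by the upper half.
\<close>

lemma lower_limsup_AE: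
  assumes e: "e > 0"
  shows "AE x in circ. \<exists>\<^sub>F N in sequentially. F N x > (sqrt v - e) * lil_norm N"
proof -
  define s where "s = sqrt v"
  have s: "s > 0" "s\<^sup>2 = v" using v_pos by (auto simp: s_def)
  \<comment> \<open>All losses are expressed by one relative tolerance d; with c and \<eta> below, c
    - 2 \<eta> is sqrt 2 times s (1 - 2 d).\<close>
  define d where "d = min (e / (8 * s)) (1 / 8)"
  have d: "d > 0" "d \<le> 1 / 8" "d * s \<le> e / 8" using e s by (auto simp: d_def min_def field_simps)
  define c where "c = sqrt 2 * s * (1 - d)"
  define \<eta> where "\<eta> = sqrt 2 * s * d / 2"
  have c: "0 < c" "c\<^sup>2 < 2 * v"
  proof -
    show "0 < c" using s d by (simp add: c_def)
    have "(1 - d)\<^sup>2 < 1" using d by (simp add: power2_eq_square algebra_simps)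
    then show "c\<^sup>2 < 2 * v" using s v_pos by (simp add: c_def power_mult_distrib)
  qed
  have \<eta>: "0 < \<eta>" "2 * \<eta> \<le> c"
  proof -
    show "0 < \<eta>" using s d by (simp add: \<eta>_def)
    have "sqrt 2 * s * d \<le> sqrt 2 * s * (1 - d)" using s d by (intro mult_left_mono) auto
    then show "2 * \<eta> \<le> c" by (simp add: \<eta>_def c_def)
  qed
  have c\<eta>: "c - 2 * \<eta> = sqrt 2 * (s * (1 - 2 * d))" by (simp add: c_def \<eta>_def algebra_simps)
  \<comment> \<open>A block holds the fraction 1 - 2^(-h) of the indices up to its end, the earlier
    sum the fraction 2^(-h); h is chosen once both effects are negligible.\<close>
  have "((\<lambda>h. s * (1 - 2 * d) * (1 - d) * sqrt (1 - 1 / 2 ^ h) - 2 * s * sqrt (1 / 2 ^ h)) \<longlongrightarrow>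
      s * (1 - 2 * d) * (1 - d) * sqrt (1 - 0) - 2 * s * sqrt 0) sequentially"
    by (intro tendsto_intros) real_asymp+
  moreover have "s - e < s * (1 - 2 * d) * (1 - d) * sqrt (1 - 0) - 2 * s * sqrt 0"
  proof -
    have "s * (1 - 2 * d) * (1 - d) = s - 3 * (d * s) + 2 * (d * d) * s" by (simp add: algebra_simps)
    moreover have "0 \<le> 2 * (d * d) * s" using d s by simp
    ultimately show ?thesis using d e by simp
  qed
  ultimately have "eventually (\<lambda>h. s - e < s * (1 - 2 * d) * (1 - d) * sqrt (1 - 1 / 2 ^ h) - 2 * s * sqrt (1 / 2 ^ h)) sequentially"
    by (rule order_tendstoD(1))
  moreover have "eventually (\<lambda>h::nat. h \<ge> 1) sequentially" by (rule eventually_ge_at_top)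
  ultimately have "eventually (\<lambda>h. s - e < s * (1 - 2 * d) * (1 - d) * sqrt (1 - 1 / 2 ^ h) - 2 * s * sqrt (1 / 2 ^ h) \<and> h \<ge> 1) sequentially"
    by (rule eventually_conj)
  then obtain h where h: "s - e < s * (1 - 2 * d) * (1 - d) * sqrt (1 - 1 / 2 ^ h) - 2 * s * sqrt (1 / 2 ^ h)" "h \<ge> 1"
    by (auto simp: eventually_sequentially)
  from lower_AE[OF h(2) c \<eta>] upper_AE[of 1, simplified]
  show ?thesis
  proof eventually_elim
    case (elim x)
    obtain N1 where N1: "\<And>N. N \<ge> N1 \<Longrightarrow> \<bar>F N x\<bar> \<le> 2 * sqrt v * sqrt (2 * real N * ln (ln (real N)))"
      using elim(2) by (auto simp: eventually_sequentially)
    have hr: "real h > 0" using h by simp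
    \<comment> \<open>For N = 2^(h (i + 1)), ln (ln N) is the logarithm on the left, and its ratio
      to ln (i / 2) tends to 1. Under the root the square becomes a loss of 1 - d.\<close>
    have "eventually (\<lambda>i. (1 - d)\<^sup>2 * ln ((real i + 1) * (real h * ln 2)) \<le> ln (real i / 2)) sequentially"
    proof -
      have "(1 - d)\<^sup>2 < 1" using d by (simp add: power2_eq_square algebra_simps)
      then show ?thesis using hr by real_asymp
    qed
    moreover have "eventually (\<lambda>i. ln (ln ((2::real) ^ (h * i))) > 0 \<and> ln ((2::real) ^ (h * i)) > 0) sequentially"
    proof -
      have "eventually (\<lambda>i. ln (real i * (real h * ln 2)) > 0 \<and> real i * (real h * ln 2) > 0) sequentially"
        using hr by (intro eventually_conj) real_asymp+
      then show ?thesis by eventually_elim (simp add: ln_realpow mult_ac)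
    qed
    ultimately have ev: "eventually (\<lambda>i. (1 - d)\<^sup>2 * ln ((real i + 1) * (real h * ln 2)) \<le> ln (real i / 2) \<and>
        ln (ln ((2::real) ^ (h * i))) > 0 \<and> ln ((2::real) ^ (h * i)) > 0) sequentially"
      by eventually_elim auto
    show ?case
      unfolding frequently_sequentially
    proof
      fix N0
      obtain i1 where i1: "\<And>i. i \<ge> i1 \<Longrightarrow> (1 - d)\<^sup>2 * ln ((real i + 1) * (real h * ln 2)) \<le> ln (real i / 2) \<and>
        ln (ln ((2::real) ^ (h * i))) > 0 \<and> ln ((2::real) ^ (h * i)) > 0"
        using ev by (auto simp: eventually_sequentially)
      obtain i where i: "i \<ge> max (max i1 1) (max N0 N1)"
        and big: "block_sum h i x > (c - 2 * \<eta>) * sqrt (real (card (block h i)) * ln (real i / 2))"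
        using elim(1) by blast
      define M where "M = (2::nat) ^ (h * i)"
      define N where "N = (2::nat) ^ (h * (i + 1))"
      have MN: "M \<le> N" "real M = real N * (1 / 2 ^ h)" by (simp_all add: M_def N_def power_add)
      have cb: "real (card (block h i)) = real N * (1 - 1 / 2 ^ h)"
      proof -
        have "card (block h i) = N - M" by (simp add: card_block N_def M_def)
        then show ?thesis using MN by (simp add: of_nat_diff right_diff_distrib)
      qed
      have ige: "i \<ge> i1" "i \<ge> N0" "i \<ge> N1" "i \<ge> 1" using i by auto
      have iM: "i \<le> M"
      proof -
        have "i \<le> h * i" using h by simp
        also have "\<dots> < 2 ^ (h * i)" by (rule less_exp)
        finally show ?thesis by (simp add: M_def)
      qed
      have pos: "ln (ln (real M)) > 0" "ln (real M) > 0" using i1[OF ige(1)] by (auto simp: M_def)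
      have M1: "real M > 0" by (simp add: M_def)
      have lnMN: "ln (ln (real M)) \<le> ln (ln (real N))"
        using pos MN M1 by (intro ln_mono) auto
      have lnN: "(1 - d)\<^sup>2 * ln (ln (real N)) \<le> ln (real i / 2)"
      proof -
        have "ln (real N) = real (h * (i + 1)) * ln 2" unfolding N_def of_nat_power by (simp only: ln_realpow of_nat_numeral)
        also have "\<dots> = (real i + 1) * (real h * ln 2)" by (simp add: algebra_simps)
        finally show ?thesis using i1[OF ige(1)] by (simp only:)
      qed
      define Y where "Y = lil_norm N"
      have "0 < ln (ln (real N))" "0 < real N" using pos lnMN M1 MN(1) by linarith+
      then have Y: "Y > 0" unfolding Y_def lil_norm_def by (intro real_sqrt_gt_zero mult_pos_pos) auto
      have FM: "\<bar>F M x\<bar> \<le> 2 * s * sqrt (1 / 2 ^ h) * Y"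
      proof -
        have "\<bar>F M x\<bar> \<le> 2 * s * sqrt (2 * real M * ln (ln (real M)))" using N1[of M] iM ige by (simp add: s_def)
        also have "\<dots> \<le> 2 * s * sqrt (2 * real M * ln (ln (real N)))" using s lnMN by (intro mult_left_mono real_sqrt_le_mono) auto
        also have "2 * real M * ln (ln (real N)) = (1 / 2 ^ h) * (2 * real N * ln (ln (real N)))" using MN by simp
        finally show ?thesis unfolding real_sqrt_mult[of "1 / 2 ^ h"] by (simp add: Y_def lil_norm_def mult.assoc)
      qed
      have BL: "s * (1 - 2 * d) * (1 - d) * sqrt (1 - 1 / 2 ^ h) * Y \<le> block_sum h i x"
      proof -
        have "s * (1 - 2 * d) * (1 - d) * sqrt (1 - 1 / 2 ^ h) * Y
          = (c - 2 * \<eta>) * sqrt (real N * (1 - 1 / 2 ^ h) * ((1 - d)\<^sup>2 * ln (ln (real N))))"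
          unfolding c\<eta> Y_def lil_norm_def using d by (simp add: real_sqrt_mult)
        also have "\<dots> \<le> (c - 2 * \<eta>) * sqrt (real (card (block h i)) * ln (real i / 2))"
          unfolding cb using \<eta> lnN by (intro mult_left_mono real_sqrt_le_mono) auto
        finally show ?thesis using big by linarith
      qed
      have "F N x = F M x + block_sum h i x"
      proof -
        have b: "block h i = {M<..N}" unfolding block_def M_def N_def ..
        have "{1..N} = {1..M} \<union> block h i" unfolding b using MN(1) M1 by auto
        moreover have "{1..M} \<inter> block h i = {}" unfolding b by auto
        ultimately show ?thesis by (simp add: F_def block_sum_def sum.union_disjoint finite_block)
      qed
      then have "F N x \<ge> (s * (1 - 2 * d) * (1 - d) * sqrt (1 - 1 / 2 ^ h) - 2 * s * sqrt (1 / 2 ^ h)) * Y"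
        using FM BL unfolding left_diff_distrib by (simp add: abs_le_iff)
      moreover have "(s * (1 - 2 * d) * (1 - d) * sqrt (1 - 1 / 2 ^ h) - 2 * s * sqrt (1 / 2 ^ h)) * Y > (s - e) * Y"
        using h(1) Y by (rule mult_strict_right_mono)
      ultimately have "F N x > (sqrt v - e) * lil_norm N" unfolding Y_def s_def by linarith
      moreover have "N \<ge> N0" using iM ige MN by linarith
      ultimately show "\<exists>N\<ge>N0. F N x > (sqrt v - e) * lil_norm N" by blast
    qed
  qed
qed

text \<open>The tolerances 1 / (k + 1) are countably many, so their null sets can be united before
  passing to the limit.\<close>

theorem lil: "AE x in circ. limsup (\<lambda>N. ereal (F N x / lil_norm N)) = ereal (sqrt v)"
proof -
  have "AE x in circ. \<forall>k::nat. eventually (\<lambda>N. \<bar>F N x\<bar> \<le> (1 + 1 / real (Suc k)) * sqrt v * lil_norm N) sequentially"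
    unfolding lil_norm_def by (subst AE_all_countable) (auto intro!: upper_AE)
  moreover have "AE x in circ. \<forall>k::nat. \<exists>\<^sub>F N in sequentially. F N x > (sqrt v - 1 / real (Suc k)) * lil_norm N"
    by (subst AE_all_countable) (auto intro!: lower_limsup_AE)
  ultimately show ?thesis
  proof eventually_elim
    case (elim x)
    have up: "limsup (\<lambda>N. ereal (F N x / lil_norm N)) \<le> ereal ((1 + 1 / real (Suc k)) * sqrt v)" for k
    proof (rule Limsup_bounded)
      show "eventually (\<lambda>N. ereal (F N x / lil_norm N) \<le> ereal ((1 + 1 / real (Suc k)) * sqrt v)) sequentially"
        using elim(1)[rule_format, of k] lil_norm_pos
        by eventually_elim (simp add: divide_le_eq abs_le_iff)
    qed
    have lo: "ereal (sqrt v - 1 / real (Suc k)) \<le> limsup (\<lambda>N. ereal (F N x / lil_norm N))" for k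
    proof (rule ccontr)
      assume "\<not> ?thesis"
      then have "limsup (\<lambda>N. ereal (F N x / lil_norm N)) < ereal (sqrt v - 1 / real (Suc k))" by simp
      then have "eventually (\<lambda>N. ereal (F N x / lil_norm N) < ereal (sqrt v - 1 / real (Suc k))) sequentially"
        by (rule Limsup_lessD)
      then have "eventually (\<lambda>N. \<not> F N x > (sqrt v - 1 / real (Suc k)) * lil_norm N) sequentially"
        using lil_norm_pos by eventually_elim (simp add: divide_less_eq)
      then show False using elim(2)[rule_format, of k] by (simp add: frequently_def)
    qed
    have "(\<lambda>k. ereal ((1 + 1 / real (Suc k)) * sqrt v)) \<longlonglongrightarrow> ereal ((1 + 0) * sqrt v)"
      unfolding lim_ereal by (intro tendsto_intros) real_asymp
    then have "limsup (\<lambda>N. ereal (F N x / lil_norm N)) \<le> ereal ((1 + 0) * sqrt v)"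
      by (rule LIMSEQ_le_const) (use up in auto)
    moreover have "(\<lambda>k. ereal (sqrt v - 1 / real (Suc k))) \<longlonglongrightarrow> ereal (sqrt v - 0)"
      unfolding lim_ereal by (intro tendsto_intros) real_asymp
    then have "ereal (sqrt v - 0) \<le> limsup (\<lambda>N. ereal (F N x / lil_norm N))"
      by (rule LIMSEQ_le_const2) (use lo in auto)
    ultimately show ?case by simp
  qed
qed

end

section \<open>Passage to Lebesgue measure\<close>

text \<open>The measures differ by completion and by the null point 1, neither of which a Borel
  function detects in distribution.\<close>

lemma distr_lebesgue_on_unit:
  fixes g :: "real \<Rightarrow> real"
  assumes [measurable]: "g \<in> borel_measurable borel"
  shows "distr (lebesgue_on {0..1}) borel g = distr circ borel g"
proof (rule measure_eqI)
  fix A assume "A \<in> sets (distr (lebesgue_on {0..1}) borel g)"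
  then have A[measurable]: "A \<in> sets borel" by simp
  have gA: "g -` A \<in> sets borel" by (rule measurable_sets_borel[OF assms A])
  have gl: "g \<in> borel_measurable (lebesgue_on {0..1})"
    by (intro measurable_restrict_space1 measurable_completion) simp
  have "emeasure (distr (lebesgue_on {0..1}) borel g) A = emeasure (lebesgue_on {0..1}) (g -` A \<inter> {0..1})"
    using gl by (subst emeasure_distr) auto
  also have "\<dots> = emeasure lebesgue (g -` A \<inter> {0..1})"
    by (rule emeasure_restrict_space) auto
  also have "\<dots> = emeasure lborel (g -` A \<inter> {0..1})"
    using gA by (subst emeasure_completion) auto
  also have "\<dots> = emeasure lborel ({0..<1} \<inter> g -` A)"
  proof (rule emeasure_eq_AE)
    show "AE x in lborel. (x \<in> g -` A \<inter> {0..1}) = (x \<in> {0..<1} \<inter> g -` A)"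
      using AE_lborel_singleton[of "1::real"] by eventually_elim auto
  qed (use gA in auto)
  also have "\<dots> = emeasure circ (g -` A)"
    unfolding circ_def using gA by (subst emeasure_uniform_measure) (auto simp: divide_ennreal_def)
  also have "\<dots> = emeasure (distr circ borel g) A"
    by (subst emeasure_distr) auto
  finally show "emeasure (distr (lebesgue_on {0..1}) borel g) A = emeasure (distr circ borel g) A" .
qed simp

lemma integral_lebesgue_on_unit:
  fixes g :: "real \<Rightarrow> real"
  assumes [measurable]: "g \<in> borel_measurable borel"
  shows "(LINT x|lebesgue_on {0..1}. g x) = (\<integral>x. g x \<partial>circ)"
proof -
  have gl: "g \<in> borel_measurable (lebesgue_on {0..1})"
    by (intro measurable_restrict_space1 measurable_completion) simp
  have "(LINT x|lebesgue_on {0..1}. g x) = (\<integral>y. y \<partial>distr (lebesgue_on {0..1}) borel g)"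
    using gl by (subst integral_distr) auto
  also have "\<dots> = (\<integral>x. g x \<partial>circ)"
    unfolding distr_lebesgue_on_unit[OF assms] by (subst integral_distr) auto
  finally show ?thesis .
qed

text \<open>The integer translates of one null set cover all exceptional points, and there are
  countably many.\<close>

lemma AE_lebesgue_periodic:
  assumes AE: "AE x in circ. P x" and per: "\<And>x. P (x + 1) = P x"
  shows "AE x in lebesgue. P (x :: real)"
proof -
  have "AE x in lborel. x \<in> {0..<1} \<longrightarrow> P x"
    using AE unfolding circ_def by (subst (asm) AE_uniform_measure) auto
  then obtain N where N: "{x \<in> space lborel. \<not> (x \<in> {0..<1} \<longrightarrow> P x)} \<subseteq> N" "N \<in> null_sets lborel"
    by (auto simp: eventually_ae_filter)
  have "AE x in lborel. \<forall>m::int. x - of_int m \<notin> N"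
  proof (subst AE_all_countable, intro allI)
    fix m :: int
    have "{x. x - of_int m \<in> N} \<in> null_sets lborel" by (rule null_sets_translation[OF N(2)])
    then have "AE x in lborel. x \<notin> {x. x - of_int m \<in> N}" by (rule AE_not_in)
    then show "AE x in lborel. x - of_int m \<notin> N" by simp
  qed
  then have "AE x in lborel. P x"
  proof eventually_elim
    case (elim x)
    have "frac x \<notin> N" using elim by (simp add: frac_def)
    moreover have "P t" if "0 \<le> t" "t < 1" "t \<notin> N" for t using N(1) that by auto
    ultimately have "P (frac x)" using frac_ge_0 frac_lt_1 by blast
    then show "P x" using periodic_frac[of P, OF per] by simp
  qed
  then show ?thesis by (rule AE_completion)
qed

theorem theorem2:
  fixes \<omega> :: "nat \<Rightarrow> real" and n :: "nat \<Rightarrow> nat" and f :: "real \<Rightarrow> real"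
  assumes omega_pos: "\<And>k. 1 \<le> k \<Longrightarrow> 0 < \<omega> k"
    and omega_mono: "mono_on {1..} \<omega>"
    and omega_lim: "filterlim \<omega> at_top sequentially"
    and n_pos: "\<And>k. 1 \<le> k \<Longrightarrow> 0 < n k"
    and n_distinct: "inj_on n {1..}"
    and cond_A: "condition_A \<omega> n"
    and f_meas: "f \<in> borel_measurable lebesgue"
    and f_periodic: "\<And>x. f (x + 1) = f x"
    and f_mean: "(LINT x|lebesgue_on {0..1}. f x) = 0"
    and f_bv: "total_variation_on 0 1 f < \<infinity>"
  shows "weak_conv_m
           (\<lambda>N. distr (lebesgue_on {0..1}) borel
                  (\<lambda>x. real N powr (- 1 / 2) * (\<Sum>k=1..N. f (real (n k) * x))))
           (centered_normal ((L2_norm01 f)\<^sup>2))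
       \<and> ((\<exists>\<alpha>>0. \<exists>k0\<ge>1. \<forall>k\<ge>k0. \<omega> k \<ge> ln (real k) powr \<alpha>) \<longrightarrow>
          (AE x in lebesgue.
             limsup (\<lambda>N. ereal ((\<Sum>k=1..N. f (real (n k) * x)) / sqrt (2 * real N * ln (ln (real N)))))
               = ereal (L2_norm01 f)))"
proof -
  obtain w V where w: "\<And>x. w (x + 1) = w x + V" "\<And>x y. x \<le> y \<Longrightarrow> \<bar>f y - f x\<bar> \<le> w y - w x"
    using bounded_variation_majorant[OF f_periodic f_bv] by blast
  \<comment> \<open>A difference of the monotone functions f + w and w is Borel measurable, so
    dilations and the Borel measure \<open>circ\<close> can be used.\<close>
  have "mono w" using w(2) by (force simp: mono_def)
  moreover have "mono (\<lambda>x. f x + w x)"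
  proof (rule monoI)
    fix x y :: real assume "x \<le> y"
    then show "f x + w x \<le> f y + w y" using w(2)[of x y] by linarith
  qed
  ultimately have "(\<lambda>x. (f x + w x) - w x) \<in> borel_measurable borel"
    by (intro borel_measurable_diff borel_measurable_mono)
  then have f_borel[measurable]: "f \<in> borel_measurable borel" by simp
  define C where "C = \<bar>f 0\<bar> + (w 1 - w 0)"
  have f_le: "\<bar>f x\<bar> \<le> C" for x
  proof -
    have "0 \<le> frac x" "frac x \<le> 1" using frac_lt_1[of x] by (auto simp: less_imp_le)
    then have "\<bar>f (frac x) - f 0\<bar> \<le> w (frac x) - w 0" "w (frac x) \<le> w 1"
      using w(2)[of 0 "frac x"] \<open>mono w\<close> by (auto simp: mono_def)
    then show ?thesis using periodic_frac[of f, OF f_periodic] by (simp add: C_def)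
  qed
  obtain N0 where N0: "\<And>M s H. M \<ge> N0 \<Longrightarrow> real s \<le> \<omega> M \<Longrightarrow> real H \<le> real M powr \<omega> M \<Longrightarrow>
    \<exists>B. finite B \<and> card B \<le> M \<and> dissociated s H n ({1..} - B)"
    using condition_A_dissociated[OF cond_A n_pos n_distinct] by blast
  interpret W: weakly_lacunary \<omega> n f w C V N0
    by unfold_locales
      (use f_periodic f_le f_mean w n_pos omega_lim N0 integral_lebesgue_on_unit[OF f_borel] in auto)
  have L2: "L2_norm01 f = sqrt W.v"
    unfolding L2_norm01_def W.v_def by (subst integral_lebesgue_on_unit) auto
  have v0: "W.v \<ge> 0" by (simp add: W.v_def)
  have "weak_conv_m (\<lambda>N. distr (lebesgue_on {0..1}) borel (\<lambda>x. real N powr (- 1 / 2) * (\<Sum>k=1..N. f (real (n k) * x))))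
           (centered_normal ((L2_norm01 f)\<^sup>2))"
  proof -
    have "distr (lebesgue_on {0..1}) borel (\<lambda>x. real N powr (- 1 / 2) * (\<Sum>k=1..N. f (real (n k) * x)))
      = distr circ borel (\<lambda>x. real N powr (- 1 / 2) * W.F N x)" for N
      unfolding W.F_def by (rule distr_lebesgue_on_unit) measurable
    then show ?thesis using W.clt v0 by (simp only: L2 real_sqrt_pow2)
  qed
  moreover have "AE x in lebesgue. limsup (\<lambda>N. ereal ((\<Sum>k=1..N. f (real (n k) * x)) / sqrt (2 * real N * ln (ln (real N)))))
               = ereal (L2_norm01 f)"
    if growth: "\<exists>\<alpha>>0. \<exists>k0\<ge>1. \<forall>k\<ge>k0. \<omega> k \<ge> ln (real k) powr \<alpha>"
  proof (rule AE_lebesgue_periodic)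
    have "f (real (n k) * (x + 1)) = f (real (n k) * x)" for k x
      using periodic_add_int[of f "real (n k) * x" "int (n k)", OF f_periodic] by (simp add: distrib_left)
    then show "(limsup (\<lambda>N. ereal ((\<Sum>k=1..N. f (real (n k) * (x + 1))) / sqrt (2 * real N * ln (ln (real N))))) = ereal (L2_norm01 f))
      = (limsup (\<lambda>N. ereal ((\<Sum>k=1..N. f (real (n k) * x)) / sqrt (2 * real N * ln (ln (real N))))) = ereal (L2_norm01 f))" for x
      by simp
    show "AE x in circ. limsup (\<lambda>N. ereal ((\<Sum>k=1..N. f (real (n k) * x)) / sqrt (2 * real N * ln (ln (real N)))))
               = ereal (L2_norm01 f)"
    proof (cases "W.v = 0")
      case True
      \<comment> \<open>With zero variance all summands vanish almost everywhere, and every quotient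
        is 0.\<close>
      have "AE x in circ. \<forall>k. k \<ge> 1 \<longrightarrow> f (real (n k) * x) = 0"
        by (subst AE_all_countable) (use W.f_AE_zero[OF True] n_pos in auto)
      then show ?thesis
      proof eventually_elim
        case (elim x)
        then have "(\<Sum>k=1..N. f (real (n k) * x)) = 0" for N by (intro sum.neutral) auto
        then show ?case by (simp add: L2 True Limsup_const zero_ereal_def[symmetric])
      qed
    next
      case False
      interpret W: weakly_lacunary_lil \<omega> n f w C V N0
      proof
        show "W.v > 0" using False v0 by simp
        fix K :: real
        obtain \<alpha> k0 where \<alpha>: "\<alpha> > 0" "\<And>k. k \<ge> k0 \<Longrightarrow> \<omega> k \<ge> ln (real k) powr \<alpha>" using growth by blast
        \<comment> \<open>Any positive power of ln M outgrows every multiple of ln (ln M).\<close>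
        have "eventually (\<lambda>M. K * ln (ln (real M)) \<le> ln (real M) powr \<alpha>) sequentially" using \<alpha>(1) by real_asymp
        with eventually_ge_at_top[of k0]
        show "eventually (\<lambda>M. \<omega> M \<ge> K * ln (ln (real M))) sequentially"
          by eventually_elim (use \<alpha>(2) order_trans in blast)
      qed
      show ?thesis using W.lil by (simp add: L2 W.F_def W.lil_norm_def)
    qed
  qed
  ultimately show ?thesis by blast
qed

end
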